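(* Let $(\mathbf{X}_t)_{t\in\mathbb{Z}}$ be a strictly stationary $\mathbb{R}^d$-valued sequence that is regularly varying with index $\alpha>0$. Let $C\subset\overline{\mathbb{R}}_0^d$ be a Borel set bounded away from zero such that for every $k=1,2,\dots$ the product $C^k\subset\overline{\mathbb{R}}_0^{dk}$ is a continuity set of $\mu_k$. Suppose that $(\mathbf{X}_t)$ is $\alpha$-mixing with rate function $(\alpha_h)$ and that $m_n,r_n\to\infty$ are integer sequences with $m_n/n\to0$, $r_n/m_n\to0$, $$\lim_{n\to\infty}m_n\sum_{h=r_n}^{\infty}\alpha_h=0,$$ and, for all $\epsilon>0$, $$\lim_{k\to\infty}\limsup_{n\to\infty}m_n\sum_{h=k}^{r_n}P(|\mathbf{X}_h|>\epsilon a_{m_n},\,|\mathbf{X}_0|>\epsilon a_{m_n})=0.$$ Let $f$ be the spectral density, $I_{nC}$ the periodogram and $\widehat f_{nC}$ the lag-window estimator (truncated periodogram, truncated at lag $r_n$) defined in the context. Then $$\lim_{n\to\infty}E I_{nC}(\lambda)=\lim_{n\to\infty}E\widehat f_{nC}(\lambda)=f(\lambda),\qquad\lambda\in(0,\pi).$$ If, in addition, $m_nr_n^2=O(n)$, then also $$\lim_{n\to\infty}E\big[(\widehat f_{nC}(\lambda)-f(\lambda))^2\big]=0,\qquad\lambda\in(0,\pi).$$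
   Context: Notation: $\overline{\mathbb{R}}=\mathbb{R}\cup\{\pm\infty\}$, $\overline{\mathbb{R}}_0^{k}=\overline{\mathbb{R}}^{k}\setminus\{\mathbf 0\}$; a set is bounded away from zero if it is contained in $\{\mathbf{x}:|\mathbf{x}|>\epsilon\}$ for some $\epsilon>0$. Regular variation: a strictly stationary $\mathbb{R}^d$-valued sequence $(\mathbf{X}_t)$ is regularly varying with index $\alpha>0$ if for every $h\ge1$ the lagged vector $\mathbf{Y}_h=\mathrm{vec}(\mathbf{X}_1,\dots,\mathbf{X}_h)$ satisfies, as $x\to\infty$, $$\frac{P(x^{-1}\mathbf{Y}_h\in\cdot)}{P(|\mathbf{Y}_h|>x)}\xrightarrow{v}\mu_h(\cdot)$$ (vague convergence on $\overline{\mathbb{R}}_0^{hd}$) for some non-null Radon measure $\mu_h$ on $\overline{\mathbb{R}}_0^{hd}$ with $\mu_h(tB)=t^{-\alpha}\mu_h(B)$ for all $t>0$ and Borel sets $B$. Let $(a_n)$ be a sequence with $a_n\uparrow\infty$ and $P(|\mathbf{X}_0|>a_n)\sim n^{-1}$. Then for every $h\ge1$, $nP(a_n^{-1}\mathbf{Y}_h\in\cdot)\xrightarrow{v}\nu_h(\cdot)=c_h\mu_h(\cdot)$ for some constant $c_h>0$; we write $\mu=\mu_1=\nu_1$. Mixing: $(\mathbf{X}_t)$ is $\alpha$-mixing with rate function $(\alpha_h)$ if $\alpha_h=\sup\{|P(A\cap B)-P(A)P(B)|:A\in\sigma(\mathbf{X}_s,s\le0),\,B\in\sigma(\mathbf{X}_s,s\ge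 h)\}\to0$ as $h\to\infty$. Spectral quantities: let $\tau_h(C)=\nu_{h+1}(C\times\overline{\mathbb{R}}^{d(h-1)}\times C)$ for $h\ge1$ and $$f(\lambda)=\mu(C)+2\sum_{h=1}^\infty\cos(\lambda h)\,\tau_h(C),\qquad\lambda\in[0,\pi].$$ Let $I_t$ be the indicator of the event $\{\mathbf{X}_t/a_{m_n}\in C\}$, $p_0=P(\mathbf{X}_0/a_{m_n}\in C)$, $\widetilde I_t=I_t-p_0$, and for $h\ge0$ $$\hat\gamma_n(h)=\frac{m_n}{n}\sum_{t=1}^{n-h}\widetilde I_t\widetilde I_{t+h},\qquad \widetilde\gamma_n(h)=\frac{m_n}{n}\sum_{t=1}^{n-h}I_tI_{t+h}.$$ The periodogram and the lag-window estimator are $$I_{nC}(\lambda)=\frac{m_n}{n}\Big|\sum_{t=1}^n\widetilde I_te^{it\lambda}\Big|^2=\hat\gamma_n(0)+2\sum_{h=1}^{n-1}\cos(\lambda h)\hat\gamma_n(h),\qquad \widehat f_{nC}(\lambda)=\hat\gamma_n(0)+2\sum_{h=1}^{r_n}\cos(\lambda h)\widetilde\gamma_n(h).$$ *)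

theory Defs
  imports "HOL-Probability.Probability" "HOL-Library.Landau_Symbols"
begin

section \<open>Vague convergence of Radon measures\<close>

definition borel_on :: "'a topology \<Rightarrow> 'a measure" where
  "borel_on T = sigma (topspace T) {U. openin T U}"

text \<open>The spaces below are locally compact, Hausdorff and second countable, so a Borel measure
  which is finite on compact sets is automatically regular.\<close>

definition radon_measure_on :: "'a topology \<Rightarrow> 'a measure \<Rightarrow> bool" where
  "radon_measure_on T \<mu> \<longleftrightarrow>
     sets \<mu> = sets (borel_on T) \<and> (\<forall>K. compactin T K \<longrightarrow> emeasure \<mu> K < \<infinity>)"

definition compactly_supported_on :: "'a topology \<Rightarrow> ('a \<Rightarrow> real) \<Rightarrow> bool" where
  "compactly_supported_on T g \<longleftrightarrow>
     continuous_map T euclideanreal g \<and>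
     (\<exists>K. compactin T K \<and> (\<forall>x \<in> topspace T - K. g x = 0))"

definition vague_conv :: "'a topology \<Rightarrow> ('i \<Rightarrow> 'a measure) \<Rightarrow> 'a measure \<Rightarrow> 'i filter \<Rightarrow> bool" where
  "vague_conv T \<mu>s \<mu> F \<longleftrightarrow>
     (\<forall>g. compactly_supported_on T g \<longrightarrow>
        ((\<lambda>i. integral\<^sup>L (\<mu>s i) g) \<longlongrightarrow> integral\<^sup>L \<mu> g) F)"

definition continuity_set :: "'a topology \<Rightarrow> 'a measure \<Rightarrow> 'a set \<Rightarrow> bool" where
  "continuity_set T \<mu> S \<longleftrightarrow> emeasure \<mu> (T frontier_of S) = 0"


section \<open>Extended Euclidean spaces\<close>

text \<open>An \<open>hd\<close>-dimensional extended vector is an \<open>h\<close>-tuple, indexed by \<open>{1..h}\<close>, of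
  \<open>d\<close>-dimensional ones.\<close>

definition ext_space :: "nat \<Rightarrow> (nat \<Rightarrow> ereal ^ 'd) topology" where
  "ext_space h = product_topology (\<lambda>_. euclidean) {1..h}"

definition ext_space0 :: "nat \<Rightarrow> (nat \<Rightarrow> ereal ^ 'd) topology" where
  "ext_space0 h = subtopology (ext_space h) (topspace (ext_space h) - {\<lambda>i\<in>{1..h}. 0})"

definition ext_vec :: "real ^ 'd \<Rightarrow> ereal ^ 'd" where
  "ext_vec x = (\<chi> j. ereal (x $ j))"

definition ext_norm :: "ereal ^ 'd \<Rightarrow> ereal" where
  "ext_norm x = (if \<forall>j. \<bar>x $ j\<bar> \<noteq> \<infinity> then ereal (norm (\<chi> j. real_of_ereal (x $ j))) else \<infinity>)"

definition bounded_away_from_zero :: "(ereal ^ 'd) set \<Rightarrow> bool" where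
  "bounded_away_from_zero C \<longleftrightarrow> (\<exists>\<epsilon>::real. \<epsilon> > 0 \<and> (\<forall>x\<in>C. ereal \<epsilon> < ext_norm x))"

definition ext_scale :: "nat \<Rightarrow> real \<Rightarrow> (nat \<Rightarrow> ereal ^ 'd) \<Rightarrow> (nat \<Rightarrow> ereal ^ 'd)" where
  "ext_scale h t x = (\<lambda>i\<in>{1..h}. \<chi> j. ereal t * x i $ j)"


section \<open>Stationary, mixing, regularly varying sequences\<close>

definition strictly_stationary :: "'w measure \<Rightarrow> (int \<Rightarrow> 'w \<Rightarrow> real ^ 'd) \<Rightarrow> bool" where
  "strictly_stationary M X \<longleftrightarrow>
     (\<forall>t. X t \<in> borel_measurable M) \<and>
     (\<forall>J k. finite J \<longrightarrow>
        distr M (\<Pi>\<^sub>M t\<in>J. borel) (\<lambda>w. \<lambda>t\<in>J. X (t + k) w) =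
        distr M (\<Pi>\<^sub>M t\<in>J. borel) (\<lambda>w. \<lambda>t\<in>J. X t w))"

definition gen_events :: "'w measure \<Rightarrow> (int \<Rightarrow> 'w \<Rightarrow> real ^ 'd) \<Rightarrow> int set \<Rightarrow> 'w set set" where
  "gen_events M X S = sigma_sets (space M) (\<Union>s\<in>S. {X s -` B \<inter> space M | B. B \<in> sets borel})"

definition mixing_coeff :: "'w measure \<Rightarrow> (int \<Rightarrow> 'w \<Rightarrow> real ^ 'd) \<Rightarrow> nat \<Rightarrow> real" where
  "mixing_coeff M X h =
     (SUP (A, B) \<in> gen_events M X {..0} \<times> gen_events M X {int h..}.
        \<bar>measure M (A \<inter> B) - measure M A * measure M B\<bar>)"

definition lagged_norm :: "(int \<Rightarrow> 'w \<Rightarrow> real ^ 'd) \<Rightarrow> nat \<Rightarrow> 'w \<Rightarrow> real" where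
  "lagged_norm X h w = L2_set (\<lambda>i. norm (X (int i) w)) {1..h}"

text \<open>The law of \<open>x\<^sup>-\<^sup>1 (X\<^sub>1, \<dots>, X\<^sub>h)\<close>, restricted to the complement of the origin.\<close>

definition lagged_law ::
    "'w measure \<Rightarrow> (int \<Rightarrow> 'w \<Rightarrow> real ^ 'd) \<Rightarrow> nat \<Rightarrow> real \<Rightarrow> (nat \<Rightarrow> ereal ^ 'd) measure" where
  "lagged_law M X h x =
     restrict_space
       (distr M (borel_on (ext_space h)) (\<lambda>w. \<lambda>i\<in>{1..h}. ext_vec ((1 / x) *\<^sub>R X (int i) w)))
       (topspace (ext_space0 h))"

text \<open>The normalisation \<open>1 / P(|Y\<^sub>h| > x)\<close> is \<open>0\<close> when the probability vanishes; then it vanishes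
  for all larger \<open>x\<close> as well and the vague limit is null, which is excluded.\<close>

definition regularly_varying ::
    "'w measure \<Rightarrow> (int \<Rightarrow> 'w \<Rightarrow> real ^ 'd) \<Rightarrow> real \<Rightarrow> (nat \<Rightarrow> (nat \<Rightarrow> ereal ^ 'd) measure) \<Rightarrow> bool"
  where
  "regularly_varying M X \<alpha> \<mu> \<longleftrightarrow>
     \<alpha> > 0 \<and>
     (\<forall>h\<ge>1.
        radon_measure_on (ext_space0 h) (\<mu> h) \<and>
        emeasure (\<mu> h) (space (\<mu> h)) \<noteq> 0 \<and>
        (\<forall>t>0. \<forall>B \<in> sets (\<mu> h).
           emeasure (\<mu> h) (ext_scale h t ` B) = ennreal (t powr (- \<alpha>)) * emeasure (\<mu> h) B) \<and>
        vague_conv (ext_space0 h)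
          (\<lambda>x. scale_measure (ennreal (1 / measure M {w \<in> space M. lagged_norm X h w > x}))
                 (lagged_law M X h x))
          (\<mu> h) at_top)"

definition tail_const ::
    "'w measure \<Rightarrow> (int \<Rightarrow> 'w \<Rightarrow> real ^ 'd) \<Rightarrow> (nat \<Rightarrow> real) \<Rightarrow>
     (nat \<Rightarrow> (nat \<Rightarrow> ereal ^ 'd) measure) \<Rightarrow> nat \<Rightarrow> real" where
  "tail_const M X a \<mu> h =
     (THE c. c > 0 \<and>
        vague_conv (ext_space0 h) (\<lambda>n. scale_measure (of_nat n) (lagged_law M X h (a n)))
          (scale_measure (ennreal c) (\<mu> h)) sequentially)"

definition tail_measure ::
    "'w measure \<Rightarrow> (int \<Rightarrow> 'w \<Rightarrow> real ^ 'd) \<Rightarrow> (nat \<Rightarrow> real) \<Rightarrow>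
     (nat \<Rightarrow> (nat \<Rightarrow> ereal ^ 'd) measure) \<Rightarrow> nat \<Rightarrow> (nat \<Rightarrow> ereal ^ 'd) measure" where
  "tail_measure M X a \<mu> h = scale_measure (ennreal (tail_const M X a \<mu> h)) (\<mu> h)"


section \<open>Spectral density, periodogram and lag-window estimator\<close>

definition tau :: "(nat \<Rightarrow> (nat \<Rightarrow> ereal ^ 'd) measure) \<Rightarrow> (ereal ^ 'd) set \<Rightarrow> nat \<Rightarrow> real" where
  "tau \<nu> C h = measure (\<nu> (h + 1)) (\<Pi>\<^sub>E i\<in>{1..h + 1}. if i = 1 \<or> i = h + 1 then C else UNIV)"

definition spectral_density ::
    "(nat \<Rightarrow> (nat \<Rightarrow> ereal ^ 'd) measure) \<Rightarrow> (ereal ^ 'd) set \<Rightarrow> real \<Rightarrow> real" where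
  "spectral_density \<nu> C \<theta> =
     measure (\<nu> 1) (\<Pi>\<^sub>E i\<in>{1..1}. C) + 2 * (\<Sum>h. cos (\<theta> * real (Suc h)) * tau \<nu> C (Suc h))"

text \<open>In the following, \<open>u\<close> is the threshold \<open>a\<^sub>m\<close> with \<open>m = m\<^sub>n\<close>.\<close>

definition exc :: "(int \<Rightarrow> 'w \<Rightarrow> real ^ 'd) \<Rightarrow> (ereal ^ 'd) set \<Rightarrow> real \<Rightarrow> int \<Rightarrow> 'w \<Rightarrow> real" where
  "exc X C u t w = indicator C (ext_vec ((1 / u) *\<^sub>R X t w))"

definition exc_prob ::
    "'w measure \<Rightarrow> (int \<Rightarrow> 'w \<Rightarrow> real ^ 'd) \<Rightarrow> (ereal ^ 'd) set \<Rightarrow> real \<Rightarrow> real" where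
  "exc_prob M X C u = measure M {w \<in> space M. ext_vec ((1 / u) *\<^sub>R X 0 w) \<in> C}"

definition exc_centered ::
    "'w measure \<Rightarrow> (int \<Rightarrow> 'w \<Rightarrow> real ^ 'd) \<Rightarrow> (ereal ^ 'd) set \<Rightarrow> real \<Rightarrow> int \<Rightarrow> 'w \<Rightarrow> real" where
  "exc_centered M X C u t w = exc X C u t w - exc_prob M X C u"

definition gamma_hat ::
    "'w measure \<Rightarrow> (int \<Rightarrow> 'w \<Rightarrow> real ^ 'd) \<Rightarrow> (ereal ^ 'd) set \<Rightarrow> real \<Rightarrow> nat \<Rightarrow> nat \<Rightarrow> nat \<Rightarrow> 'w \<Rightarrow> real"
  where
  "gamma_hat M X C u m n h w =
     real m / real n *
       (\<Sum>t=1..n - h. exc_centered M X C u (int t) w * exc_centered M X C u (int (t + h)) w)"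

definition gamma_tilde ::
    "(int \<Rightarrow> 'w \<Rightarrow> real ^ 'd) \<Rightarrow> (ereal ^ 'd) set \<Rightarrow> real \<Rightarrow> nat \<Rightarrow> nat \<Rightarrow> nat \<Rightarrow> 'w \<Rightarrow> real" where
  "gamma_tilde X C u m n h w =
     real m / real n * (\<Sum>t=1..n - h. exc X C u (int t) w * exc X C u (int (t + h)) w)"

definition periodogram ::
    "'w measure \<Rightarrow> (int \<Rightarrow> 'w \<Rightarrow> real ^ 'd) \<Rightarrow> (ereal ^ 'd) set \<Rightarrow> real \<Rightarrow> nat \<Rightarrow> nat \<Rightarrow> real \<Rightarrow> 'w \<Rightarrow> real"
  where
  "periodogram M X C u m n \<theta> w =
     real m / real n *
       (cmod (\<Sum>t=1..n. of_real (exc_centered M X C u (int t) w) * exp (\<i> * of_real (real t * \<theta>))))\<^sup>2"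

definition lag_window ::
    "'w measure \<Rightarrow> (int \<Rightarrow> 'w \<Rightarrow> real ^ 'd) \<Rightarrow> (ereal ^ 'd) set \<Rightarrow> real \<Rightarrow> nat \<Rightarrow> nat \<Rightarrow> nat \<Rightarrow> real \<Rightarrow> 'w \<Rightarrow> real"
  where
  "lag_window M X C u m r n \<theta> w =
     gamma_hat M X C u m n 0 w + 2 * (\<Sum>h=1..r. cos (\<theta> * real h) * gamma_tilde X C u m n h w)"

end

theory Submission
  imports Defs
begin

text \<open>
  Vague convergence is first turned into convergence of probabilities. Integrals of continuous
  functions that vanish near the origin, taken under the laws of the scaled lag vectors and multiplied
  by \<open>n\<close>, converge to integrals against the tail measures; the normalising constants
  come from a comparison of the tails of \<open>|Y\<^sub>h|\<close> and of \<open>|X\<^sub>0|\<close> by means of one test function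
  (\<open>scaled_lagged_norm_tendsto\<close>, \<open>tail_const_props\<close>). Continuous functions just inside and just
  outside \<open>C\<close> then show that \<open>n P(X\<^sub>0 / a\<^sub>n \<in> C, X\<^sub>h / a\<^sub>n \<in> C)\<close> converges to
  \<open>\<tau>\<^sub>h(C)\<close>, with \<open>\<tau>\<^sub>0(C) = \<nu>\<^sub>1(C)\<close> (\<open>scaled_prob_pair_tendsto\<close>). The marginals
  of the tail measures agree by stationarity, so the error is governed by the frontier of \<open>C\<close>
  under the one-dimensional measure.

  The two expectations are weighted sums over lags of these probabilities or of the corresponding
  covariances. Each term converges for a fixed lag. Lags between a large \<open>k\<close> and \<open>r\<^sub>n\<close> contribute
  little by anti-clustering, and lags above \<open>r\<^sub>n\<close>, present only in the periodogram, contribute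
  covariances that mixing makes negligible. Since the tails are uniformly small, limit and series may
  be interchanged (\<open>tendsto_suminf_uniform_tail\<close>); the same tail bound gives the summability
  of \<open>\<tau>\<^sub>h(C)\<close>.

  For the mean squared error only the variance of the lag-window estimator remains. It is a
  combination, with coefficients of order \<open>m / n\<close>, of covariances of the events that both
  \<open>t\<close> and \<open>t + h\<close> are exceedance times. Two such events whose first times are more than
  \<open>2 r\<close> apart are separated by more than \<open>r\<close>, and mixing bounds their total by a multiple of
  \<open>(m r\<^sup>2 / n) m \<Sum> \<alpha>\<^sub>h\<close>. The covariance of close events is at most the probability of either one. Using
  an event with lag above \<open>k\<close> whenever there is one, the close pairs contribute at most a
  multiple of \<open>(m r\<^sup>2 / n) m \<Sum> P(X\<^sub>0 / a\<^sub>m \<in> C, X\<^sub>h / a\<^sub>m \<in> C)\<close>, summed over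
  \<open>k \<le> h \<le> r\<close>, and a term of order \<open>(m r / n) (m p\<^sub>0)\<close>
  (\<open>lag_variance_le\<close>). The first is small for large \<open>k\<close>; the second vanishes because
  \<open>m r / n = O(1 / r)\<close>.
\<close>


section \<open>Continuous bump functions on the extended space\<close>

text \<open>A coordinatewise injection of the extended space into Euclidean space. By compactness it is an
  embedding, so it supplies the extended space with a distance, and with it the continuous test
  functions that vague convergence speaks about.\<close>

definition squash_ereal :: "ereal \<Rightarrow> real" where
  "squash_ereal x = (if x = \<infinity> then pi / 2 else if x = - \<infinity> then - pi / 2 else arctan (real_of_ereal x))"

lemma squash_ereal_simps [simp]:
  "squash_ereal (ereal y) = arctan y" "squash_ereal \<infinity> = pi / 2" "squash_ereal (-\<infinity>) = - pi / 2"
  by (simp_all add: squash_ereal_def)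

lemma squash_ereal_strict_mono: "x < y \<Longrightarrow> squash_ereal x < squash_ereal y"
proof (cases x; cases y)
  assume "x = -\<infinity>" "y = \<infinity>"
  then show "squash_ereal x < squash_ereal y"
    using pi_gt_zero by simp
next
  fix r assume "x = ereal r" "y = \<infinity>"
  then show "squash_ereal x < squash_ereal y"
    using arctan_ubound[of r] by simp
next
  fix r assume "x = -\<infinity>" "y = ereal r"
  then show "squash_ereal x < squash_ereal y"
    using arctan_lbound[of r] by simp
qed (auto simp: arctan_less_iff)

lemma inj_squash_ereal: "inj squash_ereal"
  by (rule linorder_injI) (use squash_ereal_strict_mono in force)

lemma squash_ereal_tendsto_PInf: "(squash_ereal \<longlongrightarrow> pi / 2) (nhds \<infinity>)"
proof (rule order_tendstoI)
  fix b :: real assume b: "b < pi / 2"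
  define y where "y = (if b > - pi / 2 then tan b else 0)"
  have y: "b \<le> arctan y"
    using b arctan_tan[of b] by (cases "- pi / 2 < b") (simp_all add: y_def)
  have "\<forall>\<^sub>F x in nhds \<infinity>. ereal y < x"
    using order_tendstoD(1)[OF filterlim_ident, of "ereal y" "\<infinity>"] by simp
  then show "\<forall>\<^sub>F x in nhds \<infinity>. b < squash_ereal x"
  proof eventually_elim
    case (elim x)
    show ?case
    proof (cases x)
      case (real r)
      then have "arctan y < arctan r"
        using elim by (simp add: arctan_less_iff)
      with y real show ?thesis by simp
    qed (use elim b in auto)
  qed
next
  fix b :: real assume b: "pi / 2 < b"
  have "squash_ereal x < b" for x
  proof (cases x)
    case (real r)
    then show ?thesis using b arctan_ubound[of r] by simp
  next
    case MInf
    have "- (pi / 2) < b" using b pi_gt_zero by linarith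
    with MInf show ?thesis by simp
  qed (use b in simp)
  then show "\<forall>\<^sub>F x in nhds \<infinity>. squash_ereal x < b"
    by simp
qed

lemma squash_ereal_uminus: "squash_ereal (- x) = - squash_ereal x"
  by (cases x) (auto simp: arctan_minus)

lemma continuous_squash_ereal: "continuous_on UNIV squash_ereal"
proof -
  have "(squash_ereal \<longlongrightarrow> squash_ereal x) (nhds x)" for x
  proof (cases x)
    case (real r)
    have "((\<lambda>y. arctan y) \<longlongrightarrow> arctan r) (nhds r)"
      by (intro tendsto_arctan filterlim_ident)
    then show ?thesis
      unfolding real nhds_ereal by (simp add: filterlim_filtermap)
  next
    case PInf
    then show ?thesis using squash_ereal_tendsto_PInf by simp
  next
    case MInf
    have "filterlim uminus (nhds \<infinity>) (nhds (-\<infinity> :: ereal))"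
      using tendsto_uminus_ereal[OF filterlim_ident, of "-\<infinity>"] by simp
    then have "((\<lambda>x. squash_ereal (- x)) \<longlongrightarrow> pi / 2) (nhds (-\<infinity>))"
      by (rule filterlim_compose[OF squash_ereal_tendsto_PInf])
    then have "((\<lambda>x. - squash_ereal (- x)) \<longlongrightarrow> - (pi / 2)) (nhds (-\<infinity>))"
      by (rule tendsto_minus)
    then show ?thesis
      unfolding squash_ereal_uminus MInf by simp
  qed
  then show ?thesis
    unfolding continuous_on_def
    by (intro ballI filterlim_mono[OF _ order.refl at_within_le_nhds])
qed

definition squash :: "ereal ^ 'd \<Rightarrow> real ^ 'd" where
  "squash x = (\<chi> j. squash_ereal (x $ j))"

lemma continuous_squash: "continuous_on UNIV squash"
  unfolding squash_def
  by (intro continuous_on_vec_lambda continuous_on_compose2[OF continuous_squash_ereal] continuous_on_component continuous_on_id) auto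

lemma inj_squash: "inj squash"
  unfolding squash_def inj_def vec_eq_iff by (auto dest: injD[OF inj_squash_ereal])

lemma compact_UNIV_ext_vec: "compact (UNIV :: (ereal ^ 'd) set)"
proof -
  have "compact_space (product_topology (\<lambda>_. euclidean) (UNIV :: 'd set) :: ('d \<Rightarrow> ereal) topology)"
    by (rule compact_space_product_topology[THEN iffD2]) (simp add: compact_space_def compact_UNIV)
  then have "compact (UNIV :: ('d \<Rightarrow> ereal) set)"
    by (simp add: euclidean_product_topology compact_space_def)
  moreover have "continuous_on UNIV (vec_lambda :: ('d \<Rightarrow> ereal) \<Rightarrow> ereal ^ 'd)"
    using continuous_on_vec_lambda[where f="\<lambda>j (x::'d \<Rightarrow> ereal). x j"]
    by (simp add: continuous_on_product_coordinates eta_contract_eq)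
  ultimately have "compact (range (vec_lambda :: ('d \<Rightarrow> ereal) \<Rightarrow> ereal ^ 'd))"
    by (rule compact_continuous_image[rotated])
  moreover have "range (vec_lambda :: ('d \<Rightarrow> ereal) \<Rightarrow> ereal ^ 'd) = UNIV"
    by (metis surj_def vec_nth_inverse)
  ultimately show ?thesis by simp
qed

text \<open>A continuous approximation of the indicator of \<open>S\<close> from above. The empty set needs
  its own case because the distance to the empty set is zero by convention.\<close>

definition bump :: "nat \<Rightarrow> (ereal ^ 'd) set \<Rightarrow> ereal ^ 'd \<Rightarrow> real" where
  "bump k S x =
     (if S = {} then 0 else max 0 (1 - real k * infdist (squash x) (squash ` S)))"

lemma continuous_bump: "continuous_on UNIV (bump k S)"
  unfolding bump_def
  by (cases "S = {}") (simp_all add: continuous_on_const continuous_on_max continuous_on_diff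
      continuous_on_mult continuous_on_infdist continuous_squash)

lemma bump_nonneg: "0 \<le> bump k S x"
  and bump_le_1: "bump k S x \<le> 1"
  by (auto simp: bump_def infdist_nonneg)

lemma bump_eq_1: "x \<in> S \<Longrightarrow> bump k S x = 1"
  by (auto simp: bump_def)

lemma bump_antimono: "k \<le> l \<Longrightarrow> bump l S x \<le> bump k S x"
  unfolding bump_def
  by (simp del: max.bounded_iff add: infdist_nonneg mult_right_mono max.mono)

text \<open>The image of a closed set is compact, hence closed, and injectivity keeps the image of
  \<open>x\<close> outside it.\<close>

lemma infdist_squash_pos:
  assumes "closed S" "S \<noteq> {}" "x \<notin> S"
  shows "0 < infdist (squash x) (squash ` S)"
proof -
  have "compact S"
    using compact_Int_closed[OF compact_UNIV_ext_vec assms(1)] by simp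
  then have "closed (squash ` S)"
    by (intro compact_imp_closed compact_continuous_image continuous_on_subset[OF continuous_squash]) auto
  moreover have "squash x \<notin> squash ` S"
    using assms(3) by (auto simp: inj_eq[OF inj_squash])
  ultimately have "infdist (squash x) (squash ` S) \<noteq> 0"
    using in_closed_iff_infdist_zero assms(2) by blast
  then show ?thesis
    using infdist_nonneg[of "squash x" "squash ` S"] by linarith
qed

lemma bump_tendsto_indicator:
  assumes "closed S"
  shows "(\<lambda>k. bump k S x) \<longlonglongrightarrow> indicator S x"
proof (cases "x \<in> S \<or> S = {}")
  case True
  then show ?thesis
  proof
    assume "S = {}"
    then show ?thesis by (simp add: bump_def)
  qed (simp add: bump_eq_1)
next
  case False
  then have pos: "0 < infdist (squash x) (squash ` S)" (is "0 < ?d")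
    using infdist_squash_pos assms by auto
  obtain K :: nat where K: "1 < real K * ?d"
    using reals_Archimedean3[OF pos] by blast
  have "bump k S x = 0" if "K \<le> k" for k
  proof -
    have "real K * ?d \<le> real k * ?d"
      using that pos by (intro mult_right_mono) auto
    with K show ?thesis by (simp add: bump_def)
  qed
  then have "\<forall>\<^sub>F k in sequentially. bump k S x = 0"
    using eventually_sequentially by blast
  then have "(\<lambda>k. bump k S x) \<longlonglongrightarrow> 0"
    by (rule tendsto_eventually)
  then show ?thesis using False by simp
qed

text \<open>The support of a bump shrinks to \<open>S\<close> as \<open>k\<close> grows, so it eventually avoids a
  neighbourhood of the origin. This is what makes bumps around sets bounded away from zero compactly
  supported in the punctured space.\<close>

lemma bump_support:
  assumes "closed S" "0 \<notin> S"
  shows "\<exists>K S'. closed S' \<and> 0 \<notin> S' \<and> (\<forall>k\<ge>K. \<forall>x. x \<notin> S' \<longrightarrow> bump k S x = 0)"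
proof (cases "S = {}")
  case True
  then show ?thesis by (auto simp: bump_def intro!: exI[of _ "{}"])
next
  case False
  then have pos: "0 < infdist (squash 0) (squash ` S)" (is "0 < ?d")
    using infdist_squash_pos assms by auto
  obtain K :: nat where K: "1 < real K * ?d"
    using reals_Archimedean3[OF pos] by blast
  define S' where "S' = {x. real K * infdist (squash x) (squash ` S) \<le> 1}"
  have "closed S'"
    unfolding S'_def
    by (intro closed_Collect_le continuous_intros continuous_squash)
  moreover have "0 \<notin> S'"
    using K by (simp add: S'_def)
  moreover have "bump k S x = 0" if "K \<le> k" "x \<notin> S'" for k x
  proof -
    have "real K * infdist (squash x) (squash ` S) \<le> real k * infdist (squash x) (squash ` S)"
      using that by (intro mult_right_mono) (auto simp: infdist_nonneg)
    then show ?thesis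
      using that(2) by (simp add: bump_def S'_def)
  qed
  ultimately show ?thesis by blast
qed

lemma closed_singleton_0: "closed {0 :: ereal ^ 'd}"
proof -
  have "{0 :: ereal ^ 'd} = squash -` {squash 0}"
    by (auto simp: inj_eq[OF inj_squash])
  moreover have "closed (squash -` {squash (0 :: ereal ^ 'd)})"
    using continuous_squash by (intro closed_vimage) auto
  ultimately show ?thesis by simp
qed


section \<open>Borel sets and Radon measures on the extended product spaces\<close>

text \<open>A scaled measure has constant density with respect to the original one.\<close>

lemma integral_scale_measure_ennreal:
  fixes f :: "'a \<Rightarrow> real"
  assumes "0 \<le> c" "f \<in> borel_measurable M"
  shows "integral\<^sup>L (scale_measure (ennreal c) M) f = c * integral\<^sup>L M f"
proof -
  have "scale_measure (ennreal c) M = density M (\<lambda>_. ennreal c)"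
    by (rule measure_eqI) (simp_all add: emeasure_density nn_integral_cmult_indicator)
  then show ?thesis
    using integral_density[of f M "\<lambda>_. c"] assms by simp
qed

lemma space_borel_on [simp]: "space (borel_on T) = topspace T"
  by (simp add: borel_on_def space_measure_of_conv)

lemma sets_borel_on: "sets (borel_on T) = sigma_sets (topspace T) {U. openin T U}"
  unfolding borel_on_def by (rule sets_measure_of) (auto dest: openin_subset)

lemma openin_borel_on: "openin T U \<Longrightarrow> U \<in> sets (borel_on T)"
  by (simp add: sets_borel_on sigma_sets.Basic)

lemma borel_measurable_continuous_map:
  fixes f :: "'a \<Rightarrow> 'b :: topological_space"
  assumes "continuous_map T euclidean f"
  shows "f \<in> borel_measurable (borel_on T)"
proof (rule borel_measurableI)
  fix S :: "'b set" assume "open S"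
  then have "openin T {x \<in> topspace T. f x \<in> S}"
    by (intro openin_continuous_map_preimage[OF assms]) simp
  moreover have "f -` S \<inter> space (borel_on T) = {x \<in> topspace T. f x \<in> S}"
    by auto
  ultimately show "f -` S \<inter> space (borel_on T) \<in> sets (borel_on T)"
    using openin_borel_on by simp
qed

lemma measurable_borel_on:
  assumes "\<And>w. w \<in> space M \<Longrightarrow> f w \<in> topspace T"
    and "\<And>U. openin T U \<Longrightarrow> f -` U \<inter> space M \<in> sets M"
  shows "f \<in> measurable M (borel_on T)"
  unfolding borel_on_def
  by (rule measurable_sigma_sets[OF sets_measure_of]) (use assms in \<open>auto dest: openin_subset\<close>)

lemma compact_space_ext_space: "compact_space (ext_space h :: (nat \<Rightarrow> ereal ^ 'd) topology)"
  unfolding ext_space_def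
  by (rule compact_space_product_topology[THEN iffD2]) (simp add: compact_space_def compact_UNIV_ext_vec)

lemma topspace_ext_space: "topspace (ext_space h) = (\<Pi>\<^sub>E i\<in>{1..h}. UNIV)"
  by (simp add: ext_space_def topspace_product_topology)

lemma topspace_ext_space0: "topspace (ext_space0 h) = topspace (ext_space h) - {\<lambda>i\<in>{1..h}. 0}"
  by (auto simp: ext_space0_def)

lemma continuous_map_ext_space_coord:
  "i \<in> {1..h} \<Longrightarrow> continuous_map (ext_space h) euclidean (\<lambda>x. x i)"
  unfolding ext_space_def by (rule continuous_map_product_coordinates)

lemma continuous_map_ext_space_compose_coord:
  assumes "continuous_on UNIV f" "i \<in> {1..h}"
  shows "continuous_map (ext_space h) euclidean (\<lambda>x. f (x i))"
  using continuous_map_compose[OF continuous_map_ext_space_coord[OF assms(2)], of euclidean f] assms(1)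
  by (simp add: comp_def)

lemma continuous_map_ext_space0:
  "continuous_map (ext_space h) T f \<Longrightarrow> continuous_map (ext_space0 h) T f"
  unfolding ext_space0_def by (rule continuous_map_from_subtopology)

text \<open>A nonzero tuple has a nonzero coordinate, and being nonzero is an open condition on each
  coordinate.\<close>

lemma openin_ext_space0: "openin (ext_space h) (topspace (ext_space0 h :: (nat \<Rightarrow> ereal ^ 'd) topology))"
proof -
  have "topspace (ext_space0 h :: (nat \<Rightarrow> ereal ^ 'd) topology) =
      (\<Union>i\<in>{1..h}. {x \<in> topspace (ext_space h). x i \<in> - {0}})"
    by (auto simp: topspace_ext_space0 topspace_ext_space PiE_def extensional_def fun_eq_iff restrict_def)
  moreover have "openin (ext_space h) {x \<in> topspace (ext_space h). x i \<in> - {0 :: ereal ^ 'd}}"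
    if "i \<in> {1..h}" for i
  proof (rule openin_continuous_map_preimage[OF continuous_map_ext_space_coord[OF that]])
    show "openin euclidean (- {0 :: ereal ^ 'd})"
      using open_Compl[OF closed_singleton_0] by simp
  qed
  ultimately show ?thesis by auto
qed

text \<open>The full extended space is compact, and a closed set of tuples one of whose coordinates stays
  off the origin misses the puncture.\<close>

lemma compactin_ext_space0:
  fixes S :: "(ereal ^ 'd) set"
  assumes "closed S" "0 \<notin> S" "i \<in> {1..h}"
  shows "compactin (ext_space0 h) {x \<in> topspace (ext_space h). x i \<in> S}"
proof -
  have "closedin (ext_space h) {x \<in> topspace (ext_space h). x i \<in> S}"
    using closedin_continuous_map_preimage[OF continuous_map_ext_space_coord[OF assms(3)], of S] assms(1)
    by simp
  then have "compactin (ext_space h) {x \<in> topspace (ext_space h). x i \<in> S}"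
    by (rule closedin_compact_space[OF compact_space_ext_space])
  then show ?thesis
    using assms(2,3) by (auto simp: ext_space0_def compactin_subtopology)
qed

text \<open>One factor that localises a single coordinate away from the origin makes the whole product
  a test function, whatever continuous function the other factor is. The test functions below all
  have this form.\<close>

lemma compactly_supported_coord:
  fixes f :: "ereal ^ 'd \<Rightarrow> real"
  assumes "continuous_on UNIV f" "closed S" "0 \<notin> S" "\<And>x. x \<notin> S \<Longrightarrow> f x = 0" "i \<in> {1..h}"
    and "continuous_map (ext_space h) euclideanreal G"
  shows "compactly_supported_on (ext_space0 h) (\<lambda>x. f (x i) * G x)"
  unfolding compactly_supported_on_def
proof (intro conjI exI)
  show "continuous_map (ext_space0 h) euclideanreal (\<lambda>x. f (x i) * G x)"
    by (intro continuous_map_ext_space0 continuous_map_real_mult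
        continuous_map_ext_space_compose_coord assms)
  show "compactin (ext_space0 h) {x \<in> topspace (ext_space h). x i \<in> S}"
    by (rule compactin_ext_space0) fact+
  show "\<forall>x \<in> topspace (ext_space0 h) - {x \<in> topspace (ext_space h). x i \<in> S}. f (x i) * G x = 0"
    using assms(4) by (auto simp: topspace_ext_space0)
qed

lemma emeasure_coord_finite:
  assumes "radon_measure_on (ext_space0 h) \<nu>" "closed S" "0 \<notin> S" "i \<in> {1..h}"
  shows "emeasure \<nu> {x \<in> topspace (ext_space h). x i \<in> S} < \<infinity>"
  using compactin_ext_space0[OF assms(2-4)] assms(1) by (auto simp: radon_measure_on_def)

lemma measurable_radon:
  assumes "radon_measure_on (ext_space0 h) \<nu>" "continuous_map (ext_space0 h) euclidean f"
  shows "f \<in> borel_measurable \<nu>"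
  using borel_measurable_continuous_map[OF assms(2)] assms(1)
  by (simp add: radon_measure_on_def cong: measurable_cong_sets)

lemma space_radon: "radon_measure_on T \<nu> \<Longrightarrow> space \<nu> = topspace T"
  by (metis radon_measure_on_def sets_eq_imp_space_eq space_borel_on)

text \<open>A bounded function that vanishes unless one coordinate lies in a closed set off the origin is
  dominated by the indicator of a compact set, which a Radon measure makes finite.\<close>

lemma integrable_radon:
  fixes g :: "(nat \<Rightarrow> ereal ^ 'd) \<Rightarrow> real"
  assumes \<nu>: "radon_measure_on (ext_space0 h) \<nu>" and S: "closed S" "0 \<notin> S" "i \<in> {1..h}"
    and g: "g \<in> borel_measurable \<nu>" "\<And>x. \<bar>g x\<bar> \<le> 1" "\<And>x. x i \<notin> S \<Longrightarrow> g x = 0"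
  shows "integrable \<nu> g"
proof -
  let ?K = "{x \<in> topspace (ext_space h). x i \<in> S}"
  have "?K = (\<lambda>x. x i) -` S \<inter> space \<nu>"
    using S by (auto simp: space_radon[OF \<nu>] topspace_ext_space0)
  then have "?K \<in> sets \<nu>"
    using measurable_sets[OF measurable_radon[OF \<nu> continuous_map_ext_space0[OF continuous_map_ext_space_coord[OF S(3)]]] borel_closed[OF S(1)]]
    by simp
  then have "integrable \<nu> (indicator ?K :: _ \<Rightarrow> real)"
    using emeasure_coord_finite[OF \<nu> S] by (simp add: integrable_indicator_iff)
  then show ?thesis
  proof (rule Bochner_Integration.integrable_bound[OF _ g(1)], intro AE_I2)
    fix x assume "x \<in> space \<nu>"
    then have "x \<in> topspace (ext_space h)"
      by (auto simp: space_radon[OF \<nu>] topspace_ext_space0)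
    then show "norm (g x) \<le> norm (indicator ?K x :: real)"
      using g(2)[of x] g(3)[of x] by (cases "x i \<in> S") simp_all
  qed
qed


section \<open>Scaled lag vectors of a stationary sequence\<close>

lemma continuous_ext_vec: "continuous_on UNIV (ext_vec :: real ^ 'd \<Rightarrow> ereal ^ 'd)"
  unfolding ext_vec_def
  by (intro continuous_on_vec_lambda continuous_on_ereal continuous_on_component continuous_on_id)

lemma measurable_ext_vec [measurable]: "ext_vec \<in> borel_measurable borel"
  by (rule borel_measurable_continuous_onI[OF continuous_ext_vec])

lemma ext_norm_ext_vec: "ext_norm (ext_vec x) = ereal (norm x)"
  by (simp add: ext_norm_def ext_vec_def)

definition scaled_lag ::
  "(int \<Rightarrow> 'w \<Rightarrow> real ^ 'd) \<Rightarrow> nat \<Rightarrow> real \<Rightarrow> 'w \<Rightarrow> nat \<Rightarrow> ereal ^ 'd" where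
  "scaled_lag X h x w = (\<lambda>i\<in>{1..h}. ext_vec ((1 / x) *\<^sub>R X (int i) w))"

lemma scaled_lag_topspace: "scaled_lag X h x w \<in> topspace (ext_space h)"
  by (simp add: scaled_lag_def topspace_ext_space)

lemma scaled_lag_coord: "i \<in> {1..h} \<Longrightarrow> scaled_lag X h x w i = ext_vec ((1 / x) *\<^sub>R X (int i) w)"
  by (simp add: scaled_lag_def)

text \<open>Open sets of the product are arbitrary unions of open boxes, so measurable coordinates alone
  settle nothing. The vector is factored through \<open>nat \<Rightarrow> 'd \<Rightarrow> ereal\<close>: that function space is second
  countable, which makes coordinatewise measurability enough, and the passage from it to
  \<open>ext_space h\<close> is continuous.\<close>

lemma measurable_scaled_lag:
  fixes X :: "int \<Rightarrow> 'w \<Rightarrow> real ^ 'd"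
  assumes X [measurable]: "\<And>t. X t \<in> borel_measurable M"
  shows "scaled_lag X h x \<in> measurable M (borel_on (ext_space h))"
proof (rule measurable_borel_on[OF scaled_lag_topspace])
  define \<Phi> :: "(nat \<Rightarrow> 'd \<Rightarrow> ereal) \<Rightarrow> nat \<Rightarrow> ereal ^ 'd" where
    "\<Phi> f = (\<lambda>i\<in>{1..h}. \<chi> j. f i j)" for f
  define Y where "Y w = (\<lambda>(i::nat) (j::'d). ereal (((1 / x) *\<^sub>R X (int i) w) $ j))" for w
  have *: "continuous_on UNIV (\<lambda>f. \<chi> j. (f :: nat \<Rightarrow> 'd \<Rightarrow> ereal) i j)" for i
    by (rule continuous_on_vec_lambda,
        rule continuous_on_product_then_coordinatewise[OF continuous_on_product_coordinates])
  have cont: "continuous_map euclidean (ext_space h) \<Phi>"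
    unfolding ext_space_def continuous_map_componentwise
  proof (intro conjI ballI)
    show "\<Phi> ` topspace euclidean \<subseteq> extensional {1..h}"
      by (auto simp: \<Phi>_def)
    fix i assume "i \<in> {1..h}"
    then have "(\<lambda>f. \<Phi> f i) = (\<lambda>f. \<chi> j. f i j)"
      by (simp add: \<Phi>_def)
    then show "continuous_map euclidean euclidean (\<lambda>f. \<Phi> f i)"
      using * by simp
  qed
  have "(\<lambda>w. ereal (((1 / x) *\<^sub>R X (int i) w) $ j)) \<in> borel_measurable M" for i j
    by (rule measurable_compose[OF X, of "\<lambda>v. ereal (((1 / x) *\<^sub>R v) $ j)"],
        rule borel_measurable_continuous_onI)
      (intro continuous_on_ereal continuous_on_component continuous_intros)
  then have Y: "Y \<in> borel_measurable M"
    unfolding Y_def by (intro measurable_coordinatewise_then_product)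
  fix U :: "(nat \<Rightarrow> ereal ^ 'd) set" assume "openin (ext_space h) U"
  then have "open (\<Phi> -` U)"
    using openin_continuous_map_preimage[OF cont, of U] by (simp add: vimage_def)
  then have "Y -` (\<Phi> -` U) \<inter> space M \<in> sets M"
    using Y by (intro measurable_sets[OF Y]) simp
  moreover have "scaled_lag X h x w = \<Phi> (Y w)" for w
    by (simp add: scaled_lag_def \<Phi>_def Y_def ext_vec_def)
  ultimately show "scaled_lag X h x -` U \<inter> space M \<in> sets M"
    by (simp add: vimage_def)
qed

lemma lagged_law_eq:
  "lagged_law M X h x =
     restrict_space (distr M (borel_on (ext_space h)) (scaled_lag X h x)) (topspace (ext_space0 h))"
  by (simp add: lagged_law_def scaled_lag_def[abs_def])

text \<open>A function continuous on the punctured space only is measurable for the restricted law, since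
  relatively open sets are traces of open sets.\<close>

lemma measurable_lagged_law:
  fixes G :: "(nat \<Rightarrow> ereal ^ 'd) \<Rightarrow> real"
  assumes "continuous_map (ext_space0 h) euclideanreal G"
  shows "G \<in> borel_measurable (lagged_law M X h x)"
proof (rule borel_measurableI)
  let ?\<Omega> = "topspace (ext_space0 h :: (nat \<Rightarrow> ereal ^ 'd) topology)"
  have eq: "ext_space0 h = subtopology (ext_space h) ?\<Omega>"
    unfolding topspace_ext_space0 by (rule ext_space0_def)
  fix S :: "real set" assume "open S"
  then have "openin (ext_space0 h) {x \<in> ?\<Omega>. G x \<in> S}"
    by (intro openin_continuous_map_preimage[OF assms]) simp
  then have "openin (subtopology (ext_space h) ?\<Omega>) {x \<in> ?\<Omega>. G x \<in> S}"
    using eq by simp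
  then obtain V where V: "openin (ext_space h) V" "{x \<in> ?\<Omega>. G x \<in> S} = V \<inter> ?\<Omega>"
    by (auto simp only: openin_subtopology)
  have "?\<Omega> \<inter> V \<in> sets (lagged_law M X h x)"
    using openin_borel_on[OF V(1)] by (auto simp: lagged_law_eq sets_restrict_space)
  moreover have "G -` S \<inter> space (lagged_law M X h x) = ?\<Omega> \<inter> V"
    using V(2) by (auto simp: lagged_law_eq space_restrict_space topspace_ext_space0)
  ultimately show "G -` S \<inter> space (lagged_law M X h x) \<in> sets (lagged_law M X h x)"
    by simp
qed

text \<open>A function that vanishes at the origin does not see the restriction to the punctured space, so
  its integral is a plain expectation of the scaled lag vector.\<close>

lemma integral_lagged_law:
  fixes X :: "int \<Rightarrow> 'w \<Rightarrow> real ^ 'd" and G :: "(nat \<Rightarrow> ereal ^ 'd) \<Rightarrow> real"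
  assumes X: "\<And>t. X t \<in> borel_measurable M"
    and G: "continuous_map (ext_space h) euclideanreal G" "G (\<lambda>i\<in>{1..h}. 0) = 0"
  shows "integral\<^sup>L (lagged_law M X h x) G = (\<integral>w. G (scaled_lag X h x w) \<partial>M)"
proof -
  let ?D = "distr M (borel_on (ext_space h)) (scaled_lag X h x)"
  let ?\<Omega> = "topspace (ext_space0 h :: (nat \<Rightarrow> ereal ^ 'd) topology)"
  have "?\<Omega> \<inter> space ?D \<in> sets ?D"
    using openin_borel_on[OF openin_ext_space0] by (auto simp: topspace_ext_space0 Int_absorb2 Diff_subset)
  then have "integral\<^sup>L (lagged_law M X h x) G = (\<integral>y. indicator ?\<Omega> y *\<^sub>R G y \<partial>?D)"
    unfolding lagged_law_eq by (rule integral_restrict_space)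
  also have "\<dots> = (\<integral>y. G y \<partial>?D)"
    using G(2) by (intro Bochner_Integration.integral_cong) (auto simp: topspace_ext_space0 indicator_def)
  also have "\<dots> = (\<integral>w. G (scaled_lag X h x w) \<partial>M)"
    by (rule integral_distr[OF measurable_scaled_lag[OF X] borel_measurable_continuous_map[OF G(1)]])
  finally show ?thesis .
qed

locale stationary_sequence = prob_space M for M :: "'w measure" +
  fixes X :: "int \<Rightarrow> 'w \<Rightarrow> real ^ 'd"
  assumes stationary: "strictly_stationary M X"
begin

lemma measurable_X [measurable]: "X t \<in> borel_measurable M"
  using stationary by (simp add: strictly_stationary_def)

lemma prob_shift:
  assumes J: "finite J" and B: "\<And>t. t \<in> J \<Longrightarrow> B t \<in> sets borel"
  shows "prob {w \<in> space M. \<forall>t\<in>J. X (t + k) w \<in> B t} = prob {w \<in> space M. \<forall>t\<in>J. X t w \<in> B t}"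
proof -
  have *: "prob {w \<in> space M. \<forall>t\<in>J. X (t + l) w \<in> B t} =
      measure (distr M (\<Pi>\<^sub>M t\<in>J. borel) (\<lambda>w. \<lambda>t\<in>J. X (t + l) w)) (\<Pi>\<^sub>E t\<in>J. B t)" for l
  proof -
    have "(\<lambda>w. \<lambda>t\<in>J. X (t + l) w) -` (\<Pi>\<^sub>E t\<in>J. B t) \<inter> space M = {w \<in> space M. \<forall>t\<in>J. X (t + l) w \<in> B t}"
      by (auto simp: PiE_iff)
    moreover have "(\<Pi>\<^sub>E t\<in>J. B t) \<in> sets (\<Pi>\<^sub>M t\<in>J. borel)"
      using J B by (intro sets_PiM_I_finite) auto
    ultimately show ?thesis
      by (subst measure_distr) (auto intro!: measurable_restrict)
  qed
  show ?thesis
    using *[of k] *[of 0] stationary J by (simp add: strictly_stationary_def)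
qed

lemma distr_eq: "distr M borel (X i) = distr M borel (X j)"
proof (rule measure_eqI)
  fix B :: "(real ^ 'd) set" assume "B \<in> sets (distr M borel (X i))"
  then have B: "B \<in> sets borel" by simp
  have "emeasure (distr M borel (X t)) B = ennreal (prob {w \<in> space M. X t w \<in> B})" for t
    using B by (simp add: emeasure_distr emeasure_eq_measure vimage_def Int_def conj_commute)
  moreover have "prob {w \<in> space M. X i w \<in> B} = prob {w \<in> space M. X j w \<in> B}"
    using prob_shift[of "{j}" "\<lambda>_. B" "i - j"] B by simp
  ultimately show "emeasure (distr M borel (X i)) B = emeasure (distr M borel (X j)) B"
    by simp
qed simp

lemma expectation_eq:
  fixes g :: "real ^ 'd \<Rightarrow> real"
  assumes "g \<in> borel_measurable borel"
  shows "expectation (\<lambda>w. g (X i w)) = expectation (\<lambda>w. g (X j w))"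
  using distr_eq[of i j] integral_distr[OF measurable_X assms, of i] integral_distr[OF measurable_X assms, of j]
  by simp

lemma prob_marginal_eq:
  assumes "B \<in> sets borel"
  shows "prob {w \<in> space M. X i w \<in> B} = prob {w \<in> space M. X j w \<in> B}"
  using prob_shift[of "{j}" "\<lambda>_. B" "i - j"] assms by simp

end


section \<open>Tail measures of a regularly varying sequence\<close>

text \<open>For positive \<open>\<delta>\<close>, the complement of an open cube around the origin: a closed set that
  avoids the origin, and large enough to contain everything of norm at least a fixed multiple of \<open>\<delta>\<close>.\<close>

definition away_set :: "real \<Rightarrow> (ereal ^ 'd) set" where
  "away_set \<delta> = {x. \<exists>j. ereal \<delta> \<le> \<bar>x $ j\<bar>}"

lemma closed_away_set: "closed (away_set \<delta> :: (ereal ^ 'd) set)"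
proof -
  have "closed {x :: ereal ^ 'd. ereal \<delta> \<le> \<bar>x $ j\<bar>}" for j
  proof -
    have "ereal \<delta> \<le> \<bar>y\<bar> \<longleftrightarrow> ereal \<delta> \<le> y \<or> y \<le> ereal (- \<delta>)" for y
      by (cases y) auto
    then have "{x :: ereal ^ 'd. ereal \<delta> \<le> \<bar>x $ j\<bar>} =
        {x. ereal \<delta> \<le> x $ j} \<union> {x. x $ j \<le> ereal (- \<delta>)}"
      by blast
    then show ?thesis
      by (simp add: closed_Un closed_Collect_le continuous_on_component continuous_on_id continuous_on_const)
  qed
  then have "closed (\<Union>j. {x :: ereal ^ 'd. ereal \<delta> \<le> \<bar>x $ j\<bar>})"
    by (intro closed_UN) auto
  moreover have "away_set \<delta> = (\<Union>j. {x :: ereal ^ 'd. ereal \<delta> \<le> \<bar>x $ j\<bar>})"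
    by (auto simp: away_set_def)
  ultimately show ?thesis by simp
qed

lemma zero_notin_away_set: "0 < \<delta> \<Longrightarrow> 0 \<notin> away_set \<delta>"
  by (simp add: away_set_def)

lemma ext_vec_in_away_set:
  fixes x :: "real ^ 'd"
  assumes "real CARD('d) * \<delta> \<le> norm x"
  shows "ext_vec x \<in> away_set \<delta>"
proof (rule ccontr)
  assume "ext_vec x \<notin> away_set \<delta>"
  then have "\<bar>x $ j\<bar> < \<delta>" for j
    by (auto simp: away_set_def ext_vec_def not_le)
  then have "(\<Sum>j\<in>UNIV. \<bar>x $ j\<bar>) < real CARD('d) * \<delta>"
    using sum_strict_mono[of UNIV "\<lambda>j. \<bar>x $ j\<bar>" "\<lambda>_. \<delta>"] by simp
  then show False
    using norm_le_l1_cart[of x] assms by linarith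
qed

locale regularly_varying_sequence = stationary_sequence M X
  for M :: "'w measure" and X :: "int \<Rightarrow> 'w \<Rightarrow> real ^ 'd" +
  fixes \<alpha> :: real and \<mu> :: "nat \<Rightarrow> (nat \<Rightarrow> ereal ^ 'd) measure" and a :: "nat \<Rightarrow> real"
  assumes regularly_varying: "regularly_varying M X \<alpha> \<mu>"
    and a_at_top: "filterlim a at_top sequentially"
    and tail: "asymp_equiv (\<lambda>n. measure M {w \<in> space M. norm (X 0 w) > a n}) at_top (\<lambda>n. 1 / real n)"
begin

lemma eventually_a_pos: "\<forall>\<^sub>F n in sequentially. 0 < a n"
  using a_at_top by (simp add: filterlim_at_top_dense)

lemma radon_\<mu>: "h \<ge> 1 \<Longrightarrow> radon_measure_on (ext_space0 h) (\<mu> h)"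
  using regularly_varying by (simp add: regularly_varying_def)

lemma scaled_tail_tendsto: "(\<lambda>n. real n * prob {w \<in> space M. norm (X 0 w) > a n}) \<longlonglongrightarrow> 1"
proof -
  have "(\<lambda>n. prob {w \<in> space M. norm (X 0 w) > a n} / (1 / real n)) \<longlonglongrightarrow> 1"
    by (rule asymp_equivD_strong[OF tail]) (auto intro: eventually_sequentiallyI[of 1])
  then show ?thesis
    by (simp add: mult.commute)
qed

lemma scaled_tail_pos: "\<forall>\<^sub>F n in sequentially. 0 < real n * prob {w \<in> space M. norm (X 0 w) > a n}"
  by (rule order_tendstoD(1)[OF scaled_tail_tendsto]) simp

lemma prob_norm_eq: "prob {w \<in> space M. norm (X i w) > x} = prob {w \<in> space M. norm (X j w) > x}"
  using prob_marginal_eq[of "{v. norm v > x}" i j] by simp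

lemma measurable_lagged_norm [measurable]: "lagged_norm X h \<in> borel_measurable M"
  unfolding lagged_norm_def[abs_def] L2_set_def by measurable

lemma prob_le_lagged_norm:
  assumes "h \<ge> 1"
  shows "prob {w \<in> space M. norm (X 0 w) > x} \<le> prob {w \<in> space M. lagged_norm X h w > x}"
proof -
  have "norm (X 1 w) \<le> lagged_norm X h w" for w
    using member_le_L2_set[of "{1..h}" 1 "\<lambda>i. norm (X (int i) w)"] assms by (simp add: lagged_norm_def)
  then have "prob {w \<in> space M. norm (X 1 w) > x} \<le> prob {w \<in> space M. lagged_norm X h w > x}"
    by (intro finite_measure_mono) (auto intro: less_le_trans)
  then show ?thesis
    by (simp add: prob_norm_eq[where i=0 and j=1])
qed

text \<open>If the \<open>h\<close>-vector is long, one of its blocks is longer than the fraction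
  \<open>1 / h\<close> of the threshold.\<close>

lemma prob_lagged_norm_le:
  assumes "h \<ge> 1"
  shows "prob {w \<in> space M. lagged_norm X h w > x} \<le> real h * prob {w \<in> space M. norm (X 1 w) > x / real h}"
proof -
  have "{w \<in> space M. lagged_norm X h w > x} \<subseteq> (\<Union>i\<in>{1..h}. {w \<in> space M. norm (X (int i) w) > x / real h})"
  proof (rule subsetI, rule ccontr)
    fix w assume w: "w \<in> {w \<in> space M. lagged_norm X h w > x}"
      and "w \<notin> (\<Union>i\<in>{1..h}. {w \<in> space M. norm (X (int i) w) > x / real h})"
    then have "norm (X (int i) w) \<le> x / real h" if "i \<in> {1..h}" for i
      using that by (auto simp: not_less)
    then have "(\<Sum>i\<in>{1..h}. norm (X (int i) w)) \<le> real h * (x / real h)"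
      using sum_bounded_above[of "{1..h}" "\<lambda>i. norm (X (int i) w)" "x / real h"] by simp
    moreover have "lagged_norm X h w \<le> (\<Sum>i\<in>{1..h}. norm (X (int i) w))"
      unfolding lagged_norm_def by (rule L2_set_le_sum) simp
    ultimately show False using w assms by simp
  qed
  then have "prob {w \<in> space M. lagged_norm X h w > x} \<le> prob (\<Union>i\<in>{1..h}. {w \<in> space M. norm (X (int i) w) > x / real h})"
    by (intro finite_measure_mono sets.finite_UN) auto
  also have "\<dots> \<le> (\<Sum>i\<in>{1..h}. prob {w \<in> space M. norm (X (int i) w) > x / real h})"
    by (intro finite_measure_subadditive_finite) auto
  also have "\<dots> = (\<Sum>i\<in>{1..h}. prob {w \<in> space M. norm (X 1 w) > x / real h})"
    by (intro sum.cong refl prob_norm_eq)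
  finally show ?thesis by simp
qed

lemma lagged_norm_1: "lagged_norm X 1 w = norm (X 1 w)"
  by (simp add: lagged_norm_def)

lemma normalised_law_tendsto:
  assumes "h \<ge> 1" and G: "compactly_supported_on (ext_space0 h) G"
  shows "(\<lambda>n. integral\<^sup>L (lagged_law M X h (a n)) G / prob {w \<in> space M. lagged_norm X h w > a n})
           \<longlonglongrightarrow> integral\<^sup>L (\<mu> h) G"
proof -
  have "((\<lambda>x. integral\<^sup>L (scale_measure (ennreal (1 / prob {w \<in> space M. lagged_norm X h w > x}))
                 (lagged_law M X h x)) G) \<longlongrightarrow> integral\<^sup>L (\<mu> h) G) at_top"
    using regularly_varying assms by (simp add: regularly_varying_def vague_conv_def)
  then have "((\<lambda>x. integral\<^sup>L (lagged_law M X h x) G / prob {w \<in> space M. lagged_norm X h w > x})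
      \<longlongrightarrow> integral\<^sup>L (\<mu> h) G) at_top"
    using G by (simp add: integral_scale_measure_ennreal measurable_lagged_law compactly_supported_on_def)
  then show ?thesis
    by (rule filterlim_compose[OF _ a_at_top])
qed

lemma integral_law_coord:
  fixes f :: "ereal ^ 'd \<Rightarrow> real"
  assumes "continuous_on UNIV f" "f 0 = 0" "h \<ge> 1" "x > 0"
  shows "integral\<^sup>L (lagged_law M X h x) (\<lambda>y. f (y 1)) = expectation (\<lambda>w. f (ext_vec ((1 / x) *\<^sub>R X 1 w)))"
proof -
  have "integral\<^sup>L (lagged_law M X h x) (\<lambda>y. f (y 1)) = expectation (\<lambda>w. f (scaled_lag X h x w 1))"
    using assms by (intro integral_lagged_law measurable_X continuous_map_ext_space_compose_coord) auto
  then show ?thesis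
    using assms(3) by (simp add: scaled_lag_coord)
qed

text \<open>Regular variation normalises the law of the \<open>h\<close>-vector by the tail of its own norm,
  whereas \<open>a\<close> is calibrated to the tail of a single observation. The two tails are compared
  through one test function \<open>g\<close> of the first block that equals one beyond radius
  \<open>1 / h\<close>: its expectation can be normalised either way, so the ratio of the tails converges
  to a ratio of two integrals. Subadditivity over the \<open>h\<close> blocks bounds the integral
  under \<open>\<mu> h\<close> below by \<open>1 / h\<close>, and the limiting ratio is at least one because the vector
  dominates its first block.\<close>

lemma scaled_lagged_norm_tendsto:
  assumes h: "h \<ge> 1"
  obtains c G where "c > 0" "(\<lambda>n. real n * prob {w \<in> space M. lagged_norm X h w > a n}) \<longlonglongrightarrow> c"
    "compactly_supported_on (ext_space0 h) G" "integral\<^sup>L (\<mu> h) G > 0"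
proof -
  \<comment> \<open>the number of coordinates converts the Euclidean radius \<open>1 / h\<close> into a bound on one coordinate\<close>
  define \<delta> where "\<delta> = 1 / (real h * real CARD('d))"
  have "\<delta> > 0" using h by (simp add: \<delta>_def)
  obtain K and S' :: "(ereal ^ 'd) set" where S': "closed S'" "0 \<notin> S'"
      "\<forall>k\<ge>K. \<forall>x. x \<notin> S' \<longrightarrow> bump k (away_set \<delta>) x = 0"
    using bump_support[OF closed_away_set zero_notin_away_set[OF \<open>\<delta> > 0\<close>]] by blast
  define g :: "ereal ^ 'd \<Rightarrow> real" where "g = bump K (away_set \<delta>)"
  have g: "continuous_on UNIV g" "g 0 = 0" "\<And>x. x \<notin> S' \<Longrightarrow> g x = 0" "\<And>x. 0 \<le> g x" "\<And>x. g x \<le> 1"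
    using S' by (simp_all add: g_def continuous_bump bump_nonneg bump_le_1)
  have supp: "compactly_supported_on (ext_space0 k) (\<lambda>x. g (x 1))" if "k \<ge> 1" for k
    using compactly_supported_coord[OF g(1) S'(1,2) g(3), of 1 k "\<lambda>_. 1"] that by simp
  let ?D = "\<lambda>n. real n * prob {w \<in> space M. lagged_norm X h w > a n}"
  let ?b = "\<lambda>n. real n * prob {w \<in> space M. norm (X 0 w) > a n}"
  define e where "e n = expectation (\<lambda>w. g (ext_vec ((1 / a n) *\<^sub>R X 1 w)))" for n
  define A where "A = integral\<^sup>L (\<mu> h) (\<lambda>x. g (x 1))"
  define B where "B = integral\<^sup>L (\<mu> 1) (\<lambda>x. g (x 1))"
  have law: "\<forall>\<^sub>F n in sequentially. integral\<^sup>L (lagged_law M X k (a n)) (\<lambda>y. g (y 1)) = e n" if "k \<ge> 1" for k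
    using eventually_a_pos by eventually_elim (use integral_law_coord[OF g(1,2) that] in \<open>simp add: e_def\<close>)
  \<comment> \<open>the same expectation, normalised by the tail of the vector and by the tail of one observation\<close>
  have A: "(\<lambda>n. e n / prob {w \<in> space M. lagged_norm X h w > a n}) \<longlonglongrightarrow> A"
    unfolding A_def by (rule Lim_transform_eventually[OF normalised_law_tendsto[OF h supp[OF h]]])
      (use law[OF h] in eventually_elim, simp)
  have B: "(\<lambda>n. e n / prob {w \<in> space M. norm (X 0 w) > a n}) \<longlonglongrightarrow> B"
    unfolding B_def by (rule Lim_transform_eventually[OF normalised_law_tendsto[OF order.refl supp[OF order.refl]]])
      (use law[OF order.refl] in eventually_elim, simp add: lagged_norm_1[simplified] prob_norm_eq[where i=1 and j=0])
  have pos: "\<forall>\<^sub>F n in sequentially. 0 < prob {w \<in> space M. norm (X 0 w) > a n}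
      \<and> 0 < prob {w \<in> space M. lagged_norm X h w > a n}"
    using scaled_tail_pos
  proof eventually_elim
    case (elim n)
    then have "0 < prob {w \<in> space M. norm (X 0 w) > a n}"
      by (simp add: zero_less_mult_iff)
    then show ?case using prob_le_lagged_norm[OF h, of "a n"] by simp
  qed
  have e_ge: "\<forall>\<^sub>F n in sequentially. prob {w \<in> space M. lagged_norm X h w > a n} \<le> real h * e n"
    using eventually_a_pos
  proof eventually_elim
    case (elim n)
    have "g (ext_vec ((1 / a n) *\<^sub>R X 1 w)) = 1" if "norm (X 1 w) > a n / real h" for w
    proof -
      have "real CARD('d) * \<delta> \<le> norm ((1 / a n) *\<^sub>R X 1 w)"
        using that elim h by (simp add: \<delta>_def field_simps)
      then show ?thesis
        unfolding g_def by (intro bump_eq_1 ext_vec_in_away_set)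
    qed
    then have le: "indicator {w \<in> space M. norm (X 1 w) > a n / real h} w \<le> g (ext_vec ((1 / a n) *\<^sub>R X 1 w))" for w
      using g(4) by (auto simp: indicator_def)
    have meas: "(\<lambda>w. g (ext_vec ((1 / a n) *\<^sub>R X 1 w))) \<in> borel_measurable M"
      using borel_measurable_continuous_onI[OF g(1)] by measurable
    have "prob {w \<in> space M. norm (X 1 w) > a n / real h}
        = expectation (indicator {w \<in> space M. norm (X 1 w) > a n / real h})"
      by simp
    also have "\<dots> \<le> e n"
      unfolding e_def by (intro integral_mono le integrable_const_bound[where B=1] meas) (use g(4,5) in auto)
    finally show ?case
      using prob_lagged_norm_le[OF h, of "a n"] h
      by (meson mult_left_mono of_nat_0_le_iff order.trans)
  qed
  have "1 / real h \<le> A"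
  proof (rule tendsto_lowerbound[OF A])
    show "\<forall>\<^sub>F n in sequentially. 1 / real h \<le> e n / prob {w \<in> space M. lagged_norm X h w > a n}"
      using e_ge pos by eventually_elim (use h in \<open>simp add: field_simps\<close>)
  qed simp
  then have Apos: "A > 0" using h by (smt (verit) divide_pos_pos of_nat_0_less_iff zero_less_one less_eq_Suc_le One_nat_def)
  have "(\<lambda>n. ?b n * (e n / prob {w \<in> space M. norm (X 0 w) > a n})
      / (e n / prob {w \<in> space M. lagged_norm X h w > a n})) \<longlonglongrightarrow> 1 * B / A"
    by (intro tendsto_intros scaled_tail_tendsto A B) (use Apos in simp)
  moreover have "\<forall>\<^sub>F n in sequentially. ?b n * (e n / prob {w \<in> space M. norm (X 0 w) > a n})
      / (e n / prob {w \<in> space M. lagged_norm X h w > a n}) = ?D n"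
    using pos e_ge
  proof eventually_elim
    case (elim n)
    then have "e n > 0" using h by (smt (verit) mult_nonneg_nonpos of_nat_0_le_iff)
    with elim show ?case by (simp add: field_simps)
  qed
  ultimately have D: "?D \<longlonglongrightarrow> B / A"
    using Lim_transform_eventually by fastforce
  have "1 \<le> B / A"
    by (rule LIMSEQ_le[OF scaled_tail_tendsto D])
      (use prob_le_lagged_norm[OF h] in \<open>auto intro!: mult_left_mono\<close>)
  then show thesis
    using that[OF _ D supp[OF h]] Apos by (simp add: A_def)
qed

text \<open>The limit of \<open>n P(|Y\<^sub>h| > a\<^sub>n)\<close> is an admissible constant; a second one would give
  the same integrals against the limit measure, and a test function with positive integral separates
  the two.\<close>

lemma tail_const_props:
  assumes h: "h \<ge> 1"
  shows "tail_const M X a \<mu> h > 0"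
    and "vague_conv (ext_space0 h) (\<lambda>n. scale_measure (of_nat n) (lagged_law M X h (a n)))
           (tail_measure M X a \<mu> h) sequentially"
proof -
  obtain c G where c: "c > 0" "(\<lambda>n. real n * prob {w \<in> space M. lagged_norm X h w > a n}) \<longlonglongrightarrow> c"
    and G: "compactly_supported_on (ext_space0 h) G" "integral\<^sup>L (\<mu> h) G > 0"
    using scaled_lagged_norm_tendsto[OF h] by blast
  have scale: "integral\<^sup>L (scale_measure (of_nat n) (lagged_law M X h (a n))) F
      = real n * integral\<^sup>L (lagged_law M X h (a n)) F"
    "r > 0 \<Longrightarrow> integral\<^sup>L (scale_measure (ennreal r) (\<mu> h)) F = r * integral\<^sup>L (\<mu> h) F"
    if "compactly_supported_on (ext_space0 h) F" for F n r
    using integral_scale_measure_ennreal[of "real n" F "lagged_law M X h (a n)"]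
      integral_scale_measure_ennreal[of r F "\<mu> h"] that
      measurable_lagged_law[of h F M X "a n"] measurable_radon[OF radon_\<mu>[OF h], of F]
    by (auto simp: compactly_supported_on_def ennreal_of_nat_eq_real_of_nat)
  have pos: "\<forall>\<^sub>F n in sequentially. 0 < real n * prob {w \<in> space M. lagged_norm X h w > a n}"
    by (rule order_tendstoD(1)[OF c(2,1)])
  have lim: "(\<lambda>n. real n * integral\<^sup>L (lagged_law M X h (a n)) F) \<longlonglongrightarrow> c * integral\<^sup>L (\<mu> h) F"
    if "compactly_supported_on (ext_space0 h) F" for F
  proof (rule Lim_transform_eventually[OF tendsto_mult[OF c(2) normalised_law_tendsto[OF h that]]])
    show "\<forall>\<^sub>F n in sequentially.
        real n * prob {w \<in> space M. lagged_norm X h w > a n} *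
          (integral\<^sup>L (lagged_law M X h (a n)) F / prob {w \<in> space M. lagged_norm X h w > a n})
        = real n * integral\<^sup>L (lagged_law M X h (a n)) F"
      using pos
    proof eventually_elim
      case (elim n)
      then have "prob {w \<in> space M. lagged_norm X h w > a n} \<noteq> 0"
        by (metis less_irrefl mult_zero_right)
      then show ?case by simp
    qed
  qed
  have conv: "vague_conv (ext_space0 h) (\<lambda>n. scale_measure (of_nat n) (lagged_law M X h (a n)))
      (scale_measure (ennreal c) (\<mu> h)) sequentially"
    using lim c(1) by (simp add: vague_conv_def scale)
  have "tail_const M X a \<mu> h = c"
    unfolding tail_const_def
  proof (rule the_equality)
    fix r assume r: "r > 0 \<and> vague_conv (ext_space0 h)
      (\<lambda>n. scale_measure (of_nat n) (lagged_law M X h (a n))) (scale_measure (ennreal r) (\<mu> h)) sequentially"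
    then have "(\<lambda>n. real n * integral\<^sup>L (lagged_law M X h (a n)) G) \<longlonglongrightarrow> r * integral\<^sup>L (\<mu> h) G"
      using G(1) by (auto simp: vague_conv_def scale)
    then have "r * integral\<^sup>L (\<mu> h) G = c * integral\<^sup>L (\<mu> h) G"
      using lim[OF G(1)] by (rule LIMSEQ_unique)
    then show "r = c" using G(2) by simp
  qed (use conv c in auto)
  then show "tail_const M X a \<mu> h > 0"
    "vague_conv (ext_space0 h) (\<lambda>n. scale_measure (of_nat n) (lagged_law M X h (a n)))
           (tail_measure M X a \<mu> h) sequentially"
    using c(1) conv by (auto simp: tail_measure_def)
qed

lemma radon_tail_measure:
  assumes "h \<ge> 1"
  shows "radon_measure_on (ext_space0 h) (tail_measure M X a \<mu> h)"
  using radon_\<mu>[OF assms]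
  by (auto simp: radon_measure_on_def tail_measure_def ennreal_mult_less_top)

text \<open>The form in which vague convergence is used: expectations of test functions of the scaled
  observations, multiplied by \<open>n\<close>, converge to integrals against the tail measure.\<close>

lemma tail_measure_tendsto:
  fixes f :: "ereal ^ 'd \<Rightarrow> real"
  assumes "i \<in> {1..h}" "continuous_on UNIV f" "closed S" "0 \<notin> S" "\<And>x. x \<notin> S \<Longrightarrow> f x = 0"
    and G: "continuous_map (ext_space h) euclideanreal G"
  shows "(\<lambda>n. real n * expectation (\<lambda>w. f (ext_vec ((1 / a n) *\<^sub>R X (int i) w)) * G (scaled_lag X h (a n) w)))
           \<longlonglongrightarrow> integral\<^sup>L (tail_measure M X a \<mu> h) (\<lambda>x. f (x i) * G x)"
proof -
  let ?F = "\<lambda>x. f (x i) * G x"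
  have h: "h \<ge> 1" using assms(1) by auto
  have cont: "continuous_map (ext_space h) euclideanreal ?F"
    by (intro continuous_map_real_mult continuous_map_ext_space_compose_coord assms)
  have "integral\<^sup>L (scale_measure (of_nat n) (lagged_law M X h (a n))) ?F
      = real n * integral\<^sup>L (lagged_law M X h (a n)) ?F" for n
    using integral_scale_measure_ennreal[of "real n" ?F "lagged_law M X h (a n)"]
      measurable_lagged_law[OF continuous_map_ext_space0[OF cont], of M X "a n"]
    by (simp add: ennreal_of_nat_eq_real_of_nat)
  moreover have "integral\<^sup>L (lagged_law M X h (a n)) ?F =
      expectation (\<lambda>w. f (ext_vec ((1 / a n) *\<^sub>R X (int i) w)) * G (scaled_lag X h (a n) w))" for n
    by (subst integral_lagged_law[OF measurable_X cont]) (use assms in \<open>simp_all add: scaled_lag_coord\<close>)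
  moreover have "compactly_supported_on (ext_space0 h) ?F"
    by (rule compactly_supported_coord) fact+
  then have "(\<lambda>n. integral\<^sup>L (scale_measure (of_nat n) (lagged_law M X h (a n))) ?F)
      \<longlonglongrightarrow> integral\<^sup>L (tail_measure M X a \<mu> h) ?F"
    using tail_const_props(2)[OF h] unfolding vague_conv_def by blast
  ultimately show ?thesis
    by simp
qed

end


section \<open>Joint exceedances of a continuity set\<close>

text \<open>A vector with an infinite coordinate lies in every away set; for the others this is the
  comparison of the Euclidean and the maximum norm.\<close>

lemma bounded_away_subset_away_set:
  fixes C :: "(ereal ^ 'd) set"
  assumes "bounded_away_from_zero C"
  shows "\<exists>\<delta>>0. C \<subseteq> away_set \<delta>"
proof -
  obtain \<epsilon> :: real where \<epsilon>: "\<epsilon> > 0" "\<And>x. x \<in> C \<Longrightarrow> ereal \<epsilon> < ext_norm x"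
    using assms by (auto simp: bounded_away_from_zero_def)
  define \<delta> where "\<delta> = \<epsilon> / real CARD('d)"
  have "x \<in> away_set \<delta>" if x: "x \<in> C" for x
  proof (cases "\<exists>j. \<bar>x $ j\<bar> = \<infinity>")
    case False
    define y where "y = (\<chi> j. real_of_ereal (x $ j))"
    have y: "ext_vec y = x"
      using False by (simp add: y_def ext_vec_def vec_eq_iff ereal_real)
    then have "\<epsilon> < norm y"
      using \<epsilon>(2)[OF x] ext_norm_ext_vec[of y] by simp
    then show ?thesis
      using ext_vec_in_away_set[of \<delta> y] y by (simp add: \<delta>_def)
  next
    case True
    then show ?thesis
      unfolding away_set_def mem_Collect_eq by (rule ex_forward) simp
  qed
  moreover have "\<delta> > 0" using \<epsilon>(1) by (simp add: \<delta>_def)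
  ultimately show ?thesis by blast
qed

text \<open>Compares the frontier of \<open>C\<close> in the extended space with the frontier of the one-tuples
  over \<open>C\<close> in the punctured space. Since \<open>x\<close> is not the origin, its neighbourhoods can
  be shrunk to avoid it.\<close>

lemma frontier_subset_frontier_of:
  fixes C :: "(ereal ^ 'd) set"
  assumes "0 \<notin> C" and x: "x \<in> topspace (ext_space0 1)" "x 1 \<in> closure C" "x 1 \<notin> interior C"
  shows "x \<in> ext_space0 1 frontier_of (\<Pi>\<^sub>E i\<in>{1..1}. C)"
proof -
  \<comment> \<open>one-tuples: a homeomorphic copy of the extended space\<close>
  define emb :: "ereal ^ 'd \<Rightarrow> nat \<Rightarrow> ereal ^ 'd" where "emb z = (\<lambda>i\<in>{1..1}. z)" for z
  have cont: "continuous_map euclidean (ext_space 1) emb"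
    unfolding ext_space_def continuous_map_componentwise
  proof (intro conjI ballI)
    show "emb ` topspace euclidean \<subseteq> extensional {1..1}"
      by (auto simp: emb_def)
    fix i :: nat assume "i \<in> {1..1}"
    then have "(\<lambda>z. emb z i) = (\<lambda>z. z)"
      by (simp add: emb_def)
    then show "continuous_map euclidean euclidean (\<lambda>z. emb z i)" by simp
  qed
  have emb_x: "emb (x 1) = x"
    using x(1) by (auto simp: emb_def topspace_ext_space0 topspace_ext_space PiE_def extensional_def fun_eq_iff restrict_def)
  have emb_top: "emb z \<in> topspace (ext_space0 1) \<longleftrightarrow> z \<noteq> 0" for z
  proof -
    have "emb z = (\<lambda>i\<in>{1..1}. 0) \<longleftrightarrow> z = 0"
      by (auto simp: emb_def dest: fun_cong[of _ _ 1])
    then show ?thesis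
      by (simp add: topspace_ext_space0 topspace_ext_space emb_def)
  qed
  have x_ne: "x 1 \<noteq> 0"
    using emb_top[of "x 1"] x(1) emb_x by simp
  have nbhd: "\<exists>z\<in>D. z \<noteq> 0 \<and> emb z \<in> U" if D: "x 1 \<in> closure D" and U: "openin (ext_space0 1) U" "x \<in> U" for D U
  proof -
    obtain V where V: "openin (ext_space 1) V" "U = V \<inter> topspace (ext_space0 1)"
      using U(1) openin_subtopology[of "ext_space 1" "topspace (ext_space 1) - {\<lambda>i\<in>{1..1}. 0}" U]
      by (auto simp: ext_space0_def topspace_ext_space0)
    have "open {z \<in> topspace euclidean. emb z \<in> V}"
      using openin_continuous_map_preimage[OF cont V(1)] by simp
    then have "open ({z. emb z \<in> V} \<inter> - {0})"
      using closed_singleton_0 by (intro open_Int open_Compl) simp_all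
    moreover have "x 1 \<in> {z. emb z \<in> V} \<inter> - {0}"
      using V U(2) emb_x x_ne by simp
    ultimately obtain z where "z \<in> D" "z \<in> {z. emb z \<in> V} \<inter> - {0}"
      using D closure_iff_nhds_not_empty[of "x 1" D] by blast
    then show ?thesis using V emb_top[of z] by auto
  qed
  have emb_mem: "emb z \<in> (\<Pi>\<^sub>E i\<in>{1..1}. C) \<longleftrightarrow> z \<in> C" for z
    by (auto simp: emb_def PiE_iff)
  have "x \<in> ext_space0 1 closure_of (\<Pi>\<^sub>E i\<in>{1..1}. C)"
    unfolding in_closure_of
  proof (intro conjI allI impI x(1))
    fix U assume "x \<in> U \<and> openin (ext_space0 1) U"
    then obtain z where "z \<in> C" "emb z \<in> U"
      using nbhd[OF x(2)] by blast
    then show "\<exists>y. y \<in> (\<Pi>\<^sub>E i\<in>{1..1}. C) \<and> y \<in> U"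
      using emb_mem by blast
  qed
  moreover have "x \<in> ext_space0 1 closure_of (topspace (ext_space0 1) - (\<Pi>\<^sub>E i\<in>{1..1}. C))"
    unfolding in_closure_of
  proof (intro conjI allI impI x(1))
    have "x 1 \<in> closure (- C)"
      using x(3) by (simp add: closure_complement)
    fix U assume "x \<in> U \<and> openin (ext_space0 1) U"
    then obtain z where "z \<in> - C" "z \<noteq> 0" "emb z \<in> U"
      using nbhd[OF \<open>x 1 \<in> closure (- C)\<close>] by blast
    then show "\<exists>y. y \<in> topspace (ext_space0 1) - (\<Pi>\<^sub>E i\<in>{1..1}. C) \<and> y \<in> U"
      using emb_mem emb_top by blast
  qed
  ultimately show ?thesis
    by (simp add: frontier_of_closures)
qed

locale extremal_set = regularly_varying_sequence M X \<alpha> \<mu> a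
  for M :: "'w measure" and X :: "int \<Rightarrow> 'w \<Rightarrow> real ^ 'd" and \<alpha> \<mu> a +
  fixes C :: "(ereal ^ 'd) set"
  assumes borel_C: "C \<in> sets borel"
    and bounded_away: "bounded_away_from_zero C"
    and continuity: "continuity_set (ext_space0 1) (\<mu> 1) (\<Pi>\<^sub>E i\<in>{1..1}. C)"
begin

abbreviation "\<nu> \<equiv> tail_measure M X a \<mu>"

definition exceed :: "real \<Rightarrow> int set \<Rightarrow> 'w set" where
  "exceed u S = {w \<in> space M. \<forall>s\<in>S. ext_vec ((1 / u) *\<^sub>R X s w) \<in> C}"

lemma measurable_scaled_X: "(\<lambda>w. ext_vec ((1 / u) *\<^sub>R X t w)) \<in> borel_measurable M"
  by measurable

lemma exceed_eq_vimage:
  "{w \<in> space M. ext_vec ((1 / u) *\<^sub>R X t w) \<in> C} = (\<lambda>w. ext_vec ((1 / u) *\<^sub>R X t w)) -` C \<inter> space M"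
  by auto

lemma exceed_sets [measurable]: "finite S \<Longrightarrow> exceed u S \<in> sets M"
  using measurable_sets[OF measurable_scaled_X borel_C]
  unfolding exceed_def by (intro sets.sets_Collect_finite_All) (simp_all add: exceed_eq_vimage)

lemma prob_exceed_shift:
  assumes "finite S"
  shows "prob (exceed u ((\<lambda>s. s + k) ` S)) = prob (exceed u S)"
proof -
  have "(\<lambda>v. ext_vec ((1 / u) *\<^sub>R v)) -` C \<inter> space borel \<in> sets borel"
    by (rule measurable_sets[OF _ borel_C]) measurable
  then show ?thesis
    using prob_shift[OF assms, of "\<lambda>_. (\<lambda>v. ext_vec ((1 / u) *\<^sub>R v)) -` C" k]
    by (simp add: exceed_def)
qed

text \<open>The away sets are closed, so the closure of \<open>C\<close> is still bounded away from zero.\<close>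

lemma zero_notin_closure_C: "0 \<notin> closure C"
proof -
  obtain \<delta> where "\<delta> > 0" "C \<subseteq> away_set \<delta>"
    using bounded_away_subset_away_set[OF bounded_away] by auto
  then show ?thesis
    using closure_minimal[OF _ closed_away_set, of C \<delta>] zero_notin_away_set[of \<delta>] by blast
qed

lemma zero_notin_C: "0 \<notin> C"
  using zero_notin_closure_C closure_subset by blast

text \<open>Continuous functions above and below the indicator of \<open>C\<close>: \<open>outer k\<close> decreases to the
  indicator of the closure and \<open>inner k\<close> increases to the indicator of the interior.\<close>

definition outer :: "nat \<Rightarrow> ereal ^ 'd \<Rightarrow> real" where
  "outer k x = bump k (closure C) x"

definition inner :: "nat \<Rightarrow> ereal ^ 'd \<Rightarrow> real" where
  "inner k x = 1 - bump k (- interior C) x"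

lemma continuous_outer: "continuous_on UNIV (outer k)"
  and continuous_inner: "continuous_on UNIV (inner k)"
  unfolding outer_def[abs_def] inner_def[abs_def]
  by (intro continuous_intros continuous_bump)+

lemma inner_nonneg: "0 \<le> inner k x" and outer_le_1: "outer k x \<le> 1"
  by (simp_all add: outer_def inner_def bump_le_1)

lemma inner_le_indicator: "inner k x \<le> indicator C x"
proof (cases "x \<in> interior C")
  case True
  then show ?thesis
    using bump_nonneg[of k "- interior C" x] interior_subset[of C] by (auto simp: inner_def)
qed (simp add: inner_def bump_eq_1)

lemma indicator_le_outer: "indicator C x \<le> outer k x"
proof (cases "x \<in> C")
  case True
  then show ?thesis
    using closure_subset[of C] by (auto simp: outer_def bump_eq_1)
qed (simp add: outer_def bump_nonneg)

lemma outer_support: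
  "\<exists>K S. closed S \<and> 0 \<notin> S \<and> (\<forall>k\<ge>K. \<forall>x. x \<notin> S \<longrightarrow> outer k x = 0 \<and> inner k x = 0)"
proof -
  obtain K S where S: "closed S" "0 \<notin> S" "\<forall>k\<ge>K. \<forall>x. x \<notin> S \<longrightarrow> outer k x = 0"
    using bump_support[OF closed_closure zero_notin_closure_C] unfolding outer_def by blast
  have "inner k x = 0" if "outer k x = 0" for k x
    using inner_le_indicator[of k x] indicator_le_outer[of x k] inner_nonneg[of k x] that by linarith
  with S show ?thesis by blast
qed

text \<open>The continuity hypothesis concerns \<open>\<mu> 1\<close>, and \<open>\<nu> 1\<close> is a multiple of it.\<close>

lemma emeasure_frontier_null:
  "emeasure (\<nu> 1) {x \<in> topspace (ext_space0 1). x 1 \<in> closure C - interior C} = 0"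
proof -
  let ?T = "ext_space0 1 :: (nat \<Rightarrow> ereal ^ 'd) topology"
  let ?F = "?T frontier_of (\<Pi>\<^sub>E i\<in>{1..1}. C)"
  have "topspace ?T - ?F \<in> sets (borel_on ?T)"
    by (rule openin_borel_on) (simp add: closedin_frontier_of openin_diff)
  then have "space (borel_on ?T) - (topspace ?T - ?F) \<in> sets (borel_on ?T)"
    by (rule sets.compl_sets)
  then have "?F \<in> sets (borel_on ?T)"
    using frontier_of_subset_topspace[of ?T "\<Pi>\<^sub>E i\<in>{1..1}. C"] by (simp add: double_diff)
  then have "?F \<in> sets (\<mu> 1)"
    using radon_\<mu>[of 1] by (simp add: radon_measure_on_def)
  then have "emeasure (\<mu> 1) {x \<in> topspace ?T. x 1 \<in> closure C - interior C} \<le> emeasure (\<mu> 1) ?F"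
    using frontier_subset_frontier_of[OF zero_notin_C] by (intro emeasure_mono) auto
  then show ?thesis
    using continuity by (simp add: continuity_set_def tail_measure_def)
qed

lemma integrable_tail_coord:
  assumes "i \<in> {1..h}" "j \<in> {1..h}" "closed S" "0 \<notin> S"
    and f: "continuous_on UNIV f" "\<And>x. x \<notin> S \<Longrightarrow> f x = 0" "\<And>x. 0 \<le> f x" "\<And>x. f x \<le> 1"
    and g: "continuous_on UNIV g" "\<And>x. 0 \<le> g x" "\<And>x. g x \<le> (1 :: real)"
  shows "integrable (\<nu> h) (\<lambda>x. f (x i) * g (x j))"
proof (rule integrable_radon[OF radon_tail_measure assms(3,4,1)])
  show "1 \<le> h" using assms(1) by auto
  then show "(\<lambda>x. f (x i) * g (x j)) \<in> borel_measurable (\<nu> h)"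
    by (intro measurable_radon[OF radon_tail_measure] continuous_map_ext_space0
        continuous_map_real_mult continuous_map_ext_space_compose_coord assms)
  show "\<bar>f (x i) * g (x j)\<bar> \<le> 1" for x
    using f(3,4)[of "x i"] g(2,3)[of "x j"] by (simp add: abs_mult mult_le_one)
qed (use f in auto)

text \<open>The marginals of the tail measures away from the origin agree, because stationarity makes the
  prelimit expectations equal and limits are unique. This is how the continuity of \<open>C\<close> for the
  one-dimensional measure controls products of \<open>C\<close> in higher dimensions.\<close>

lemma integral_tail_marginal:
  assumes "i \<in> {1..h}" "continuous_on UNIV f" "closed S" "0 \<notin> S" "\<And>x. x \<notin> S \<Longrightarrow> f x = (0 :: real)"
  shows "integral\<^sup>L (\<nu> h) (\<lambda>x. f (x i)) = integral\<^sup>L (\<nu> 1) (\<lambda>x. f (x 1))"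
proof -
  have "(\<lambda>v. f (ext_vec ((1 / u) *\<^sub>R v))) \<in> borel_measurable borel" for u
    using borel_measurable_continuous_onI[OF assms(2)] by measurable
  then have "expectation (\<lambda>w. f (ext_vec ((1 / u) *\<^sub>R X (int i) w))) = expectation (\<lambda>w. f (ext_vec ((1 / u) *\<^sub>R X 1 w)))" for u
    by (rule expectation_eq)
  then show ?thesis
    using tail_measure_tendsto[OF assms, of "\<lambda>_. 1"] tail_measure_tendsto[OF _ assms(2-5), of 1 1 "\<lambda>_. 1"]
    by (simp add: LIMSEQ_unique)
qed

text \<open>The mass of the layer between the inner and the outer approximation of \<open>C\<close>.\<close>

definition gap :: "nat \<Rightarrow> real" where
  "gap k = integral\<^sup>L (\<nu> 1) (\<lambda>x. outer k (x 1) - inner k (x 1))"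

text \<open>Dominated convergence: the layer shrinks to the frontier of \<open>C\<close>, which is a null set.\<close>

lemma gap_tendsto_0: "gap \<longlonglongrightarrow> 0"
proof -
  obtain K S where S: "closed S" "0 \<notin> S" "\<And>k x. k \<ge> K \<Longrightarrow> x \<notin> S \<Longrightarrow> outer k x = 0 \<and> inner k x = 0"
    using outer_support by blast
  let ?w = "\<lambda>x. outer K (x 1)"
  let ?s = "\<lambda>k x. outer (k + K) (x 1) - inner (k + K) (x 1)"
  have meas: "(\<lambda>x. outer k (x 1) - inner k (x 1)) \<in> borel_measurable (\<nu> 1)" for k
    by (intro measurable_radon[OF radon_tail_measure] continuous_map_ext_space0
        continuous_map_diff continuous_map_ext_space_compose_coord continuous_outer continuous_inner) auto
  have w: "integrable (\<nu> 1) ?w"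
    using integrable_tail_coord[of 1 1 1 S "outer K" "\<lambda>_. 1"] S continuous_outer[of K] outer_le_1
    by (simp add: outer_def bump_nonneg)
  have lim: "(\<lambda>k. ?s k x) \<longlonglongrightarrow> indicator (closure C - interior C) (x 1)" for x :: "nat \<Rightarrow> ereal ^ 'd"
  proof -
    have "(\<lambda>k. outer k (x 1) - inner k (x 1)) \<longlonglongrightarrow>
        indicator (closure C) (x 1) - (1 - indicator (- interior C) (x 1))"
      unfolding outer_def inner_def
      by (intro tendsto_intros bump_tendsto_indicator) auto
    moreover have "indicator (closure C) (x 1) - (1 - indicator (- interior C) (x 1)) =
        (indicator (closure C - interior C) (x 1) :: real)"
      using interior_subset[of C] closure_subset[of C] by (auto simp: indicator_def)
    ultimately show ?thesis
      using LIMSEQ_ignore_initial_segment by fastforce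
  qed
  have null: "AE x in \<nu> 1. indicator (closure C - interior C) (x 1) = (0 :: real)"
  proof (rule AE_I[OF _ emeasure_frontier_null])
    have "(\<lambda>x. x 1) -` (closure C - interior C) \<inter> space (\<nu> 1) \<in> sets (\<nu> 1)"
      by (intro measurable_sets[OF measurable_radon[OF radon_tail_measure
            continuous_map_ext_space0[OF continuous_map_ext_space_coord]]]) auto
    moreover have "(\<lambda>x. x 1) -` (closure C - interior C) \<inter> space (\<nu> 1) =
        {x \<in> topspace (ext_space0 1). x 1 \<in> closure C - interior C}"
      using space_radon[OF radon_tail_measure[of 1]] by auto
    ultimately show "{x \<in> topspace (ext_space0 1). x 1 \<in> closure C - interior C} \<in> sets (\<nu> 1)"
      by simp
  qed (auto simp: space_radon[OF radon_tail_measure] indicator_def)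
  have "(\<lambda>k. integral\<^sup>L (\<nu> 1) (?s k)) \<longlonglongrightarrow> integral\<^sup>L (\<nu> 1) (\<lambda>x. 0 :: real)"
  proof (rule integral_dominated_convergence[OF _ _ w])
    show "AE x in \<nu> 1. (\<lambda>k. ?s k x) \<longlonglongrightarrow> 0"
      using null by eventually_elim (metis lim)
    show "AE x in \<nu> 1. norm (?s k x) \<le> ?w x" for k
    proof (intro AE_I2)
      fix x
      have "inner (k + K) (x 1) \<le> outer (k + K) (x 1)"
        using inner_le_indicator indicator_le_outer order.trans by blast
      moreover have "outer (k + K) (x 1) \<le> ?w x"
        unfolding outer_def by (rule bump_antimono) simp
      ultimately show "norm (?s k x) \<le> ?w x"
        using inner_nonneg[of "k + K" "x 1"] by simp
    qed
  qed (use meas in auto)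
  then have "(\<lambda>k. gap (k + K)) \<longlonglongrightarrow> 0"
    by (simp add: gap_def)
  then show ?thesis
    by (rule LIMSEQ_offset)
qed

text \<open>The box lies in the punctured space because its first coordinate, being in \<open>C\<close>, is
  nonzero.\<close>

lemma tau_box_eq:
  "(\<Pi>\<^sub>E i\<in>{1..h + 1}. if i = 1 \<or> i = h + 1 then C else UNIV) =
     {x \<in> topspace (ext_space0 (h + 1)). x 1 \<in> C \<and> x (h + 1) \<in> C}"
proof -
  have *: "x \<noteq> (\<lambda>i\<in>{1..h + 1}. 0)" if "x 1 \<in> C" for x :: "nat \<Rightarrow> ereal ^ 'd"
    using that zero_notin_C by auto
  have "x \<in> (\<Pi>\<^sub>E i\<in>{1..h + 1}. if i = 1 \<or> i = h + 1 then C else UNIV) \<longleftrightarrow>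
      x \<in> {x \<in> topspace (ext_space0 (h + 1)). x 1 \<in> C \<and> x (h + 1) \<in> C}" for x
  proof -
    have "(\<forall>i\<in>{1..h + 1}. x i \<in> (if i = 1 \<or> i = h + 1 then C else UNIV)) \<longleftrightarrow> x 1 \<in> C \<and> x (h + 1) \<in> C"
      by (auto split: if_splits)
    then show ?thesis
      using * by (auto simp: topspace_ext_space0 topspace_ext_space PiE_iff)
  qed
  then show ?thesis by blast
qed

text \<open>The probability and the target both lie between the quantities obtained by replacing the two
  indicators of \<open>C\<close> by inner and by outer approximations. The bounds converge for fixed
  \<open>k\<close>, and the limits differ by at most two one-dimensional gaps. For \<open>h = 0\<close> both
  coordinates are the same and the limit is \<open>\<nu>\<^sub>1(C)\<close>.\<close>

lemma scaled_prob_pair_tendsto: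
  "(\<lambda>n. real n * prob (exceed (a n) {0, int h})) \<longlonglongrightarrow> tau \<nu> C h"
proof -
  define H where "H = h + 1"
  have H: "1 \<in> {1..H}" "H \<in> {1..H}" "1 \<le> H" by (auto simp: H_def)
  obtain K S where S: "closed S" "0 \<notin> S" "\<And>k x. k \<ge> K \<Longrightarrow> x \<notin> S \<Longrightarrow> outer k x = 0 \<and> inner k x = 0"
    using outer_support by blast
  define P where "P n = real n * prob (exceed (a n) {0, int h})" for n
  define L where "L k = integral\<^sup>L (\<nu> H) (\<lambda>x. inner k (x 1) * inner k (x H))" for k
  define U where "U k = integral\<^sup>L (\<nu> H) (\<lambda>x. outer k (x 1) * outer k (x H))" for k
  let ?Y = "\<lambda>n i w. ext_vec ((1 / a n) *\<^sub>R X (int i) w)"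
  define l where "l k n = real n * expectation (\<lambda>w. inner k (?Y n 1 w) * inner k (?Y n H w))" for k n
  define u where "u k n = real n * expectation (\<lambda>w. outer k (?Y n 1 w) * outer k (?Y n H w))" for k n
  have inner_le_1: "inner k x \<le> 1" and outer_nonneg: "0 \<le> outer k x" and inner_le_outer: "inner k x \<le> outer k x" for k x
    using inner_le_indicator[of k x] indicator_le_outer[of x k] by (cases "x \<in> C"; simp)+
  note bounds = inner_nonneg inner_le_1 outer_nonneg outer_le_1 inner_le_outer
  have zero: "outer k x = 0" "inner k x = 0" if "k \<ge> K" "x \<notin> S" for k x
    using S(3)[OF that] by auto
  have lim_l: "l k \<longlonglongrightarrow> L k" if "k \<ge> K" for k
  proof -
    have "l k = (\<lambda>n. real n * expectation (\<lambda>w. inner k (?Y n 1 w) * inner k (scaled_lag X H (a n) w H)))"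
      by (simp only: l_def[abs_def] scaled_lag_coord[OF H(2)])
    moreover have "\<dots> \<longlonglongrightarrow> L k"
      unfolding L_def
      by (rule tail_measure_tendsto[OF H(1) continuous_inner S(1,2) _
            continuous_map_ext_space_compose_coord[OF continuous_inner H(2)]]) (erule zero(2)[OF that])
    ultimately show ?thesis by simp
  qed
  have lim_u: "u k \<longlonglongrightarrow> U k" if "k \<ge> K" for k
  proof -
    have "u k = (\<lambda>n. real n * expectation (\<lambda>w. outer k (?Y n 1 w) * outer k (scaled_lag X H (a n) w H)))"
      by (simp only: u_def[abs_def] scaled_lag_coord[OF H(2)])
    moreover have "\<dots> \<longlonglongrightarrow> U k"
      unfolding U_def
      by (rule tail_measure_tendsto[OF H(1) continuous_outer S(1,2) _
            continuous_map_ext_space_compose_coord[OF continuous_outer H(2)]]) (erule zero(1)[OF that])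
    ultimately show ?thesis by simp
  qed
  have P_eq: "P n = real n * expectation (\<lambda>w. indicator C (?Y n 1 w) * indicator C (?Y n H w))" for n
  proof -
    have "(\<lambda>s. s + 1) ` {0, int h} = {1, int H}" by (auto simp: H_def)
    then have "prob (exceed (a n) {0, int h}) = prob (exceed (a n) {1, int H})"
      using prob_exceed_shift[of "{0, int h}" "a n" 1] by simp
    also have "\<dots> = expectation (indicator (exceed (a n) {1, int H}))"
      by simp
    also have "\<dots> = expectation (\<lambda>w. indicator C (?Y n 1 w) * indicator C (?Y n H w))"
      by (intro Bochner_Integration.integral_cong) (auto simp: exceed_def indicator_def)
    finally show ?thesis by (simp add: P_def)
  qed
  have meas: "(\<lambda>w. f (?Y n i w)) \<in> borel_measurable M" if "f \<in> borel_measurable borel" for f :: "ereal ^ 'd \<Rightarrow> real" and n i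
    using that by measurable
  have ind: "(indicator C :: _ \<Rightarrow> real) \<in> borel_measurable borel"
    using borel_C by simp
  have int: "integrable M (\<lambda>w. f (?Y n i w) * f (?Y n j w))"
    if "f \<in> borel_measurable borel" "\<And>x. 0 \<le> f x" "\<And>x. f x \<le> 1" for f :: "ereal ^ 'd \<Rightarrow> real" and n i j
    by (rule integrable_const_bound[where B=1])
      (use meas[OF that(1)] that(2,3) in \<open>auto simp: abs_mult intro!: mult_le_one borel_measurable_times\<close>)
  have l_le_P: "l k n \<le> P n" and P_le_u: "P n \<le> u k n" for k n
  proof -
    note b = borel_measurable_continuous_onI[OF continuous_inner] borel_measurable_continuous_onI[OF continuous_outer]
    show "l k n \<le> P n"
      unfolding l_def P_eq
      by (intro mult_left_mono integral_mono int mult_mono inner_le_indicator b ind) (auto simp: bounds)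
    show "P n \<le> u k n"
      unfolding u_def P_eq
      by (intro mult_left_mono integral_mono int mult_mono indicator_le_outer b ind) (auto simp: bounds)
  qed
  have intg: "integrable (\<nu> H) (\<lambda>x. inner k (x 1) * inner k (x H))"
    "integrable (\<nu> H) (\<lambda>x. outer k (x 1) * outer k (x H))"
    "integrable (\<nu> H) (\<lambda>x. outer k (x i) - inner k (x i))" if "k \<ge> K" "i \<in> {1..H}" for k i
  proof -
    show "integrable (\<nu> H) (\<lambda>x. inner k (x 1) * inner k (x H))"
      by (rule integrable_tail_coord[OF H(1,2) S(1,2)]) (use S(3)[OF that(1)] in \<open>auto simp: continuous_inner bounds\<close>)
    show "integrable (\<nu> H) (\<lambda>x. outer k (x 1) * outer k (x H))"
      by (rule integrable_tail_coord[OF H(1,2) S(1,2)]) (use S(3)[OF that(1)] in \<open>auto simp: continuous_outer bounds\<close>)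
    have "integrable (\<nu> H) (\<lambda>x. outer k (x i) * 1)" "integrable (\<nu> H) (\<lambda>x. inner k (x i) * 1)"
      by (rule integrable_tail_coord[OF that(2) that(2) S(1,2)];
          use S(3)[OF that(1)] in \<open>auto simp: continuous_outer continuous_inner bounds\<close>)+
    then show "integrable (\<nu> H) (\<lambda>x. outer k (x i) - inner k (x i))"
      by simp
  qed
  have tau: "tau \<nu> C h = integral\<^sup>L (\<nu> H) (\<lambda>x. indicator C (x 1) * indicator C (x H))"
    and tau_int: "integrable (\<nu> H) (\<lambda>x. indicator C (x 1) * indicator C (x H) :: real)"
  proof -
    let ?B = "{x \<in> topspace (ext_space0 H). x 1 \<in> C \<and> x H \<in> C}"
    have m: "(\<lambda>x. x i) \<in> borel_measurable (\<nu> H)" if "i \<in> {1..H}" for i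
      by (intro measurable_radon[OF radon_tail_measure] continuous_map_ext_space0 continuous_map_ext_space_coord that H)
    have sp: "space (\<nu> H) = topspace (ext_space0 H)"
      by (rule space_radon[OF radon_tail_measure[OF H(3)]])
    have "((\<lambda>x. x 1) -` C \<inter> space (\<nu> H)) \<inter> ((\<lambda>x. x H) -` C \<inter> space (\<nu> H)) \<in> sets (\<nu> H)"
      by (intro sets.Int measurable_sets[OF m] H borel_C)
    moreover have "((\<lambda>x. x 1) -` C \<inter> space (\<nu> H)) \<inter> ((\<lambda>x. x H) -` C \<inter> space (\<nu> H)) = ?B"
      using sp by auto
    ultimately have B: "?B \<in> sets (\<nu> H)" by simp
    have eq: "indicator C (x 1) * indicator C (x H) = (indicator ?B x :: real)" if "x \<in> space (\<nu> H)" for x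
      using that sp by (auto simp: indicator_def)
    have "(\<lambda>x. indicator C (x 1) * indicator C (x H) :: real) \<in> borel_measurable (\<nu> H)"
      by (intro borel_measurable_times measurable_compose[OF m ind] H)
    then show "integrable (\<nu> H) (\<lambda>x. indicator C (x 1) * indicator C (x H) :: real)"
      by (rule Bochner_Integration.integrable_bound[OF intg(2)[OF order.refl H(1)]])
        (auto intro!: mult_mono simp: abs_mult indicator_le_outer bounds)
    have "tau \<nu> C h = measure (\<nu> H) ?B"
      by (simp only: tau_def tau_box_eq H_def)
    also have "\<dots> = integral\<^sup>L (\<nu> H) (indicator ?B)"
      using B by (simp add: sets.Int_space_eq2)
    also have "\<dots> = integral\<^sup>L (\<nu> H) (\<lambda>x. indicator C (x 1) * indicator C (x H))"
      by (rule Bochner_Integration.integral_cong[OF refl eq[symmetric]])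
    finally show "tau \<nu> C h = integral\<^sup>L (\<nu> H) (\<lambda>x. indicator C (x 1) * indicator C (x H))" .
  qed
  have between: "L k \<le> tau \<nu> C h" "tau \<nu> C h \<le> U k" if "k \<ge> K" for k
  proof -
    show "L k \<le> tau \<nu> C h"
      unfolding L_def tau
      by (rule integral_mono[OF intg(1)[OF that H(1)] tau_int])
        (intro mult_mono inner_le_indicator inner_nonneg indicator_pos_le)
    show "tau \<nu> C h \<le> U k"
      unfolding U_def tau
      by (rule integral_mono[OF tau_int intg(2)[OF that H(1)]])
        (intro mult_mono indicator_le_outer outer_nonneg indicator_pos_le)
  qed
  have width: "U k - L k \<le> 2 * gap k" if "k \<ge> K" for k
  proof -
    \<comment> \<open>for numbers in the unit interval, a product changes by no more than its factors do in total\<close>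
    have le: "b * b' - c * c' \<le> (b - c) + (b' - c')"
      if "0 \<le> c" "c \<le> b" "b \<le> 1" "0 \<le> c'" "c' \<le> b'" "b' \<le> 1" for b b' c c' :: real
    proof -
      have "b * b' - c * c' = (b - c) * b' + c * (b' - c')" by (simp add: algebra_simps)
      also have "\<dots> \<le> (b - c) * 1 + 1 * (b' - c')"
        using that by (intro add_mono mult_mono) auto
      finally show ?thesis by simp
    qed
    have "U k - L k = integral\<^sup>L (\<nu> H) (\<lambda>x. outer k (x 1) * outer k (x H) - inner k (x 1) * inner k (x H))"
      unfolding U_def L_def by (rule Bochner_Integration.integral_diff[symmetric]) (rule intg[OF that H(1)])+
    also have "\<dots> \<le> integral\<^sup>L (\<nu> H) (\<lambda>x. (outer k (x 1) - inner k (x 1)) + (outer k (x H) - inner k (x H)))"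
      by (rule integral_mono[OF Bochner_Integration.integrable_diff[OF intg(2,1)[OF that H(1)]]
            Bochner_Integration.integrable_add[OF intg(3)[OF that H(1)] intg(3)[OF that H(2)]]])
        (intro le bounds)
    also have "\<dots> = integral\<^sup>L (\<nu> H) (\<lambda>x. outer k (x 1) - inner k (x 1)) + integral\<^sup>L (\<nu> H) (\<lambda>x. outer k (x H) - inner k (x H))"
      by (rule Bochner_Integration.integral_add) (rule intg[OF that] H)+
    also have "\<dots> = gap k + gap k"
      unfolding gap_def
      by (subst (1 2) integral_tail_marginal[of _ H "\<lambda>x. outer k x - inner k x", OF _ _ S(1,2)])
        (use S(3)[OF that] H in \<open>auto intro!: continuous_on_diff continuous_outer continuous_inner\<close>)
    finally show ?thesis by simp
  qed
  show ?thesis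
    unfolding P_def[symmetric]
  proof (rule tendstoI)
    fix e :: real assume e: "e > 0"
    have "\<forall>\<^sub>F k in sequentially. gap k < e / 4"
      by (rule order_tendstoD(2)[OF gap_tendsto_0]) (use e in simp)
    then have "\<forall>\<^sub>F k in sequentially. gap k < e / 4 \<and> k \<ge> K"
      using eventually_ge_at_top by (rule eventually_conj)
    then obtain k where k: "gap k < e / 4" "k \<ge> K"
      by (auto dest: eventually_happens)
    have "\<forall>\<^sub>F n in sequentially. L k - e / 2 < l k n" "\<forall>\<^sub>F n in sequentially. u k n < U k + e / 2"
      by (rule order_tendstoD[OF lim_l[OF k(2)]] order_tendstoD[OF lim_u[OF k(2)]], use e in simp)+
    then show "\<forall>\<^sub>F n in sequentially. dist (P n) (tau \<nu> C h) < e"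
    proof eventually_elim
      case (elim n)
      then show ?case
        using l_le_P[of k n] P_le_u[of n k] between[OF k(2)] width[OF k(2)] k(1)
        by (simp add: dist_real_def abs_less_iff)
    qed
  qed
qed

end


section \<open>Quadratic forms in centred variables\<close>

text \<open>Summation along the diagonals of a square.\<close>

lemma sum_dist_nat:
  fixes f :: "nat \<Rightarrow> real"
  shows "(\<Sum>s=1..n. \<Sum>t=1..n. f (nat \<bar>int s - int t\<bar>)) = real n * f 0 + 2 * (\<Sum>h=1..n-1. real (n - h) * f h)"
proof (induction n)
  case (Suc n)
  \<comment> \<open>the row and the column that the induction step adds to the square\<close>
  have new: "(\<Sum>t=1..n. f (nat \<bar>int (Suc n) - int t\<bar>)) = (\<Sum>h=1..n. f h)"
  proof (rule sum.reindex_bij_witness[of _ "\<lambda>h. Suc n - h" "\<lambda>t. Suc n - t"])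
    fix t assume "t \<in> {1..n}"
    then have "Suc n - t = nat \<bar>int (Suc n) - int t\<bar>" by auto
    then show "f (Suc n - t) = f (nat \<bar>int (Suc n) - int t\<bar>)" by (rule arg_cong)
  qed auto
  have new': "(\<Sum>s=1..n. f (nat \<bar>int s - int (Suc n)\<bar>)) = (\<Sum>h=1..n. f h)"
    using new by (simp only: abs_minus_commute)
  have "(\<Sum>s=1..Suc n. \<Sum>t=1..Suc n. f (nat \<bar>int s - int t\<bar>)) =
      (\<Sum>s=1..n. \<Sum>t=1..n. f (nat \<bar>int s - int t\<bar>)) + 2 * (\<Sum>h=1..n. f h) + f 0"
    using new new' by (simp add: sum.distrib)
  also have "\<dots> = real (Suc n) * f 0 + 2 * ((\<Sum>h=1..n-1. real (n - h) * f h) + (\<Sum>h=1..n. f h))"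
    unfolding Suc.IH by (simp add: algebra_simps)
  also have "(\<Sum>h=1..n-1. real (n - h) * f h) = (\<Sum>h=1..n. real (n - h) * f h)"
    by (cases n) simp_all
  also have "(\<Sum>h=1..n. real (n - h) * f h) + (\<Sum>h=1..n. f h) = (\<Sum>h=1..Suc n - 1. real (Suc n - h) * f h)"
    unfolding sum.distrib[symmetric] by (rule sum.cong) (auto simp: Suc_diff_le algebra_simps)
  finally show ?case .
qed simp

lemma cmod_sum_squared:
  fixes z :: "nat \<Rightarrow> real"
  shows "(cmod (\<Sum>t\<in>A. of_real (z t) * exp (\<i> * of_real (real t * \<theta>))))\<^sup>2 =
     (\<Sum>s\<in>A. \<Sum>t\<in>A. z s * z t * cos (\<theta> * real (nat \<bar>int s - int t\<bar>)))"
proof -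
  have exp: "exp (\<i> * of_real x) = cis x" for x
    by (simp add: cis_conv_exp)
  have "(cmod (\<Sum>t\<in>A. of_real (z t) * exp (\<i> * of_real (real t * \<theta>))))\<^sup>2 =
      (\<Sum>t\<in>A. z t * cos (real t * \<theta>))\<^sup>2 + (\<Sum>t\<in>A. z t * sin (real t * \<theta>))\<^sup>2"
    unfolding exp cmod_power2 by simp
  also have "\<dots> = (\<Sum>s\<in>A. \<Sum>t\<in>A. z s * z t *
      (cos (real s * \<theta>) * cos (real t * \<theta>) + sin (real s * \<theta>) * sin (real t * \<theta>)))"
    by (simp add: power2_eq_square sum_product sum.distrib[symmetric] algebra_simps)
  also have "\<dots> = (\<Sum>s\<in>A. \<Sum>t\<in>A. z s * z t * cos (\<theta> * real (nat \<bar>int s - int t\<bar>)))"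
  proof (intro sum.cong refl arg_cong2[where f="(*)"])
    fix s t :: nat
    have "cos (real s * \<theta>) * cos (real t * \<theta>) + sin (real s * \<theta>) * sin (real t * \<theta>) = cos (real s * \<theta> - real t * \<theta>)"
      by (simp add: cos_diff)
    also have "real s * \<theta> - real t * \<theta> = \<theta> * (real s - real t)" by (simp add: algebra_simps)
    also have "cos (\<theta> * (real s - real t)) = cos (\<theta> * \<bar>real s - real t\<bar>)"
      by (cases "real s \<le> real t") (auto simp: abs_if, metis cos_minus minus_diff_eq mult_minus_right)
    also have "\<bar>real s - real t\<bar> = real (nat \<bar>int s - int t\<bar>)" by simp
    finally show "cos (real s * \<theta>) * cos (real t * \<theta>) + sin (real s * \<theta>) * sin (real t * \<theta>) =
      cos (\<theta> * real (nat \<bar>int s - int t\<bar>))" .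
  qed
  finally show ?thesis .
qed

context prob_space
begin

lemma expectation_square_sum_indicators:
  fixes c :: "'i \<Rightarrow> real"
  assumes I: "finite I" and A: "\<And>i. i \<in> I \<Longrightarrow> A i \<in> events"
  shows "expectation (\<lambda>w. (\<Sum>i\<in>I. c i * (indicator (A i) w - prob (A i)))\<^sup>2) =
    (\<Sum>i\<in>I. \<Sum>j\<in>I. c i * c j * (prob (A i \<inter> A j) - prob (A i) * prob (A j)))"
proof -
  have "expectation (\<lambda>w. (\<Sum>i\<in>I. c i * (indicator (A i) w - prob (A i)))\<^sup>2) =
      expectation (\<lambda>w. \<Sum>i\<in>I. \<Sum>j\<in>I. c i * c j * (indicator (A i \<inter> A j) w
        - prob (A i) * indicator (A j) w - prob (A j) * indicator (A i) w + prob (A i) * prob (A j)))"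
    by (intro Bochner_Integration.integral_cong refl)
      (simp add: power2_eq_square sum_product indicator_inter_arith algebra_simps)
  also have "\<dots> = (\<Sum>i\<in>I. \<Sum>j\<in>I. c i * c j * (prob (A i \<inter> A j)
        - prob (A i) * prob (A j) - prob (A j) * prob (A i) + prob (A i) * prob (A j)))"
  proof -
    have int: "integrable M (indicator B :: _ \<Rightarrow> real)" if "B \<in> events" for B
      using that by (simp add: integrable_indicator_iff emeasure_eq_measure)
    have trm: "integrable M (\<lambda>w. indicator (A i \<inter> A j) w - prob (A i) * indicator (A j) w
          - prob (A j) * indicator (A i) w + prob (A i) * prob (A j))"
      "expectation (\<lambda>w. indicator (A i \<inter> A j) w - prob (A i) * indicator (A j) w
          - prob (A j) * indicator (A i) w + prob (A i) * prob (A j)) =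
        prob (A i \<inter> A j) - prob (A i) * prob (A j) - prob (A j) * prob (A i) + prob (A i) * prob (A j)"
      if "i \<in> I" "j \<in> I" for i j
      using int[OF A[OF that(1)]] int[OF A[OF that(2)]] int[OF sets.Int[OF A[OF that(1)] A[OF that(2)]]]
        A[OF that(1)] A[OF that(2)] prob_space
      by (simp_all add: sets.Int)
    show ?thesis
      by (subst Bochner_Integration.integral_sum,
          intro Bochner_Integration.integrable_sum Bochner_Integration.integrable_mult_right trm(1), assumption+,
          intro sum.cong refl, subst Bochner_Integration.integral_sum,
          intro Bochner_Integration.integrable_mult_right trm(1), assumption+,
          intro sum.cong refl) (simp add: trm(2))
  qed
  finally show ?thesis by (simp add: algebra_simps)
qed

end

section \<open>Covariances of exceedance events and exact moments\<close>

context extremal_set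
begin

lemma gen_events_exceed:
  assumes "finite S" "S \<subseteq> I"
  shows "exceed u S \<in> gen_events M X I"
proof -
  let ?G = "\<Union>s\<in>I. {X s -` B \<inter> space M | B. B \<in> sets borel}"
  interpret G: sigma_algebra "space M" "gen_events M X I"
    unfolding gen_events_def by (rule sigma_algebra_sigma_sets) auto
  have sng: "exceed u {s} \<in> gen_events M X I" if "s \<in> I" for s
  proof -
    have "(\<lambda>v. ext_vec ((1 / u) *\<^sub>R v)) -` C \<inter> space borel \<in> sets borel"
      by (rule measurable_sets[OF _ borel_C]) measurable
    moreover have "exceed u {s} = X s -` ((\<lambda>v. ext_vec ((1 / u) *\<^sub>R v)) -` C \<inter> space borel) \<inter> space M"
      by (auto simp: exceed_def)
    ultimately have "exceed u {s} \<in> ?G"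
      using that by blast
    then show ?thesis unfolding gen_events_def by (rule sigma_sets.Basic)
  qed
  have eqs: "exceed u {} = space M" "exceed u (insert s T) = exceed u {s} \<inter> exceed u T" for s T
    by (auto simp: exceed_def)
  show ?thesis
    using assms(1,2)
  proof (induction S rule: finite_induct)
    case (insert s T)
    then show ?case using G.Int[of "exceed u {s}" "exceed u T"] by (simp add: eqs(2)[of s T] sng)
  qed (simp add: eqs)
qed

lemma bdd_mixing:
  "bdd_above ((\<lambda>(A, B). \<bar>prob (A \<inter> B) - prob A * prob B\<bar>) ` D)"
proof -
  have "\<bar>prob (A \<inter> B) - prob A * prob B\<bar> \<le> 1" for A B
    using measure_nonneg[of M] prob_le_1 mult_le_one[of "prob A" "prob B"]
    by (smt (verit) mult_nonneg_nonneg)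
  then show ?thesis by (auto intro!: bdd_aboveI2[where M=1])
qed

text \<open>The supremum that defines the coefficient is over a bounded set, so it bounds each of its
  members.\<close>

lemma mixing_coeff_bound:
  assumes "A \<in> gen_events M X {..0}" "B \<in> gen_events M X {int h..}"
  shows "\<bar>prob (A \<inter> B) - prob A * prob B\<bar> \<le> mixing_coeff M X h"
  using cSUP_upper[OF _ bdd_mixing, of "(A, B)" "gen_events M X {..0} \<times> gen_events M X {int h..}"] assms
  by (simp add: mixing_coeff_def)

lemma mixing_coeff_nonneg: "0 \<le> mixing_coeff M X h"
  using mixing_coeff_bound[of "{}" "{}" h] by (simp add: gen_events_def sigma_sets.Empty)

lemma exceed_Un: "exceed u (S \<union> T) = exceed u S \<inter> exceed u T"
  by (auto simp: exceed_def)

lemma exceed_mono: "S \<subseteq> T \<Longrightarrow> exceed u T \<subseteq> exceed u S"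
  by (auto simp: exceed_def)

definition exceed_cov :: "real \<Rightarrow> int set \<Rightarrow> int set \<Rightarrow> real" where
  "exceed_cov u S T = prob (exceed u S \<inter> exceed u T) - prob (exceed u S) * prob (exceed u T)"

lemma exceed_cov_commute: "exceed_cov u S T = exceed_cov u T S"
  by (simp add: exceed_cov_def Int_commute mult.commute)

text \<open>Stationarity moves the last time of the earlier event to zero, where the definition of the
  coefficient applies.\<close>

lemma exceed_cov_le_mixing:
  assumes "finite S" "finite T" "\<And>s. s \<in> S \<Longrightarrow> s \<le> b" "\<And>t. t \<in> T \<Longrightarrow> b + int g \<le> t"
  shows "\<bar>exceed_cov u S T\<bar> \<le> mixing_coeff M X g"
proof -
  let ?S = "(\<lambda>s. s + (- b)) ` S" and ?T = "(\<lambda>s. s + (- b)) ` T"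
  have "?S \<subseteq> {..0}" "?T \<subseteq> {int g..}"
    using assms(3,4) by fastforce+
  then have "\<bar>prob (exceed u ?S \<inter> exceed u ?T) - prob (exceed u ?S) * prob (exceed u ?T)\<bar> \<le> mixing_coeff M X g"
    using assms(1,2) by (intro mixing_coeff_bound gen_events_exceed) auto
  moreover have "exceed u ?S \<inter> exceed u ?T = exceed u ((\<lambda>s. s + (- b)) ` (S \<union> T))"
    by (simp add: exceed_Un image_Un)
  ultimately show ?thesis
    unfolding exceed_cov_def
    using prob_exceed_shift[of S u "- b"] prob_exceed_shift[of T u "- b"] prob_exceed_shift[of "S \<union> T" u "- b"] assms(1,2)
    by (simp add: exceed_Un)
qed

lemma exceed_cov_le_prob:
  assumes "finite S"
  shows "\<bar>exceed_cov u S T\<bar> \<le> prob (exceed u S)"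
proof -
  have "prob (exceed u S \<inter> exceed u T) \<le> prob (exceed u S)"
    using assms by (intro finite_measure_mono) auto
  moreover have "prob (exceed u S) * prob (exceed u T) \<le> prob (exceed u S)"
    by (simp add: mult_left_le)
  ultimately show ?thesis
    unfolding exceed_cov_def using measure_nonneg[of M] by (smt (verit) mult_nonneg_nonneg)
qed

definition pair_prob :: "real \<Rightarrow> nat \<Rightarrow> real" where
  "pair_prob u h = prob (exceed u {0, int h})"

lemma pair_prob_nonneg: "0 \<le> pair_prob u h"
  by (simp add: pair_prob_def)

lemma prob_exceed_pair: "prob (exceed u {s, t}) = pair_prob u (nat \<bar>s - t\<bar>)"
proof -
  have *: "prob (exceed u {s, t}) = pair_prob u (nat \<bar>s - t\<bar>)" if "s \<le> t" for s t
  proof -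
    have "{s, t} = (\<lambda>x. x + s) ` {0, int (nat \<bar>s - t\<bar>)}" using that by auto
    then show ?thesis
      using prob_exceed_shift[of "{0, int (nat \<bar>s - t\<bar>)}" u s] by (simp add: pair_prob_def)
  qed
  show ?thesis
    using *[of s t] *[of t s] by (cases "s \<le> t") (auto simp: insert_commute abs_minus_commute)
qed

lemma pair_prob_0: "pair_prob u 0 = prob (exceed u {0})"
  by (simp add: pair_prob_def)

lemma prob_exceed_single: "prob (exceed u {t}) = pair_prob u 0"
  using prob_exceed_pair[of u t t] by simp

lemma exc_prob_eq: "exc_prob M X C u = pair_prob u 0"
  by (simp add: exc_prob_def pair_prob_0 exceed_def)

lemma exc_eq: "w \<in> space M \<Longrightarrow> exc X C u t w = indicator (exceed u {t}) w"
  by (simp add: exc_def exceed_def indicator_def)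

lemma exc_mult_eq: "w \<in> space M \<Longrightarrow> exc X C u s w * exc X C u t w = indicator (exceed u {s, t}) w"
  by (simp add: exc_def exceed_def indicator_def)

lemma integrable_indicator_exceed: "finite S \<Longrightarrow> integrable M (indicator (exceed u S) :: _ \<Rightarrow> real)"
  by (simp add: integrable_indicator_iff emeasure_eq_measure)

lemma exc_centered_mult_eq:
  assumes "w \<in> space M"
  shows "exc_centered M X C u s w * exc_centered M X C u t w =
    indicator (exceed u {s, t}) w - pair_prob u 0 * indicator (exceed u {s}) w
      - pair_prob u 0 * indicator (exceed u {t}) w + (pair_prob u 0)\<^sup>2"
  using exc_mult_eq[OF assms, of u s t]
  by (simp add: exc_centered_def exc_prob_eq exc_eq[OF assms] algebra_simps power2_eq_square)

lemma expectation_exc_centered: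
  shows "integrable M (\<lambda>w. exc_centered M X C u s w * exc_centered M X C u t w)"
    and "expectation (\<lambda>w. exc_centered M X C u s w * exc_centered M X C u t w) =
      pair_prob u (nat \<bar>s - t\<bar>) - (pair_prob u 0)\<^sup>2"
proof -
  let ?F = "\<lambda>w. indicator (exceed u {s, t}) w - pair_prob u 0 * indicator (exceed u {s}) w
      - pair_prob u 0 * indicator (exceed u {t}) w + (pair_prob u 0)\<^sup>2"
  have F: "integrable M ?F" "expectation ?F = pair_prob u (nat \<bar>s - t\<bar>) - (pair_prob u 0)\<^sup>2"
    using integrable_indicator_exceed[of _ u] prob_space
    by (simp_all add: prob_exceed_pair prob_exceed_single power2_eq_square)
  show "integrable M (\<lambda>w. exc_centered M X C u s w * exc_centered M X C u t w)"
    using F(1) by (rule Bochner_Integration.integrable_cong[THEN iffD1, rotated -1]) (simp_all add: exc_centered_mult_eq)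
  show "expectation (\<lambda>w. exc_centered M X C u s w * exc_centered M X C u t w) =
      pair_prob u (nat \<bar>s - t\<bar>) - (pair_prob u 0)\<^sup>2"
    unfolding F(2)[symmetric] by (rule Bochner_Integration.integral_cong) (simp_all add: exc_centered_mult_eq)
qed

text \<open>The covariance of the indicators at times \<open>s\<close> and \<open>t\<close> depends on \<open>|s - t|\<close>
  alone, so the double sum collapses to a weighted sum over lags.\<close>

lemma expectation_periodogram:
  assumes "n > 0"
  shows "expectation (periodogram M X C u m n \<theta>) =
    real m * (pair_prob u 0 - (pair_prob u 0)\<^sup>2)
      + 2 * (\<Sum>h=1..n-1. real (n - h) / real n * cos (\<theta> * real h) * (real m * (pair_prob u h - (pair_prob u 0)\<^sup>2)))"
proof -
  let ?g = "\<lambda>h. (pair_prob u h - (pair_prob u 0)\<^sup>2) * cos (\<theta> * real h)"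
  have "expectation (periodogram M X C u m n \<theta>) = real m / real n *
      expectation (\<lambda>w. \<Sum>s=1..n. \<Sum>t=1..n. exc_centered M X C u (int s) w * exc_centered M X C u (int t) w *
        cos (\<theta> * real (nat \<bar>int s - int t\<bar>)))"
    unfolding periodogram_def[abs_def] cmod_sum_squared by simp
  also have "\<dots> = real m / real n * (\<Sum>s=1..n. \<Sum>t=1..n. ?g (nat \<bar>int s - int t\<bar>))"
  proof -
    have "expectation (\<lambda>w. \<Sum>s=1..n. \<Sum>t=1..n. exc_centered M X C u (int s) w * exc_centered M X C u (int t) w *
        cos (\<theta> * real (nat \<bar>int s - int t\<bar>))) =
        (\<Sum>s=1..n. expectation (\<lambda>w. \<Sum>t=1..n. exc_centered M X C u (int s) w * exc_centered M X C u (int t) w *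
        cos (\<theta> * real (nat \<bar>int s - int t\<bar>))))"
      by (rule Bochner_Integration.integral_sum) (intro Bochner_Integration.integrable_sum
        Bochner_Integration.integrable_mult_left expectation_exc_centered(1))
    also have "\<dots> = (\<Sum>s=1..n. \<Sum>t=1..n. expectation (\<lambda>w. exc_centered M X C u (int s) w * exc_centered M X C u (int t) w *
        cos (\<theta> * real (nat \<bar>int s - int t\<bar>))))"
      by (intro sum.cong refl Bochner_Integration.integral_sum
        Bochner_Integration.integrable_mult_left expectation_exc_centered(1))
    also have "\<dots> = (\<Sum>s=1..n. \<Sum>t=1..n. ?g (nat \<bar>int s - int t\<bar>))"
      by (simp add: expectation_exc_centered(2))
    finally show ?thesis by simp
  qed
  also have "\<dots> = real m / real n * (real n * ?g 0 + 2 * (\<Sum>h=1..n-1. real (n - h) * ?g h))"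
    by (simp only: sum_dist_nat[of ?g])
  also have "\<dots> = real m * (pair_prob u 0 - (pair_prob u 0)\<^sup>2)
      + 2 * (\<Sum>h=1..n-1. real (n - h) / real n * cos (\<theta> * real h) * (real m * (pair_prob u h - (pair_prob u 0)\<^sup>2)))"
  proof -
    have "real m / real n * (\<Sum>h=1..n-1. real (n - h) * ?g h) =
        (\<Sum>h=1..n-1. real (n - h) / real n * cos (\<theta> * real h) * (real m * (pair_prob u h - (pair_prob u 0)\<^sup>2)))"
      unfolding sum_distrib_left by (intro sum.cong refl) simp
    moreover have "real m / real n * (real n * x + 2 * y) = real m * x + 2 * (real m / real n * y)" for x y
      using assms by (simp add: field_simps)
    ultimately show ?thesis by simp
  qed
  finally show ?thesis .
qed

text \<open>Weight of the indicator of a joint exceedance at lag \<open>h\<close>. The weight at lag zero is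
  special because the estimator centres the indicators there and only there:
  \<open>(I - p)\<^sup>2 = (1 - 2 p) I + p\<^sup>2\<close>.\<close>

definition lag_coeff :: "real \<Rightarrow> nat \<Rightarrow> nat \<Rightarrow> real \<Rightarrow> nat \<Rightarrow> real" where
  "lag_coeff u m n \<theta> h = real m / real n * (if h = 0 then 1 - 2 * pair_prob u 0 else 2 * cos (\<theta> * real h))"

text \<open>Index pairs are ordered as (lag, time).\<close>

definition lag_pairs :: "nat \<Rightarrow> nat \<Rightarrow> (nat \<times> nat) set" where
  "lag_pairs n r = (SIGMA h:{0..r}. {1..n - h})"

definition pair_event :: "real \<Rightarrow> nat \<times> nat \<Rightarrow> 'w set" where
  "pair_event u = (\<lambda>(h, t). exceed u {int t, int (t + h)})"

lemma prob_pair_event: "prob (pair_event u (h, t)) = pair_prob u h"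
  by (simp add: pair_event_def prob_exceed_pair)

lemma sets_pair_event [measurable]: "pair_event u i \<in> events"
  by (cases i) (simp add: pair_event_def)

text \<open>Written this way the estimator is a constant plus a linear combination of indicators, and its
  second moments are sums of covariances of events.\<close>

lemma lag_window_eq:
  assumes "n > 0" "w \<in> space M"
  shows "lag_window M X C u m r n \<theta> w =
    real m * (pair_prob u 0)\<^sup>2 + (\<Sum>i\<in>lag_pairs n r. lag_coeff u m n \<theta> (fst i) * indicator (pair_event u i) w)"
proof -
  have "gamma_hat M X C u m n 0 w = real m / real n *
      (\<Sum>t=1..n. (1 - 2 * pair_prob u 0) * indicator (pair_event u (0, t)) w + (pair_prob u 0)\<^sup>2)"
    unfolding gamma_hat_def
    by (intro arg_cong[where f="(*) _"] sum.cong)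
      (simp_all add: exc_centered_mult_eq[OF assms(2)] pair_event_def left_diff_distrib)
  also have "\<dots> = real m * (pair_prob u 0)\<^sup>2 + (\<Sum>t=1..n. lag_coeff u m n \<theta> 0 * indicator (pair_event u (0, t)) w)"
  proof -
    have "real m / real n * (real n * x) = real m * x" for x
      using assms(1) by simp
    then show ?thesis
      by (simp only: sum.distrib sum_constant card_atLeastAtMost distrib_left sum_distrib_left[symmetric]
          lag_coeff_def mult.assoc if_True diff_Suc_Suc diff_zero simp_thms add.commute One_nat_def)
  qed
  finally have 0: "gamma_hat M X C u m n 0 w = \<dots>" .
  have h: "2 * (cos (\<theta> * real h) * gamma_tilde X C u m n h w) =
      (\<Sum>t=1..n - h. lag_coeff u m n \<theta> h * indicator (pair_event u (h, t)) w)" if "h \<in> {1..r}" for h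
    using that unfolding gamma_tilde_def exc_mult_eq[OF assms(2)]
    by (simp add: lag_coeff_def pair_event_def sum_distrib_left mult.assoc mult.left_commute)
  have "(\<Sum>i\<in>lag_pairs n r. lag_coeff u m n \<theta> (fst i) * indicator (pair_event u i) w) =
      (\<Sum>h=0..r. \<Sum>t=1..n - h. lag_coeff u m n \<theta> h * indicator (pair_event u (h, t)) w)"
    unfolding lag_pairs_def by (subst sum.Sigma) (simp_all add: split_def)
  also have "\<dots> = (\<Sum>t=1..n. lag_coeff u m n \<theta> 0 * indicator (pair_event u (0, t)) w)
      + (\<Sum>h=1..r. \<Sum>t=1..n - h. lag_coeff u m n \<theta> h * indicator (pair_event u (h, t)) w)"
    by (subst sum.atLeast_Suc_atMost) simp_all
  also have "(\<Sum>h=1..r. \<Sum>t=1..n - h. lag_coeff u m n \<theta> h * indicator (pair_event u (h, t)) w) =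
      2 * (\<Sum>h=1..r. cos (\<theta> * real h) * gamma_tilde X C u m n h w)"
    unfolding sum_distrib_left by (intro sum.cong refl h[symmetric])
  finally show ?thesis
    unfolding lag_window_def 0 by simp
qed

lemma integrable_lag_sum:
  "integrable M (\<lambda>w. \<Sum>i\<in>lag_pairs n r. lag_coeff u m n \<theta> (fst i) * indicator (pair_event u i) w)"
  by (intro Bochner_Integration.integrable_sum Bochner_Integration.integrable_mult_right)
    (simp add: integrable_indicator_iff emeasure_eq_measure)

definition lag_mean :: "real \<Rightarrow> nat \<Rightarrow> nat \<Rightarrow> nat \<Rightarrow> real \<Rightarrow> real" where
  "lag_mean u m r n \<theta> = real m * (pair_prob u 0)\<^sup>2
     + (\<Sum>i\<in>lag_pairs n r. lag_coeff u m n \<theta> (fst i) * prob (pair_event u i))"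

lemma expectation_lag_window:
  assumes "n > 0"
  shows "expectation (lag_window M X C u m r n \<theta>) = lag_mean u m r n \<theta>"
proof -
  have "expectation (lag_window M X C u m r n \<theta>) = expectation (\<lambda>w. real m * (pair_prob u 0)\<^sup>2
      + (\<Sum>i\<in>lag_pairs n r. lag_coeff u m n \<theta> (fst i) * indicator (pair_event u i) w))"
    using assms by (intro Bochner_Integration.integral_cong) (simp_all add: lag_window_eq)
  also have "\<dots> = real m * (pair_prob u 0)\<^sup>2
      + expectation (\<lambda>w. \<Sum>i\<in>lag_pairs n r. lag_coeff u m n \<theta> (fst i) * indicator (pair_event u i) w)"
    using integrable_lag_sum prob_space by simp
  also have "expectation (\<lambda>w. \<Sum>i\<in>lag_pairs n r. lag_coeff u m n \<theta> (fst i) * indicator (pair_event u i) w)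
      = (\<Sum>i\<in>lag_pairs n r. expectation (\<lambda>w. lag_coeff u m n \<theta> (fst i) * indicator (pair_event u i) w))"
    by (intro Bochner_Integration.integral_sum Bochner_Integration.integrable_mult_right)
      (simp add: integrable_indicator_iff emeasure_eq_measure)
  finally show ?thesis
    by (simp add: lag_mean_def)
qed

lemma lag_mean_eq:
  assumes "n > 0"
  shows "lag_mean u m r n \<theta> = real m * (pair_prob u 0 - (pair_prob u 0)\<^sup>2)
    + (\<Sum>h=1..r. 2 * (real (n - h) / real n * cos (\<theta> * real h) * (real m * pair_prob u h)))"
proof -
  have "(\<Sum>i\<in>lag_pairs n r. lag_coeff u m n \<theta> (fst i) * prob (pair_event u i)) =
      (\<Sum>h=0..r. \<Sum>t=1..n - h. lag_coeff u m n \<theta> h * pair_prob u h)"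
    unfolding lag_pairs_def by (subst sum.Sigma) (auto intro!: sum.cong simp: prob_pair_event)
  also have "\<dots> = real n * (lag_coeff u m n \<theta> 0 * pair_prob u 0) + (\<Sum>h=1..r. real (n - h) * (lag_coeff u m n \<theta> h * pair_prob u h))"
    by (subst sum.atLeast_Suc_atMost) simp_all
  also have "real n * (lag_coeff u m n \<theta> 0 * pair_prob u 0) = real m * (pair_prob u 0 - 2 * (pair_prob u 0)\<^sup>2)"
    using assms by (simp add: lag_coeff_def power2_eq_square algebra_simps)
  also have "(\<Sum>h=1..r. real (n - h) * (lag_coeff u m n \<theta> h * pair_prob u h)) =
      (\<Sum>h=1..r. 2 * (real (n - h) / real n * cos (\<theta> * real h) * (real m * pair_prob u h)))"
    by (intro sum.cong) (auto simp: lag_coeff_def)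
  finally show ?thesis
    by (simp add: lag_mean_def algebra_simps)
qed

text \<open>Variance plus squared bias.\<close>

lemma mse_lag_window:
  assumes "n > 0"
  shows "expectation (\<lambda>w. (lag_window M X C u m r n \<theta> w - f)\<^sup>2) =
    (\<Sum>i\<in>lag_pairs n r. \<Sum>j\<in>lag_pairs n r. lag_coeff u m n \<theta> (fst i) * lag_coeff u m n \<theta> (fst j) *
        (prob (pair_event u i \<inter> pair_event u j) - prob (pair_event u i) * prob (pair_event u j)))
    + (lag_mean u m r n \<theta> - f)\<^sup>2"
proof -
  define D where "D w = (\<Sum>i\<in>lag_pairs n r. lag_coeff u m n \<theta> (fst i) * (indicator (pair_event u i) w - prob (pair_event u i)))" for w
  let ?b = "lag_mean u m r n \<theta> - f"
  have sq: "(x + y)\<^sup>2 = x\<^sup>2 + (2 * y * x + y\<^sup>2)" for x y :: real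
    by (simp add: power2_eq_square algebra_simps)
  have fin: "finite (lag_pairs n r)" by (simp add: lag_pairs_def)
  have ind: "integrable M (indicator (pair_event u i) :: _ \<Rightarrow> real)" for i
    by (simp add: integrable_indicator_iff emeasure_eq_measure)
  have D: "integrable M D" "expectation D = 0"
  proof -
    have int: "integrable M (\<lambda>w. lag_coeff u m n \<theta> (fst i) * (indicator (pair_event u i) w - prob (pair_event u i)))" for i
      by (intro Bochner_Integration.integrable_mult_right Bochner_Integration.integrable_diff ind) simp
    show "integrable M D"
      unfolding D_def[abs_def] by (intro Bochner_Integration.integrable_sum int)
    have "expectation D = (\<Sum>i\<in>lag_pairs n r.
        expectation (\<lambda>w. lag_coeff u m n \<theta> (fst i) * (indicator (pair_event u i) w - prob (pair_event u i))))"
      unfolding D_def[abs_def] by (intro Bochner_Integration.integral_sum int)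
    also have "\<dots> = 0"
      using ind prob_space by simp
    finally show "expectation D = 0" .
  qed
  have "\<bar>D w\<bar> \<le> (\<Sum>i\<in>lag_pairs n r. \<bar>lag_coeff u m n \<theta> (fst i)\<bar> * 1)" for w
    unfolding D_def
    by (rule order.trans[OF sum_abs]) (auto simp: abs_mult indicator_def intro!: sum_mono mult_left_le)
  then have "(D w)\<^sup>2 \<le> (\<Sum>i\<in>lag_pairs n r. \<bar>lag_coeff u m n \<theta> (fst i)\<bar> * 1)\<^sup>2" for w
    by (simp add: abs_le_square_iff[symmetric] sum_nonneg)
  then have D2: "integrable M (\<lambda>w. (D w)\<^sup>2)"
    using borel_measurable_integrable[OF D(1)]
    by (intro integrable_const_bound[where B="(\<Sum>i\<in>lag_pairs n r. \<bar>lag_coeff u m n \<theta> (fst i)\<bar> * 1)\<^sup>2"]) auto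
  have "expectation (\<lambda>w. (lag_window M X C u m r n \<theta> w - f)\<^sup>2) = expectation (\<lambda>w. (D w)\<^sup>2 + (2 * ?b * D w + ?b\<^sup>2))"
  proof (intro Bochner_Integration.integral_cong refl)
    fix w assume "w \<in> space M"
    then have "lag_window M X C u m r n \<theta> w - f = D w + ?b"
      by (simp add: lag_window_eq[OF assms] lag_mean_def D_def right_diff_distrib sum_subtractf)
    then show "(lag_window M X C u m r n \<theta> w - f)\<^sup>2 = (D w)\<^sup>2 + (2 * ?b * D w + ?b\<^sup>2)"
      by (simp only: sq)
  qed
  also have "\<dots> = expectation (\<lambda>w. (D w)\<^sup>2) + ?b\<^sup>2"
    using D D2 prob_space by simp
  also have "expectation (\<lambda>w. (D w)\<^sup>2) = (\<Sum>i\<in>lag_pairs n r. \<Sum>j\<in>lag_pairs n r. lag_coeff u m n \<theta> (fst i) * lag_coeff u m n \<theta> (fst j) *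
        (prob (pair_event u i \<inter> pair_event u j) - prob (pair_event u i) * prob (pair_event u j)))"
    unfolding D_def by (rule expectation_square_sum_indicators[OF fin]) simp
  finally show ?thesis .
qed

end


section \<open>Series with uniformly small tails\<close>

text \<open>Interchange of limit and series under uniformly small tails. There is no common
  summable majorant: the tails are small only for \<open>n\<close> beyond a bound that depends on
  the required accuracy, and the range of summation grows as well. The tail condition passes to the
  limit sequence, which is therefore summable.\<close>

lemma tendsto_suminf_uniform_tail:
  fixes x :: "nat \<Rightarrow> nat \<Rightarrow> real"
  assumes r: "filterlim r at_top sequentially"
    and lim: "\<And>h. (\<lambda>n. x n h) \<longlonglongrightarrow> y h"
    and tail: "\<And>e. e > 0 \<Longrightarrow> \<exists>k. \<forall>\<^sub>F n in sequentially. (\<Sum>h=k..<r n. \<bar>x n h\<bar>) \<le> e"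
  shows "(\<lambda>n. \<Sum>h<r n. x n h) \<longlonglongrightarrow> (\<Sum>h. y h)"
proof -
  have y_tail: "(\<Sum>h=k..<K. \<bar>y h\<bar>) \<le> e"
    if k: "\<forall>\<^sub>F n in sequentially. (\<Sum>h=k..<r n. \<bar>x n h\<bar>) \<le> e" for k K e
  proof (rule tendsto_upperbound)
    show "(\<lambda>n. \<Sum>h=k..<K. \<bar>x n h\<bar>) \<longlonglongrightarrow> (\<Sum>h=k..<K. \<bar>y h\<bar>)"
      by (intro tendsto_intros lim)
    have "\<forall>\<^sub>F n in sequentially. K \<le> r n"
      using r by (simp add: filterlim_at_top)
    with k show "\<forall>\<^sub>F n in sequentially. (\<Sum>h=k..<K. \<bar>x n h\<bar>) \<le> e"
    proof eventually_elim
      case (elim n)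
      have "(\<Sum>h=k..<K. \<bar>x n h\<bar>) \<le> (\<Sum>h=k..<r n. \<bar>x n h\<bar>)"
        using elim(2) by (intro sum_mono2) auto
      then show ?case using elim(1) by simp
    qed
  qed simp
  obtain k1 where k1: "\<forall>\<^sub>F n in sequentially. (\<Sum>h=k1..<r n. \<bar>x n h\<bar>) \<le> 1"
    using tail[of 1] by auto
  have abs: "summable (\<lambda>h. \<bar>y h\<bar>)"
  proof (rule summableI_nonneg_bounded)
    fix N
    have "(\<Sum>h<N. \<bar>y h\<bar>) \<le> (\<Sum>h\<in>{..<k1} \<union> {k1..<N}. \<bar>y h\<bar>)"
      by (intro sum_mono2) auto
    also have "\<dots> = (\<Sum>h<k1. \<bar>y h\<bar>) + (\<Sum>h=k1..<N. \<bar>y h\<bar>)"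
      by (intro sum.union_disjoint) auto
    also have "\<dots> \<le> (\<Sum>h<k1. \<bar>y h\<bar>) + 1"
      using y_tail[OF k1, of N] by simp
    finally show "(\<Sum>h<N. \<bar>y h\<bar>) \<le> (\<Sum>h<k1. \<bar>y h\<bar>) + 1" .
  qed simp
  have y: "summable y"
    using summable_rabs_cancel[OF abs] .
  show ?thesis
  proof (rule tendstoI)
    fix e :: real assume e: "e > 0"
    obtain k where k: "\<forall>\<^sub>F n in sequentially. (\<Sum>h=k..<r n. \<bar>x n h\<bar>) \<le> e / 4"
      using tail[of "e / 4"] e by auto
    have split: "(\<Sum>h<N. z h) = (\<Sum>h<k. z h) + (\<Sum>h=k..<N. z h)" if "k \<le> N" for z :: "nat \<Rightarrow> real" and N
      using that sum.atLeastLessThan_concat[of 0 k N z] by (simp add: lessThan_atLeast0)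
    have rest: "\<bar>(\<Sum>h. y h) - (\<Sum>h<k. y h)\<bar> \<le> e / 4"
    proof (rule tendsto_upperbound)
      show "(\<lambda>N. \<bar>(\<Sum>h<N. y h) - (\<Sum>h<k. y h)\<bar>) \<longlonglongrightarrow> \<bar>(\<Sum>h. y h) - (\<Sum>h<k. y h)\<bar>"
        by (intro tendsto_intros summable_LIMSEQ y)
      show "\<forall>\<^sub>F N in sequentially. \<bar>(\<Sum>h<N. y h) - (\<Sum>h<k. y h)\<bar> \<le> e / 4"
        using eventually_ge_at_top[of k]
      proof eventually_elim
        case (elim N)
        have "\<bar>\<Sum>h=k..<N. y h\<bar> \<le> (\<Sum>h=k..<N. \<bar>y h\<bar>)" by (rule sum_abs)
        also have "\<dots> \<le> e / 4" by (rule y_tail[OF k])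
        finally show ?case using split[OF elim, of y] by simp
      qed
    qed simp
    have "(\<lambda>n. \<Sum>h<k. x n h) \<longlonglongrightarrow> (\<Sum>h<k. y h)"
      by (intro tendsto_intros lim)
    then have "\<forall>\<^sub>F n in sequentially. dist (\<Sum>h<k. x n h) (\<Sum>h<k. y h) < e / 4"
      using e by (intro tendstoD) auto
    moreover have "\<forall>\<^sub>F n in sequentially. k \<le> r n"
      using r by (simp add: filterlim_at_top)
    ultimately show "\<forall>\<^sub>F n in sequentially. dist (\<Sum>h<r n. x n h) (\<Sum>h. y h) < e"
      using k
    proof eventually_elim
      case (elim n)
      have "\<bar>\<Sum>h=k..<r n. x n h\<bar> \<le> e / 4"
        using sum_abs[of "x n" "{k..<r n}"] elim(3) by linarith
      then show ?case
        using split[OF elim(2), of "x n"] elim(1) rest e unfolding dist_real_def by linarith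
    qed
  qed
qed

section \<open>A bound for the variance of the lag-window estimator\<close>

context extremal_set
begin

lemma pair_event_cov: 
  "prob (pair_event u (h, t) \<inter> pair_event u (h', t')) - prob (pair_event u (h, t)) * prob (pair_event u (h', t')) =
    exceed_cov u {int t, int (t + h)} {int t', int (t' + h')}"
  by (simp add: pair_event_def exceed_cov_def)

lemma pair_prob_le_0: "pair_prob u h \<le> pair_prob u 0"
  unfolding pair_prob_def by (intro finite_measure_mono exceed_mono) auto

lemma pair_prob_le_1: "pair_prob u h \<le> 1"
  by (simp add: pair_prob_def)

lemma pair_cov_le_mixing: "\<bar>pair_prob u h - (pair_prob u 0)\<^sup>2\<bar> \<le> mixing_coeff M X h"
  using exceed_cov_le_mixing[of "{0}" "{int h}" 0 h u] prob_exceed_single[of u "int h"]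
  by (simp add: exceed_cov_def exceed_Un[symmetric] pair_prob_def power2_eq_square insert_commute)

text \<open>Pairs of times more than \<open>2 * r\<close> apart leave a gap of at least the distance minus
  \<open>r\<close> between the two events, which mixing exploits. For close pairs the covariance of two events
  is at most the probability of either one; whichever has lag larger than \<open>k\<close> is used, since
  anti-clustering makes these probabilities small in total, and pairs with two lags up to \<open>k\<close>
  are few.\<close>

lemma abs_exceed_cov_pairs_le:
  assumes "h \<le> r" "h' \<le> r"
  shows "\<bar>exceed_cov u {int t, int (t + h)} {int t', int (t' + h')}\<bar> \<le>
    (if nat \<bar>int t - int t'\<bar> > 2 * r then mixing_coeff M X (nat \<bar>int t - int t'\<bar> - r)
     else (if h > k then pair_prob u h else 0) + (if h' > k then pair_prob u h' else 0)
       + (if h \<le> k then 1 else 0) * (if h' \<le> k then 1 else 0) * pair_prob u 0)"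
    (is "\<bar>?c\<bar> \<le> (if ?far then ?\<alpha> else ?near)")
proof (cases ?far)
  case True
  have "\<bar>?c\<bar> \<le> ?\<alpha>"
  proof (cases "t \<le> t'")
    case le: True
    show ?thesis
      by (rule exceed_cov_le_mixing[where b="int (t + h)"]) (use True le assms in auto)
  next
    case False
    show ?thesis
      by (subst exceed_cov_commute, rule exceed_cov_le_mixing[where b="int (t' + h')"]) (use True False assms in auto)
  qed
  with True show ?thesis by simp
next
  case False
  have 1: "\<bar>?c\<bar> \<le> pair_prob u h"
    using exceed_cov_le_prob[of "{int t, int (t + h)}" u "{int t', int (t' + h')}"] by (simp add: prob_exceed_pair)
  have 2: "\<bar>?c\<bar> \<le> pair_prob u h'"
    using exceed_cov_le_prob[of "{int t', int (t' + h')}" u "{int t, int (t + h)}"]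
    by (simp add: prob_exceed_pair exceed_cov_commute)
  have "\<bar>?c\<bar> \<le> ?near"
    using 1 2 pair_prob_le_0[of u h] pair_prob_nonneg[of u h] pair_prob_nonneg[of u h']
    by (cases "h \<le> k"; cases "h' \<le> k") auto
  with False show ?thesis by simp
qed

definition lag_variance :: "real \<Rightarrow> nat \<Rightarrow> nat \<Rightarrow> nat \<Rightarrow> real \<Rightarrow> real" where
  "lag_variance u m r n \<theta> =
    (\<Sum>i\<in>lag_pairs n r. \<Sum>j\<in>lag_pairs n r. lag_coeff u m n \<theta> (fst i) * lag_coeff u m n \<theta> (fst j) *
        (prob (pair_event u i \<inter> pair_event u j) - prob (pair_event u i) * prob (pair_event u j)))"

lemma lag_variance_nonneg:
  assumes "n > 0"
  shows "0 \<le> lag_variance u m r n \<theta>"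
proof -
  have "lag_variance u m r n \<theta> = expectation (\<lambda>w. (lag_window M X C u m r n \<theta> w - lag_mean u m r n \<theta>)\<^sup>2)"
    using mse_lag_window[OF assms, of u m r \<theta> "lag_mean u m r n \<theta>"] by (simp add: lag_variance_def)
  then show ?thesis by simp
qed

lemma abs_lag_coeff_le: "\<bar>lag_coeff u m n \<theta> h\<bar> \<le> 2 * real m / real n"
proof -
  have "\<bar>if h = 0 then 1 - 2 * pair_prob u 0 else 2 * cos (\<theta> * real h)\<bar> \<le> 2"
    using pair_prob_nonneg[of u 0] pair_prob_le_1[of u 0] abs_cos_le_one[of "\<theta> * real h"] by (auto simp: abs_mult)
  then have "real m / real n * \<bar>if h = 0 then 1 - 2 * pair_prob u 0 else 2 * cos (\<theta> * real h)\<bar> \<le> real m / real n * 2"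
    by (intro mult_left_mono) auto
  then show ?thesis by (simp add: lag_coeff_def abs_mult mult.commute)
qed

text \<open>Each of the \<open>n\<close> times has at most \<open>1 + 4 r\<close> close partners; the sum over the two
  lags is carried out last. The probabilities of lags above \<open>k\<close> enter through \<open>S\<close> and the
  mixing coefficients through \<open>A\<close>.\<close>

lemma lag_variance_le:
  fixes u k m n r
  defines "S \<equiv> \<Sum>h=k..r. pair_prob u h"
    and "A \<equiv> \<Sum>d\<in>{2 * r<..<n}. mixing_coeff M X (d - r)"
  shows "lag_variance u m r n \<theta> \<le> (2 * real m / real n)\<^sup>2 * (real n *
    ((1 + 4 * real r) * (2 * (real r + 1) * S + (real k + 1)\<^sup>2 * pair_prob u 0) + 2 * (real r + 1)\<^sup>2 * A))"
proof -
  define q where "q h = (if h > k then pair_prob u h else 0)" for h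
  define q0 where "q0 h = (if h \<le> k then 1 else 0 :: real)" for h
  define Q where "Q h h' = q h + q h' + q0 h * q0 h' * pair_prob u 0" for h h'
  define W where "W h h' d = (if d > 2 * r then mixing_coeff M X (d - r) else Q h h')" for h h' d
  have Q: "0 \<le> Q h h'" for h h'
    by (simp add: Q_def q_def q0_def pair_prob_nonneg)
  have W: "0 \<le> W h h' d" for h h' d
    using Q by (simp add: W_def mixing_coeff_nonneg)
  let ?R = "{0..r} \<times> {1..n}"
  let ?cov = "\<lambda>i j. prob (pair_event u i \<inter> pair_event u j) - prob (pair_event u i) * prob (pair_event u j)"
  let ?w = "\<lambda>i j. W (fst i) (fst j) (nat \<bar>int (snd i) - int (snd j)\<bar>)"
  have sub: "lag_pairs n r \<subseteq> ?R" by (auto simp: lag_pairs_def)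
  have cov: "\<bar>?cov i j\<bar> \<le> ?w i j" if "i \<in> lag_pairs n r" "j \<in> lag_pairs n r" for i j
  proof -
    obtain h t h' t' where "i = (h, t)" "j = (h', t')" by (cases i; cases j)
    have "h \<le> r" "h' \<le> r"
      using that \<open>i = (h, t)\<close> \<open>j = (h', t')\<close> by (auto simp: lag_pairs_def)
    then show ?thesis
      using abs_exceed_cov_pairs_le[of h r h' u t t' k]
      by (simp only: \<open>i = (h, t)\<close> \<open>j = (h', t')\<close> fst_conv snd_conv pair_event_cov W_def Q_def q_def q0_def)
  qed
  \<comment> \<open>\<open>W\<close> depends on the times through their distance only, and extending the sums to a full rectangle makes the sum over times one over distances\<close>
  have "lag_variance u m r n \<theta> \<le> (\<Sum>i\<in>lag_pairs n r. \<Sum>j\<in>lag_pairs n r. (2 * real m / real n)\<^sup>2 * ?w i j)"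
    unfolding lag_variance_def
  proof (intro sum_mono)
    fix i j assume ij: "i \<in> lag_pairs n r" "j \<in> lag_pairs n r"
    let ?c = "lag_coeff u m n \<theta>"
    have "?c (fst i) * ?c (fst j) * ?cov i j \<le> \<bar>?c (fst i)\<bar> * \<bar>?c (fst j)\<bar> * \<bar>?cov i j\<bar>"
      by (metis abs_ge_self abs_mult)
    also have "\<dots> \<le> (2 * real m / real n) * (2 * real m / real n) * ?w i j"
      by (intro mult_mono abs_lag_coeff_le cov ij) auto
    finally show "?c (fst i) * ?c (fst j) * ?cov i j \<le> (2 * real m / real n)\<^sup>2 * ?w i j"
      by (simp only: power2_eq_square)
  qed
  also have "\<dots> = (2 * real m / real n)\<^sup>2 * (\<Sum>i\<in>lag_pairs n r. \<Sum>j\<in>lag_pairs n r. ?w i j)"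
    by (simp only: sum_distrib_left)
  also have "\<dots> \<le> (2 * real m / real n)\<^sup>2 * (\<Sum>i\<in>?R. \<Sum>j\<in>?R. ?w i j)"
  proof (rule mult_left_mono)
    have "(\<Sum>i\<in>lag_pairs n r. \<Sum>j\<in>lag_pairs n r. ?w i j) \<le> (\<Sum>i\<in>lag_pairs n r. \<Sum>j\<in>?R. ?w i j)"
      using sub W by (intro sum_mono sum_mono2) auto
    also have "\<dots> \<le> (\<Sum>i\<in>?R. \<Sum>j\<in>?R. ?w i j)"
      using sub W by (intro sum_mono2 sum_nonneg) auto
    finally show "(\<Sum>i\<in>lag_pairs n r. \<Sum>j\<in>lag_pairs n r. ?w i j) \<le> (\<Sum>i\<in>?R. \<Sum>j\<in>?R. ?w i j)" .
  qed simp
  also have "(\<Sum>i\<in>?R. \<Sum>j\<in>?R. ?w i j) =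
      (\<Sum>h=0..r. \<Sum>h'=0..r. \<Sum>t=1..n. \<Sum>t'=1..n. W h h' (nat \<bar>int t - int t'\<bar>))"
  proof -
    have "(\<Sum>i\<in>?R. \<Sum>j\<in>?R. ?w i j) = (\<Sum>h=0..r. \<Sum>t=1..n. \<Sum>h'=0..r. \<Sum>t'=1..n. W h h' (nat \<bar>int t - int t'\<bar>))"
      by (simp only: sum.cartesian_product' fst_conv snd_conv)
    also have "\<dots> = (\<Sum>h=0..r. \<Sum>h'=0..r. \<Sum>t=1..n. \<Sum>t'=1..n. W h h' (nat \<bar>int t - int t'\<bar>))"
      by (intro sum.cong refl sum.swap)
    finally show ?thesis .
  qed
  also have "(\<Sum>h=0..r. \<Sum>h'=0..r. \<Sum>t=1..n. \<Sum>t'=1..n. W h h' (nat \<bar>int t - int t'\<bar>))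
      \<le> (\<Sum>h=0..r. \<Sum>h'=0..r. real n * ((1 + 4 * real r) * Q h h' + 2 * A))"
  proof (intro sum_mono)
    fix h h'
    have "(\<Sum>t=1..n. \<Sum>t'=1..n. W h h' (nat \<bar>int t - int t'\<bar>)) =
        real n * W h h' 0 + 2 * (\<Sum>d=1..n-1. real (n - d) * W h h' d)"
      by (rule sum_dist_nat)
    also have "\<dots> \<le> real n * W h h' 0 + 2 * (\<Sum>d=1..n-1. real n * W h h' d)"
      by (intro add_left_mono mult_left_mono sum_mono mult_right_mono W) auto
    also have "\<dots> = real n * (Q h h' + 2 * (\<Sum>d=1..n-1. W h h' d))"
      by (simp add: sum_distrib_left[symmetric] W_def algebra_simps)
    also have "\<dots> \<le> real n * (Q h h' + 2 * (2 * real r * Q h h' + A))"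
    proof (intro mult_left_mono add_left_mono)
      have "(\<Sum>d=1..n-1. W h h' d) \<le> (\<Sum>d\<in>{1..2 * r} \<union> {2 * r<..<n}. W h h' d)"
        using W by (intro sum_mono2) auto
      also have "\<dots> = (\<Sum>d\<in>{1..2 * r}. W h h' d) + (\<Sum>d\<in>{2 * r<..<n}. W h h' d)"
        by (intro sum.union_disjoint) auto
      also have "(\<Sum>d\<in>{1..2 * r}. W h h' d) = 2 * real r * Q h h'"
        by (simp add: W_def)
      also have "(\<Sum>d\<in>{2 * r<..<n}. W h h' d) = A"
        unfolding A_def by (intro sum.cong) (auto simp: W_def)
      finally show "(\<Sum>d=1..n-1. W h h' d) \<le> 2 * real r * Q h h' + A" .
    qed auto
    also have "\<dots> = real n * ((1 + 4 * real r) * Q h h' + 2 * A)"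
      by (simp add: algebra_simps)
    finally show "(\<Sum>t=1..n. \<Sum>t'=1..n. W h h' (nat \<bar>int t - int t'\<bar>)) \<le> real n * ((1 + 4 * real r) * Q h h' + 2 * A)" .
  qed
  also have "\<dots> = real n * ((1 + 4 * real r) * (\<Sum>h=0..r. \<Sum>h'=0..r. Q h h') + 2 * (real r + 1)\<^sup>2 * A)"
  proof -
    have "(\<Sum>h=0..r. \<Sum>h'=0..r. real n * (c * Q h h' + b)) =
        real n * (c * (\<Sum>h=0..r. \<Sum>h'=0..r. Q h h') + real (r + 1) * (real (r + 1) * b))" for b c
      by (simp only: sum_distrib_left[symmetric] sum.distrib sum_constant card_atLeastAtMost diff_zero Suc_eq_plus1)
    then show ?thesis
      by (simp add: power2_eq_square add.commute)
  qed
  also have "\<dots> \<le> real n * ((1 + 4 * real r) * (2 * (real r + 1) * S + (real k + 1)\<^sup>2 * pair_prob u 0) + 2 * (real r + 1)\<^sup>2 * A)"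
  proof (intro mult_left_mono add_right_mono)
    have "(\<Sum>h=0..r. q h) = (\<Sum>h\<in>{0..r} \<inter> {h. h > k}. pair_prob u h)"
      unfolding q_def by (subst sum.inter_restrict) (auto intro: sum.cong)
    also have "\<dots> \<le> S"
      unfolding S_def by (intro sum_mono2) (auto simp: pair_prob_nonneg)
    finally have qS: "(\<Sum>h=0..r. q h) \<le> S" .
    have "(\<Sum>h=0..r. q0 h) = (\<Sum>h\<in>{0..r} \<inter> {h. h \<le> k}. 1)"
      unfolding q0_def by (subst sum.inter_restrict) (auto intro: sum.cong)
    also have "\<dots> \<le> (\<Sum>h\<in>{0..k}. 1)"
      by (intro sum_mono2) auto
    finally have q0k: "(\<Sum>h=0..r. q0 h) \<le> real k + 1" by simp
    have "0 \<le> (\<Sum>h=0..r. q0 h)" by (simp add: q0_def sum_nonneg)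
    then have q0k2: "(\<Sum>h=0..r. q0 h)\<^sup>2 \<le> (real k + 1)\<^sup>2"
      using q0k by (intro power_mono)
    have "(\<Sum>h=0..r. \<Sum>h'=0..r. Q h h') = 2 * (real r + 1) * (\<Sum>h=0..r. q h) + (\<Sum>h=0..r. q0 h)\<^sup>2 * pair_prob u 0"
    proof -
      have "(\<Sum>h=0..r. q0 h)\<^sup>2 * pair_prob u 0 = (\<Sum>h=0..r. \<Sum>h'=0..r. q0 h * q0 h' * pair_prob u 0)"
        by (simp only: power2_eq_square sum_product) (simp only: sum_distrib_right)
      then show ?thesis
        by (simp add: Q_def sum.distrib sum_distrib_left algebra_simps)
    qed
    also have "\<dots> \<le> 2 * (real r + 1) * S + (real k + 1)\<^sup>2 * pair_prob u 0"
      by (intro add_mono mult_left_mono mult_right_mono qS q0k2 pair_prob_nonneg) auto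
    finally show "(\<Sum>h=0..r. \<Sum>h'=0..r. Q h h') \<le> 2 * (real r + 1) * S + (real k + 1)\<^sup>2 * pair_prob u 0" .
  qed auto
  finally show ?thesis
    by (simp add: mult_left_mono)
qed

end


section \<open>Limits of the spectral estimators\<close>

locale lag_window_regime = extremal_set M X \<alpha> \<mu> a C
  for M :: "'w measure" and X :: "int \<Rightarrow> 'w \<Rightarrow> real ^ 'd" and \<alpha> \<mu> a C +
  fixes m r :: "nat \<Rightarrow> nat"
  assumes m_top: "filterlim m at_top sequentially"
    and r_top: "filterlim r at_top sequentially"
    and m_small: "(\<lambda>n. real (m n) / real n) \<longlonglongrightarrow> 0"
    and r_small: "(\<lambda>n. real (r n) / real (m n)) \<longlonglongrightarrow> 0"
    and mixing: "(\<lambda>n. of_nat (m n) * (\<Sum>h. ennreal (mixing_coeff M X (r n + h)))) \<longlonglongrightarrow> 0"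
    and anticlustering: "\<And>\<epsilon>. \<epsilon> > 0 \<Longrightarrow>
           (\<lambda>k. limsup (\<lambda>n. ereal (real (m n) *
              (\<Sum>h=k..r n. measure M {w \<in> space M.
                 norm (X (int h) w) > \<epsilon> * a (m n) \<and> norm (X 0 w) > \<epsilon> * a (m n)})))) \<longlonglongrightarrow> 0"
begin

definition P :: "nat \<Rightarrow> nat \<Rightarrow> real" where
  "P n h = pair_prob (a (m n)) h"

lemma P_nonneg: "0 \<le> P n h"
  by (simp add: P_def pair_prob_nonneg)

lemma eventually_m_pos: "\<forall>\<^sub>F n in sequentially. 0 < m n"
  by (rule eventually_compose_filterlim[OF eventually_gt_at_top m_top])

lemma eventually_r_pos: "\<forall>\<^sub>F n in sequentially. 0 < r n"
  by (rule eventually_compose_filterlim[OF eventually_gt_at_top r_top])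

lemma eventually_r_less: "\<forall>\<^sub>F n in sequentially. r n < n"
proof -
  have "\<forall>\<^sub>F n in sequentially. real (r n) / real (m n) < 1" "\<forall>\<^sub>F n in sequentially. real (m n) / real n < 1"
    by (rule order_tendstoD(2)[OF r_small] order_tendstoD(2)[OF m_small], simp)+
  with eventually_m_pos eventually_gt_at_top[of 0] show ?thesis
  proof eventually_elim
    case (elim n)
    then show ?case by (simp add: field_simps)
  qed
qed

lemma mP_tendsto: "(\<lambda>n. real (m n) * P n h) \<longlonglongrightarrow> tau \<nu> C h"
  unfolding P_def pair_prob_def
  using filterlim_compose[OF scaled_prob_pair_tendsto m_top] by simp

text \<open>The centring terms of all \<open>r n\<close> lags together:
  \<open>r m p\<^sup>2 = (r / m) (m p)\<^sup>2\<close>, with \<open>m p\<close> convergent.\<close>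

lemma rmP0_sq_tendsto: "(\<lambda>n. real (r n) * (real (m n) * (P n 0)\<^sup>2)) \<longlonglongrightarrow> 0"
proof (rule Lim_transform_eventually)
  show "(\<lambda>n. real (r n) / real (m n) * (real (m n) * P n 0)\<^sup>2) \<longlonglongrightarrow> 0"
    using tendsto_mult[OF r_small tendsto_power[OF mP_tendsto[of 0], of 2]] by simp
  show "\<forall>\<^sub>F n in sequentially. real (r n) / real (m n) * (real (m n) * P n 0)\<^sup>2 = real (r n) * (real (m n) * (P n 0)\<^sup>2)"
    using eventually_m_pos by eventually_elim (simp add: power2_eq_square)
qed

lemma mP0_sq_tendsto: "(\<lambda>n. real (m n) * (P n 0)\<^sup>2) \<longlonglongrightarrow> 0"
proof (rule Lim_null_comparison[OF _ rmP0_sq_tendsto])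
  show "\<forall>\<^sub>F n in sequentially. norm (real (m n) * (P n 0)\<^sup>2) \<le> real (r n) * (real (m n) * (P n 0)\<^sup>2)"
    using eventually_r_pos
  proof eventually_elim
    case (elim n)
    then have "1 * (real (m n) * (P n 0)\<^sup>2) \<le> real (r n) * (real (m n) * (P n 0)\<^sup>2)"
      by (intro mult_right_mono) auto
    then show ?case by simp
  qed
qed

text \<open>A joint exceedance of \<open>C\<close> forces both norms above a fixed multiple of the threshold, so
  the anti-clustering hypothesis covers the probabilities that occur in the spectral estimators.\<close>

lemma anticlustering_P:
  assumes "e > 0"
  shows "\<exists>k. \<forall>\<^sub>F n in sequentially. real (m n) * (\<Sum>h=k..r n. P n h) < e"
proof -
  obtain \<epsilon> :: real where \<epsilon>: "\<epsilon> > 0" "\<And>x. x \<in> C \<Longrightarrow> ereal \<epsilon> < ext_norm x"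
    using bounded_away by (auto simp: bounded_away_from_zero_def)
  let ?p = "\<lambda>n h. prob {w \<in> space M. norm (X (int h) w) > \<epsilon> * a (m n) \<and> norm (X 0 w) > \<epsilon> * a (m n)}"
  have le: "P n h \<le> ?p n h" if "0 < a (m n)" for n h
  proof -
    have "norm (X t w) > \<epsilon> * a (m n)" if "ext_vec ((1 / a (m n)) *\<^sub>R X t w) \<in> C" for t w
      using \<epsilon>(2)[OF that] \<open>0 < a (m n)\<close> by (simp add: ext_norm_ext_vec field_simps)
    then show ?thesis
      unfolding P_def pair_prob_def exceed_def by (intro finite_measure_mono) auto
  qed
  have "\<forall>\<^sub>F k in sequentially. limsup (\<lambda>n. ereal (real (m n) * (\<Sum>h=k..r n. ?p n h))) < ereal e"
    by (rule order_tendstoD(2)[OF anticlustering[OF \<epsilon>(1)]]) (use assms in simp)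
  then obtain k where "limsup (\<lambda>n. ereal (real (m n) * (\<Sum>h=k..r n. ?p n h))) < ereal e"
    by (auto dest: eventually_happens)
  then have "\<forall>\<^sub>F n in sequentially. ereal (real (m n) * (\<Sum>h=k..r n. ?p n h)) < ereal e"
    by (rule Limsup_lessD)
  moreover have "\<forall>\<^sub>F n in sequentially. 0 < a (m n)"
    by (rule eventually_compose_filterlim[OF eventually_a_pos m_top])
  ultimately have "\<forall>\<^sub>F n in sequentially. real (m n) * (\<Sum>h=k..r n. P n h) < e"
  proof eventually_elim
    case (elim n)
    have "real (m n) * (\<Sum>h=k..r n. P n h) \<le> real (m n) * (\<Sum>h=k..r n. ?p n h)"
      by (intro mult_left_mono sum_mono le elim) auto
    then show ?case using elim(1) by simp
  qed
  then show ?thesis by blast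
qed

text \<open>Bounding all finite sums at once turns the extended-real mixing condition into real
  inequalities without a separate summability argument.\<close>

lemma mixing_sums:
  obtains \<beta> where "\<beta> \<longlonglongrightarrow> 0"
    "\<forall>\<^sub>F n in sequentially. \<forall>J. finite J \<longrightarrow> J \<subseteq> {r n..} \<longrightarrow> real (m n) * (\<Sum>j\<in>J. mixing_coeff M X j) \<le> \<beta> n"
proof
  let ?S = "\<lambda>n. of_nat (m n) * (\<Sum>h. ennreal (mixing_coeff M X (r n + h)))"
  show "(\<lambda>n. enn2real (?S n)) \<longlonglongrightarrow> 0"
    using tendsto_enn2real[of ?S 0 sequentially] mixing by simp
  have "\<forall>\<^sub>F n in sequentially. ?S n < 1"
    by (rule order_tendstoD(2)[OF mixing]) simp
  then show "\<forall>\<^sub>F n in sequentially. \<forall>J. finite J \<longrightarrow> J \<subseteq> {r n..} \<longrightarrow>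
      real (m n) * (\<Sum>j\<in>J. mixing_coeff M X j) \<le> enn2real (?S n)"
  proof eventually_elim
    case (elim n)
    show ?case
    proof (intro allI impI)
      fix J assume J: "finite J" "J \<subseteq> {r n..}"
      have "(\<Sum>j\<in>J. mixing_coeff M X j) = (\<Sum>i\<in>(\<lambda>j. j - r n) ` J. mixing_coeff M X (r n + i))"
      proof (subst sum.reindex)
        show "inj_on (\<lambda>j. j - r n) J"
          using J(2) by (auto intro: inj_on_diff_nat)
      qed (use J(2) in \<open>auto intro!: sum.cong\<close>)
      then have "ennreal (\<Sum>j\<in>J. mixing_coeff M X j) = (\<Sum>i\<in>(\<lambda>j. j - r n) ` J. ennreal (mixing_coeff M X (r n + i)))"
        by (simp add: sum_ennreal mixing_coeff_nonneg)
      also have "\<dots> \<le> (\<Sum>h. ennreal (mixing_coeff M X (r n + h)))"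
        using J by (intro sum_le_suminf) auto
      finally have le: "ennreal (real (m n) * (\<Sum>j\<in>J. mixing_coeff M X j)) \<le> ?S n"
        by (simp add: ennreal_mult sum_nonneg mixing_coeff_nonneg ennreal_of_nat_eq_real_of_nat mult_left_mono)
      have "?S n < top"
        using elim by (rule less_trans) simp
      with le have "enn2real (ennreal (real (m n) * (\<Sum>j\<in>J. mixing_coeff M X j))) \<le> enn2real (?S n)"
        by (rule enn2real_mono)
      then show "real (m n) * (\<Sum>j\<in>J. mixing_coeff M X j) \<le> enn2real (?S n)"
        by (simp add: sum_nonneg mixing_coeff_nonneg)
    qed
  qed
qed

lemma weight_tendsto: "(\<lambda>n. real (n - h) / real n) \<longlonglongrightarrow> 1"
proof (rule Lim_transform_eventually)
  show "(\<lambda>n. 1 - real h * inverse (real n)) \<longlonglongrightarrow> 1"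
    using tendsto_diff[OF tendsto_const tendsto_mult[OF tendsto_const lim_inverse_n], of 1 "real h"] by simp
  show "\<forall>\<^sub>F n in sequentially. 1 - real h * inverse (real n) = real (n - h) / real n"
    using eventually_gt_at_top[of h] by eventually_elim (simp add: field_simps of_nat_diff)
qed

lemma weight_bound: "\<bar>real (n - h) / real n * cos x * y\<bar> \<le> \<bar>y\<bar>"
proof -
  have "\<bar>real (n - h) / real n\<bar> * \<bar>cos x\<bar> \<le> 1 * 1"
    by (intro mult_mono) (auto simp: divide_le_eq)
  then show ?thesis
    using mult_right_mono[of "\<bar>real (n - h) / real n\<bar> * \<bar>cos x\<bar>" 1 "\<bar>y\<bar>"] by (simp add: abs_mult)
qed

text \<open>Common limit theorem for the sums over lags up to \<open>r n\<close>, with \<open>z\<close> standing for the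
  normalised joint probabilities or for the normalised covariances; \<open>b\<close> absorbs the centring.\<close>

lemma weighted_sum_tendsto:
  assumes z: "\<And>h. (\<lambda>n. z n h) \<longlonglongrightarrow> tau \<nu> C h"
    and bound: "\<And>n h. \<bar>z n h\<bar> \<le> real (m n) * P n h + b n"
    and b: "(\<lambda>n. real (r n) * b n) \<longlonglongrightarrow> 0" "\<And>n. 0 \<le> b n"
  shows "(\<lambda>n. \<Sum>h=1..r n. real (n - h) / real n * cos (\<theta> * real h) * z n h)
    \<longlonglongrightarrow> (\<Sum>h. cos (\<theta> * real (Suc h)) * tau \<nu> C (Suc h))"
proof -
  let ?x = "\<lambda>n h. real (n - Suc h) / real n * cos (\<theta> * real (Suc h)) * z n (Suc h)"
  have "(\<lambda>n. \<Sum>h<r n. ?x n h) \<longlonglongrightarrow> (\<Sum>h. cos (\<theta> * real (Suc h)) * tau \<nu> C (Suc h))"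
  proof (rule tendsto_suminf_uniform_tail[OF r_top])
    show "(\<lambda>n. ?x n h) \<longlonglongrightarrow> cos (\<theta> * real (Suc h)) * tau \<nu> C (Suc h)" for h
      using tendsto_mult[OF tendsto_mult[OF weight_tendsto[of "Suc h"] tendsto_const] z[of "Suc h"],
          of "cos (\<theta> * real (Suc h))"] by simp
    fix e :: real assume e: "e > 0"
    obtain k where k: "\<forall>\<^sub>F n in sequentially. real (m n) * (\<Sum>h=k..r n. P n h) < e / 2"
      using anticlustering_P[of "e / 2"] e by auto
    have "\<forall>\<^sub>F n in sequentially. real (r n) * b n < e / 2"
      by (rule order_tendstoD(2)[OF b(1)]) (use e in simp)
    with k have "\<forall>\<^sub>F n in sequentially. (\<Sum>h=k..<r n. \<bar>?x n h\<bar>) \<le> e"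
    proof eventually_elim
      case (elim n)
      have "(\<Sum>h=k..<r n. \<bar>?x n h\<bar>) \<le> (\<Sum>h=k..<r n. real (m n) * P n (Suc h) + b n)"
        by (intro sum_mono order.trans[OF weight_bound bound])
      also have "\<dots> = real (m n) * (\<Sum>h=k..<r n. P n (Suc h)) + real (r n - k) * b n"
        by (simp add: sum.distrib sum_distrib_left)
      also have "(\<Sum>h=k..<r n. P n (Suc h)) = (\<Sum>h=Suc k..<Suc (r n). P n h)"
        by (rule sum.shift_bounds_Suc_ivl[symmetric])
      also have "\<dots> \<le> (\<Sum>h=k..r n. P n h)"
        by (intro sum_mono2) (auto simp: P_nonneg)
      also have "real (r n - k) * b n \<le> real (r n) * b n"
        by (intro mult_right_mono b(2)) auto
      finally have "(\<Sum>h=k..<r n. \<bar>?x n h\<bar>) \<le> real (m n) * (\<Sum>h=k..r n. P n h) + real (r n) * b n"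
        by (simp add: mult_left_mono)
      then show ?case using elim by linarith
    qed
    then show "\<exists>k. \<forall>\<^sub>F n in sequentially. (\<Sum>h=k..<r n. \<bar>?x n h\<bar>) \<le> e" by blast
  qed
  then show ?thesis
    by (simp only: One_nat_def sum.atLeast1_atMost_eq)
qed

lemma zero_lag_tendsto: "(\<lambda>n. real (m n) * (P n 0 - (P n 0)\<^sup>2)) \<longlonglongrightarrow> tau \<nu> C 0"
  using tendsto_diff[OF mP_tendsto[of 0] mP0_sq_tendsto] by (simp add: right_diff_distrib)

lemma spectral_density_eq:
  "spectral_density \<nu> C \<theta> = tau \<nu> C 0 + 2 * (\<Sum>h. cos (\<theta> * real (Suc h)) * tau \<nu> C (Suc h))"
proof -
  have "(\<Pi>\<^sub>E i\<in>{1..1::nat}. C) = (\<Pi>\<^sub>E i\<in>{1..0 + 1}. if i = 1 \<or> i = 0 + 1 then C else UNIV)"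
  proof -
    have *: "{1..0 + 1} = {1..1 :: nat}" by simp
    show ?thesis unfolding * by (rule PiE_cong) auto
  qed
  then show ?thesis
    by (simp add: spectral_density_def tau_def)
qed

lemma lag_mean_tendsto:
  "(\<lambda>n. lag_mean (a (m n)) (m n) (r n) n \<theta>) \<longlonglongrightarrow> spectral_density \<nu> C \<theta>"
proof (rule Lim_transform_eventually)
  show "(\<lambda>n. real (m n) * (P n 0 - (P n 0)\<^sup>2) +
      2 * (\<Sum>h=1..r n. real (n - h) / real n * cos (\<theta> * real h) * (real (m n) * P n h)))
      \<longlonglongrightarrow> spectral_density \<nu> C \<theta>"
    unfolding spectral_density_eq
    by (intro tendsto_add tendsto_mult tendsto_const zero_lag_tendsto weighted_sum_tendsto[where b="\<lambda>_. 0"] mP_tendsto)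
      (simp_all add: P_nonneg)
  show "\<forall>\<^sub>F n in sequentially. real (m n) * (P n 0 - (P n 0)\<^sup>2) +
      2 * (\<Sum>h=1..r n. real (n - h) / real n * cos (\<theta> * real h) * (real (m n) * P n h)) =
      lag_mean (a (m n)) (m n) (r n) n \<theta>"
    using eventually_gt_at_top[of 0]
    by eventually_elim (simp add: lag_mean_eq P_def sum_distrib_left)
qed

lemma expectation_lag_window_tendsto:
  "(\<lambda>n. expectation (lag_window M X C (a (m n)) (m n) (r n) n \<theta>)) \<longlonglongrightarrow> spectral_density \<nu> C \<theta>"
  by (rule Lim_transform_eventually[OF lag_mean_tendsto])
    (use eventually_gt_at_top[of 0] in eventually_elim, simp add: expectation_lag_window)

text \<open>Lags up to \<open>r n\<close> behave as in the lag-window estimator, since centring is negligible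
  there. At the remaining lags centring is essential: it turns probabilities into covariances, which
  are bounded by mixing coefficients.\<close>

lemma expectation_periodogram_tendsto:
  "(\<lambda>n. expectation (periodogram M X C (a (m n)) (m n) n \<theta>)) \<longlonglongrightarrow> spectral_density \<nu> C \<theta>"
proof -
  let ?z = "\<lambda>n h. real (m n) * (P n h - (P n 0)\<^sup>2)"
  let ?y = "\<lambda>n h. real (n - h) / real n * cos (\<theta> * real h) * ?z n h"
  have head: "(\<lambda>n. \<Sum>h=1..r n. ?y n h) \<longlonglongrightarrow> (\<Sum>h. cos (\<theta> * real (Suc h)) * tau \<nu> C (Suc h))"
  proof (rule weighted_sum_tendsto[where b="\<lambda>n. real (m n) * (P n 0)\<^sup>2", OF _ _ rmP0_sq_tendsto])
    show "(\<lambda>n. ?z n h) \<longlonglongrightarrow> tau \<nu> C h" for h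
      using tendsto_diff[OF mP_tendsto[of h] mP0_sq_tendsto] by (simp add: right_diff_distrib)
    fix n h
    have "\<bar>P n h - (P n 0)\<^sup>2\<bar> \<le> P n h + (P n 0)\<^sup>2"
      using P_nonneg[of n h] zero_le_power2[of "P n 0"] by linarith
    then have "real (m n) * \<bar>P n h - (P n 0)\<^sup>2\<bar> \<le> real (m n) * (P n h + (P n 0)\<^sup>2)"
      by (rule mult_left_mono) simp
    then show "\<bar>?z n h\<bar> \<le> real (m n) * P n h + real (m n) * (P n 0)\<^sup>2"
      by (simp add: abs_mult distrib_left)
  qed simp
  obtain \<beta> where \<beta>: "\<beta> \<longlonglongrightarrow> 0"
    "\<forall>\<^sub>F n in sequentially. \<forall>J. finite J \<longrightarrow> J \<subseteq> {r n..} \<longrightarrow> real (m n) * (\<Sum>j\<in>J. mixing_coeff M X j) \<le> \<beta> n"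
    using mixing_sums by blast
  have rest: "(\<lambda>n. \<Sum>h\<in>{r n<..<n}. ?y n h) \<longlonglongrightarrow> 0"
  proof (rule Lim_null_comparison[OF _ \<beta>(1)])
    show "\<forall>\<^sub>F n in sequentially. norm (\<Sum>h\<in>{r n<..<n}. ?y n h) \<le> \<beta> n"
      using \<beta>(2)
    proof eventually_elim
      case (elim n)
      have "norm (\<Sum>h\<in>{r n<..<n}. ?y n h) \<le> (\<Sum>h\<in>{r n<..<n}. \<bar>?z n h\<bar>)"
        unfolding real_norm_def by (rule order.trans[OF sum_abs sum_mono]) (rule weight_bound)
      also have "\<dots> \<le> (\<Sum>h\<in>{r n<..<n}. real (m n) * mixing_coeff M X h)"
        by (intro sum_mono) (simp add: abs_mult P_def pair_cov_le_mixing mult_left_mono)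
      also have "\<dots> = real (m n) * (\<Sum>h\<in>{r n<..<n}. mixing_coeff M X h)"
        by (simp add: sum_distrib_left)
      also have "\<dots> \<le> \<beta> n"
        by (rule elim[rule_format]) auto
      finally show ?case .
    qed
  qed
  have "(\<lambda>n. ?z n 0 + 2 * ((\<Sum>h=1..r n. ?y n h) + (\<Sum>h\<in>{r n<..<n}. ?y n h))) \<longlonglongrightarrow>
      tau \<nu> C 0 + 2 * ((\<Sum>h. cos (\<theta> * real (Suc h)) * tau \<nu> C (Suc h)) + 0)"
    by (intro tendsto_add tendsto_mult tendsto_const zero_lag_tendsto head rest)
  then have lim: "(\<lambda>n. ?z n 0 + 2 * ((\<Sum>h=1..r n. ?y n h) + (\<Sum>h\<in>{r n<..<n}. ?y n h))) \<longlonglongrightarrow> spectral_density \<nu> C \<theta>"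
    by (simp only: spectral_density_eq add_0_right)
  show ?thesis
  proof (rule Lim_transform_eventually[OF lim])
    show "\<forall>\<^sub>F n in sequentially. ?z n 0 + 2 * ((\<Sum>h=1..r n. ?y n h) + (\<Sum>h\<in>{r n<..<n}. ?y n h)) =
        expectation (periodogram M X C (a (m n)) (m n) n \<theta>)"
      using eventually_r_less
    proof eventually_elim
      case (elim n)
      have "{1..n-1} = {1..r n} \<union> {r n<..<n}" using elim by auto
      then have "(\<Sum>h=1..n-1. ?y n h) = (\<Sum>h=1..r n. ?y n h) + (\<Sum>h\<in>{r n<..<n}. ?y n h)"
        by (simp only:) (rule sum.union_disjoint, auto)
      then show ?case
        using expectation_periodogram[of n "a (m n)" "m n" \<theta>] elim by (simp only: P_def)
    qed
  qed
qed

text \<open>With \<open>m r\<^sup>2 / n \<le> B\<close>, the three parts of the variance bound are of order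
  \<open>m S\<close>, \<open>(m p) / r\<close> for fixed \<open>k\<close>, and \<open>m A\<close>. The last two tend to zero
  as \<open>n\<close> grows, and the first is small for large \<open>k\<close> by anti-clustering.\<close>

lemma lag_variance_tendsto:
  assumes "(\<lambda>n. real (m n) * (real (r n))\<^sup>2) \<in> O(\<lambda>n. real n)"
  shows "(\<lambda>n. lag_variance (a (m n)) (m n) (r n) n \<theta>) \<longlonglongrightarrow> 0"
proof -
  let ?V = "\<lambda>n. lag_variance (a (m n)) (m n) (r n) n \<theta>"
  obtain B where B: "B > 0" "\<forall>\<^sub>F n in sequentially. norm (real (m n) * (real (r n))\<^sup>2) \<le> B * norm (real n)"
    using landau_o.bigE[OF assms] by blast
  obtain \<beta> where \<beta>: "\<beta> \<longlonglongrightarrow> 0"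
    "\<forall>\<^sub>F n in sequentially. \<forall>J. finite J \<longrightarrow> J \<subseteq> {r n..} \<longrightarrow> real (m n) * (\<Sum>j\<in>J. mixing_coeff M X j) \<le> \<beta> n"
    using mixing_sums by blast
  have bound: "\<forall>\<^sub>F n in sequentially. ?V n \<le> 80 * B * (real (m n) * (\<Sum>h=k..r n. P n h))
      + (20 * (real k + 1)\<^sup>2 * (B * inverse (real (r n)) * (real (m n) * P n 0)) + 32 * (B * \<beta> n))" for k
    using B(2) \<beta>(2) eventually_r_pos eventually_gt_at_top[of 0]
  proof eventually_elim
    case (elim n)
    define A where "A = (\<Sum>d\<in>{2 * r n<..<n}. mixing_coeff M X (d - r n))"
    define S where "S = (\<Sum>h=k..r n. P n h)"
    define \<rho> where "\<rho> = real (r n)"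
    \<comment> \<open>the ratio that the growth condition bounds by \<open>B\<close>\<close>
    define \<kappa> where "\<kappa> = real (m n) * \<rho>\<^sup>2 / real n"
    have \<rho>: "1 \<le> \<rho>" using elim(3) by (simp add: \<rho>_def)
    have n: "0 < real n" using elim(4) by simp
    have \<kappa>: "0 \<le> \<kappa>" "\<kappa> \<le> B" using elim(1) n by (simp_all add: \<kappa>_def \<rho>_def divide_le_eq)
    have S: "0 \<le> S" by (simp add: S_def sum_nonneg P_nonneg)
    have A0: "0 \<le> A" by (simp add: A_def sum_nonneg mixing_coeff_nonneg)
    have "A = (\<Sum>j\<in>(\<lambda>d. d - r n) ` {2 * r n<..<n}. mixing_coeff M X j)"
      unfolding A_def by (subst sum.reindex) (auto simp: inj_on_def)
    then have A: "real (m n) * A \<le> \<beta> n"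
      by (simp only:) (rule elim(2)[rule_format], auto)
    have P0: "0 \<le> P n 0" by (rule P_nonneg)
    \<comment> \<open>\<open>r n\<close> is at least one, so lower-order terms in it are absorbed into constants\<close>
    have "?V n \<le> (2 * real (m n) / real n)\<^sup>2 * (real n *
        ((1 + 4 * \<rho>) * (2 * (\<rho> + 1) * S + (real k + 1)\<^sup>2 * P n 0) + 2 * (\<rho> + 1)\<^sup>2 * A))"
      using lag_variance_le[of "a (m n)" "m n" "r n" n \<theta> k] by (simp only: A_def S_def \<rho>_def P_def)
    also have "\<dots> \<le> (2 * real (m n) / real n)\<^sup>2 * (real n *
        ((5 * \<rho>) * (2 * (2 * \<rho>) * S + (real k + 1)\<^sup>2 * P n 0) + 2 * (2 * \<rho>)\<^sup>2 * A))"
      using \<rho> S A0 P0 by (intro mult_left_mono add_mono mult_mono power_mono) auto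
    also have "\<dots> = 80 * \<kappa> * (real (m n) * S) + 20 * (real k + 1)\<^sup>2 * (\<kappa> * inverse \<rho> * (real (m n) * P n 0))
        + 32 * (\<kappa> * (real (m n) * A))"
      using n \<rho> by (simp add: \<kappa>_def power2_eq_square field_simps)
    also have "\<dots> \<le> 80 * B * (real (m n) * S) + 20 * (real k + 1)\<^sup>2 * (B * inverse \<rho> * (real (m n) * P n 0))
        + 32 * (B * \<beta> n)"
      using \<kappa> \<rho> S A0 P0 A by (intro add_mono mult_mono mult_left_mono mult_right_mono) auto
    finally show ?case
      by (simp add: S_def \<rho>_def)
  qed
  have "(\<lambda>n. inverse (real (r n))) \<longlonglongrightarrow> 0"
    using filterlim_compose[OF lim_inverse_n r_top] by simp
  then have zero: "(\<lambda>n. B * inverse (real (r n)) * (real (m n) * P n 0)) \<longlonglongrightarrow> B * 0 * tau \<nu> C 0"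
    by (intro tendsto_mult tendsto_const mP_tendsto)
  have small: "(\<lambda>n. 20 * (real k + 1)\<^sup>2 * (B * inverse (real (r n)) * (real (m n) * P n 0)) + 32 * (B * \<beta> n))
      \<longlonglongrightarrow> 20 * (real k + 1)\<^sup>2 * (B * 0 * tau \<nu> C 0) + 32 * (B * 0)" for k
    by (intro tendsto_add tendsto_mult[OF tendsto_const] zero \<beta>(1))
  show ?thesis
  proof (rule tendstoI)
    fix e :: real assume e: "e > 0"
    \<comment> \<open>the leading term of the bound has the factor \<open>80 * B\<close> and gets half of \<open>e\<close>\<close>
    obtain k where k: "\<forall>\<^sub>F n in sequentially. real (m n) * (\<Sum>h=k..r n. P n h) < e / (160 * B)"
      using anticlustering_P[of "e / (160 * B)"] e B(1) by auto
    have "\<forall>\<^sub>F n in sequentially. 20 * (real k + 1)\<^sup>2 * (B * inverse (real (r n)) * (real (m n) * P n 0)) + 32 * (B * \<beta> n) < e / 2"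
      by (rule order_tendstoD(2)[OF small]) (use e in simp)
    with k bound[of k] eventually_gt_at_top[of 0] show "\<forall>\<^sub>F n in sequentially. dist (?V n) 0 < e"
    proof eventually_elim
      case (elim n)
      have "80 * B * (real (m n) * (\<Sum>h=k..r n. P n h)) < e / 2"
        using elim(1) B(1) by (simp add: field_simps)
      then have "?V n < e" using elim(2,4) by linarith
      then show ?case
        using lag_variance_nonneg[OF elim(3), of "a (m n)" "m n" "r n" \<theta>] by (simp add: dist_real_def)
    qed
  qed
qed

lemma mse_tendsto:
  assumes "(\<lambda>n. real (m n) * (real (r n))\<^sup>2) \<in> O(\<lambda>n. real n)"
  shows "(\<lambda>n. expectation (\<lambda>w. (lag_window M X C (a (m n)) (m n) (r n) n \<theta> w - spectral_density \<nu> C \<theta>)\<^sup>2)) \<longlonglongrightarrow> 0"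
proof (rule Lim_transform_eventually)
  have "(\<lambda>n. lag_variance (a (m n)) (m n) (r n) n \<theta> +
      (lag_mean (a (m n)) (m n) (r n) n \<theta> - spectral_density \<nu> C \<theta>)\<^sup>2)
      \<longlonglongrightarrow> 0 + (spectral_density \<nu> C \<theta> - spectral_density \<nu> C \<theta>)\<^sup>2"
    by (intro tendsto_add tendsto_power tendsto_diff lag_variance_tendsto lag_mean_tendsto tendsto_const assms)
  then show "(\<lambda>n. lag_variance (a (m n)) (m n) (r n) n \<theta> +
      (lag_mean (a (m n)) (m n) (r n) n \<theta> - spectral_density \<nu> C \<theta>)\<^sup>2) \<longlonglongrightarrow> 0"
    by simp
  show "\<forall>\<^sub>F n in sequentially. lag_variance (a (m n)) (m n) (r n) n \<theta> +
      (lag_mean (a (m n)) (m n) (r n) n \<theta> - spectral_density \<nu> C \<theta>)\<^sup>2 =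
      expectation (\<lambda>w. (lag_window M X C (a (m n)) (m n) (r n) n \<theta> w - spectral_density \<nu> C \<theta>)\<^sup>2)"
    using eventually_gt_at_top[of 0] by eventually_elim (simp add: mse_lag_window lag_variance_def)
qed

end


section \<open>Consistency of the spectral estimators\<close>

theorem theorem5p1:
  fixes M :: "'w measure"
    and X :: "int \<Rightarrow> 'w \<Rightarrow> real ^ 'd"
    and \<alpha> :: real
    and \<mu> :: "nat \<Rightarrow> (nat \<Rightarrow> ereal ^ 'd) measure"
    and a :: "nat \<Rightarrow> real"
    and C :: "(ereal ^ 'd) set"
    and m r :: "nat \<Rightarrow> nat"
  assumes "prob_space M"
    and "strictly_stationary M X"
    and "regularly_varying M X \<alpha> \<mu>"
    and "incseq a"
    and "filterlim a at_top sequentially"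
    and "asymp_equiv (\<lambda>n. measure M {w \<in> space M. norm (X 0 w) > a n}) at_top (\<lambda>n. 1 / real n)"
    and "C \<in> sets borel"
    and "bounded_away_from_zero C"
    and "\<And>k. k \<ge> 1 \<Longrightarrow> continuity_set (ext_space0 k) (\<mu> k) (\<Pi>\<^sub>E i\<in>{1..k}. C)"
    and "mixing_coeff M X \<longlonglongrightarrow> 0"
    and "filterlim m at_top sequentially"
    and "filterlim r at_top sequentially"
    and "(\<lambda>n. real (m n) / real n) \<longlonglongrightarrow> 0"
    and "(\<lambda>n. real (r n) / real (m n)) \<longlonglongrightarrow> 0"
    and "(\<lambda>n. of_nat (m n) * (\<Sum>h. ennreal (mixing_coeff M X (r n + h)))) \<longlonglongrightarrow> 0"
    and "\<And>\<epsilon>. \<epsilon> > 0 \<Longrightarrow>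
           (\<lambda>k. limsup (\<lambda>n. ereal (real (m n) *
              (\<Sum>h=k..r n. measure M {w \<in> space M.
                 norm (X (int h) w) > \<epsilon> * a (m n) \<and> norm (X 0 w) > \<epsilon> * a (m n)})))) \<longlonglongrightarrow> 0"
  shows "(\<forall>\<theta>\<in>{0<..<pi}.
            (\<lambda>n. integral\<^sup>L M (periodogram M X C (a (m n)) (m n) n \<theta>))
              \<longlonglongrightarrow> spectral_density (tail_measure M X a \<mu>) C \<theta> \<and>
            (\<lambda>n. integral\<^sup>L M (lag_window M X C (a (m n)) (m n) (r n) n \<theta>))
              \<longlonglongrightarrow> spectral_density (tail_measure M X a \<mu>) C \<theta>) \<and>
         ((\<lambda>n. real (m n) * (real (r n))\<^sup>2) \<in> O(\<lambda>n. real n) \<longrightarrow>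
          (\<forall>\<theta>\<in>{0<..<pi}.
            (\<lambda>n. integral\<^sup>L M (\<lambda>w. (lag_window M X C (a (m n)) (m n) (r n) n \<theta> w
                   - spectral_density (tail_measure M X a \<mu>) C \<theta>)\<^sup>2)) \<longlonglongrightarrow> 0))"
proof -
  interpret prob_space M by fact
  interpret stationary_sequence M X
    by unfold_locales fact
  interpret regularly_varying_sequence M X \<alpha> \<mu> a
    by unfold_locales fact+
  have "continuity_set (ext_space0 1) (\<mu> 1) (\<Pi>\<^sub>E i\<in>{1..1}. C)"
    by (rule assms(9)) simp
  then interpret extremal_set M X \<alpha> \<mu> a C
    using assms(7,8) by unfold_locales
  interpret lag_window_regime M X \<alpha> \<mu> a C m r
    by unfold_locales (fact assms)+
  show ?thesis
    by (intro conjI ballI impI expectation_periodogram_tendsto expectation_lag_window_tendsto mse_tendsto)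
qed

end
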